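(* Let $p$ be an odd prime, $K/\mathbb Q_p$ a finite extension and $G=\mathbb Z_p^\times$. In the localized Iwasawa algebra $\Sigma^{-1}\Lambda_K(G)$, $$\mathcal Z_{1/2}=(\delta_1-\delta_{2^{-1}})\star\mathcal Z_p.$$ Equivalently, on the $j$-th branch, $j\in\mathbb Z/(p-1)\mathbb Z$, $$Z_{1/2,j}(s):=\mathcal M_{\mathcal Z_{1/2},j}(s)=\bigl(1-\omega(2)^{-j}\langle2\rangle^{-s}\bigr)\,\zeta_{p,j}(-s).$$ At every integer $n\ge0$ with $n\equiv j\pmod{p-1}$ one has $$Z_{1/2,j}(n)=(1-p^n)\frac{B_{n+1}(1/2)}{n+1}.$$ Moreover, $$\operatorname{Res}_{s=-1}Z_{1/2,-1}(s)=1-p^{-1}.$$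
   Context: $\mathcal O$ is the valuation ring of $K$; $\Lambda_K(G)=\mathcal O[[G]][1/p]$ is the algebra of bounded $K$-valued measures on $G$ under multiplicative convolution $\star$ (push-forward of the product under $(x,y)\mapsto xy$); $\delta_u$ is the Dirac measure at $u$. For odd integers $c>1$ prime to $p$, $r_c=\delta_1-c\,\delta_c$, and $\Sigma$ is the multiplicative set generated by all $r_c$ (non-zero-divisors). **Half-shift zeta pseudomeasure.** $\lambda_{1/2,c}$ is the bounded measure on $\mathbb Z_p$ with $\int_{\mathbb Z_p}(1+T)^xd\lambda_{1/2,c}(x)=\frac{(1+T)^{1/2}}T-c\frac{(1+T)^{c/2}}{(1+T)^c-1}$, $\lambda_{1/2,c}^\times$ its restriction to $G$, and $\mathcal Z_{1/2}=r_c^{-1}\star\lambda^\times_{1/2,c}\in\Sigma^{-1}\Lambda_K(G)$, independent of $c$. **Classical zeta pseudomeasure.** $\mathcal Z_p\in\Sigma^{-1}\Lambda_K(G)$ is the classical Iwasawa zeta pseudomeasure: for every odd $c>1$ prime to $p$, $r_c\star\mathcal Z_p$ is an integral bounded measure with $\int_Gx^n\,d(r_c\star\mathcal Z_p)(x)=-(1-c^{n+1})(1-p^n)\frac{B_{n+1}}{n+1}$ for all $n\ge0$. **Branches.** For $x\in\mathbb Z_p^\times$ write $x=\omega(x)\langle x\rangle$ with $\omega(x)\in\mu_{p-1}$, $\langle x\rangle\in1+p\mathbb Z_p$. For $\rho\in\Lambda_K(G)$, $\mathcal M_{\rho,j}(s)=\int_G\omega(x)^j\langle x\rangle^sd\rho(x)$;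 for $Q=A/r$ in the localization, $\mathcal M_{Q,j}=\mathcal M_{A,j}/\mathcal M_{r,j}$ (meromorphic in $s$). Put $\zeta_{p,j}(u)=\mathcal M_{\mathcal Z_p,j}(-u)$; the exceptional branch $\zeta_p=\zeta_{p,-1}$ is the classical $p$-adic zeta function with its standard simple pole, normalized by $\operatorname{Res}_{u=1}\zeta_p(u)=1-p^{-1}$. $B_n(x)$ are Bernoulli polynomials, $B_n=B_n(0)$. *)

theory Defs
  imports
    "HOL-Analysis.Analysis"
    "HOL-Algebra.Ring"
    "HOL-Computational_Algebra.Computational_Algebra"
    "HOL-Number_Theory.Cong"
begin

section \<open>Finite extensions of the field of p-adic numbers\<close>

text \<open>
  A field that is complete for a multiplicative ultrametric absolute value; the absolute value
  is the distance to \<open>0\<close>, so that the library's limits, series and continuity apply.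
\<close>

class complete_ultrametric_field = field_char_0 + complete_space +
  assumes dist_diff: "dist x y = dist (x - y) 0"
    and dist_mult: "dist (x * y) 0 = dist x 0 * dist y 0"
    and dist_ultra: "dist (x + y) 0 \<le> max (dist x 0) (dist y 0)"

definition vabs :: "'k::complete_ultrametric_field \<Rightarrow> real" where
  "vabs x = dist x 0"

text \<open>
  When \<open>vabs p = 1/p\<close>, the closure of \<open>\<rat>\<close> in the complete field \<open>'k\<close> is the completion of
  \<open>\<rat>\<close> at the p-adic absolute value. A finite extension of it carries a unique extension of that
  absolute value and is complete for it, which is the structure fixed by the class.
\<close>

definition Qp :: "'k::complete_ultrametric_field set" where
  "Qp = closure \<rat>"

definition finite_extension_of_Qp :: "nat \<Rightarrow> 'k::complete_ultrametric_field itself \<Rightarrow> bool" where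
  "finite_extension_of_Qp p _ \<longleftrightarrow>
     prime p \<and> vabs (of_nat p :: 'k) = 1 / real p \<and>
     (\<exists>B :: 'k set. finite B \<and> (\<forall>x. \<exists>a. (\<forall>b\<in>B. a b \<in> Qp) \<and> x = (\<Sum>b\<in>B. a b * b)))"

definition Zp :: "'k::complete_ultrametric_field set" where
  "Zp = {x \<in> Qp. vabs x \<le> 1}"

definition Zp_units :: "'k::complete_ultrametric_field set" where
  "Zp_units = {x \<in> Zp. \<exists>y\<in>Zp. x * y = 1}"


section \<open>Bounded measures and the Iwasawa algebra\<close>

text \<open>
  A bounded measure on \<open>X\<close> is identified with its integration functional
  \<open>f \<mapsto> \<integral>\<^sub>X f d\<mu>\<close>, a bounded linear functional on the continuous functions \<open>X \<rightarrow> K\<close>. Functions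
  on \<open>X\<close> are represented by functions on all of \<open>'k\<close>; boundedness forces \<open>\<mu> f\<close> to depend on
  \<open>f\<close> only through its restriction to \<open>X\<close>. The value on functions that are not continuous
  on \<open>X\<close> is set to \<open>0\<close>, so that equal measures are equal as HOL functions.
\<close>

type_synonym 'k functional = "('k \<Rightarrow> 'k) \<Rightarrow> 'k"

definition bounded_measures :: "'k::complete_ultrametric_field set \<Rightarrow> 'k functional set" where
  "bounded_measures X = {\<mu>.
     (\<forall>f g. continuous_on X f \<longrightarrow> continuous_on X g \<longrightarrow> \<mu> (\<lambda>x. f x + g x) = \<mu> f + \<mu> g) \<and>
     (\<forall>a f. continuous_on X f \<longrightarrow> \<mu> (\<lambda>x. a * f x) = a * \<mu> f) \<and>
     (\<exists>C. \<forall>f b. continuous_on X f \<longrightarrow> (\<forall>x\<in>X. vabs (f x) \<le> b) \<longrightarrow> vabs (\<mu> f) \<le> C * b) \<and>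
     (\<forall>f. \<not> continuous_on X f \<longrightarrow> \<mu> f = 0)}"

text \<open>Measures with values in the valuation ring of \<open>K\<close>.\<close>

definition integral_measures :: "'k::complete_ultrametric_field set \<Rightarrow> 'k functional set" where
  "integral_measures X = {\<mu> \<in> bounded_measures X.
     \<forall>f. continuous_on X f \<longrightarrow> (\<forall>x\<in>X. vabs (f x) \<le> 1) \<longrightarrow> vabs (\<mu> f) \<le> 1}"

definition dirac :: "'k::complete_ultrametric_field set \<Rightarrow> 'k \<Rightarrow> 'k functional" where
  "dirac X u = (\<lambda>f. if continuous_on X f then f u else 0)"

definition restrict_measure ::
    "'k::complete_ultrametric_field set \<Rightarrow> 'k functional \<Rightarrow> 'k functional" where
  "restrict_measure Y \<mu> =
     (\<lambda>f. if continuous_on Y f then \<mu> (\<lambda>x. if x \<in> Y then f x else 0) else 0)"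

text \<open>\<open>\<integral> f d(\<mu> \<star> \<nu>) = \<integral>\<integral> f(x y) d\<nu>(y) d\<mu>(x)\<close>.\<close>

definition convolution ::
    "'k::complete_ultrametric_field set \<Rightarrow> 'k functional \<Rightarrow> 'k functional \<Rightarrow> 'k functional" where
  "convolution X \<mu> \<nu> =
     (\<lambda>f. if continuous_on X f then \<mu> (\<lambda>x. \<nu> (\<lambda>y. f (x * y))) else 0)"

definition Iwasawa_algebra :: "'k::complete_ultrametric_field functional ring" where
  "Iwasawa_algebra =
     \<lparr> carrier = bounded_measures Zp_units,
       mult = convolution Zp_units,
       one = dirac Zp_units 1,
       zero = (\<lambda>f. 0),
       add = (\<lambda>\<mu> \<nu> f. \<mu> f + \<nu> f) \<rparr>"

definition r_elt :: "nat \<Rightarrow> 'k::complete_ultrametric_field functional" where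
  "r_elt c = (\<lambda>f. dirac Zp_units 1 f - of_nat c * dirac Zp_units (of_nat c) f)"

inductive_set denominators :: "nat \<Rightarrow> 'k::complete_ultrametric_field functional set" for p where
  one: "\<one>\<^bsub>Iwasawa_algebra\<^esub> \<in> denominators p"
| mult: "\<lbrakk>odd c; c > 1; coprime c p; \<rho> \<in> denominators p\<rbrakk>
    \<Longrightarrow> r_elt c \<otimes>\<^bsub>Iwasawa_algebra\<^esub> \<rho> \<in> denominators p"


section \<open>Localization of a commutative ring\<close>

definition loc_rel :: "('a, 'b) ring_scheme \<Rightarrow> 'a set \<Rightarrow> (('a \<times> 'a) \<times> ('a \<times> 'a)) set" where
  "loc_rel R S = {((a, s), (b, t)).
     a \<in> carrier R \<and> b \<in> carrier R \<and> s \<in> S \<and> t \<in> S \<and>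
     (\<exists>u\<in>S. u \<otimes>\<^bsub>R\<^esub> (a \<otimes>\<^bsub>R\<^esub> t) = u \<otimes>\<^bsub>R\<^esub> (b \<otimes>\<^bsub>R\<^esub> s))}"

definition loc_frac :: "('a, 'b) ring_scheme \<Rightarrow> 'a set \<Rightarrow> 'a \<Rightarrow> 'a \<Rightarrow> ('a \<times> 'a) set" where
  "loc_frac R S a s = loc_rel R S `` {(a, s)}"

definition localization :: "('a, 'b) ring_scheme \<Rightarrow> 'a set \<Rightarrow> ('a \<times> 'a) set ring" where
  "localization R S =
     \<lparr> carrier = (carrier R \<times> S) // loc_rel R S,
       mult = (\<lambda>X Y. \<Union>(a, s)\<in>X. \<Union>(b, t)\<in>Y. loc_frac R S (a \<otimes>\<^bsub>R\<^esub> b) (s \<otimes>\<^bsub>R\<^esub> t)),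
       one = loc_frac R S \<one>\<^bsub>R\<^esub> \<one>\<^bsub>R\<^esub>,
       zero = loc_frac R S \<zero>\<^bsub>R\<^esub> \<one>\<^bsub>R\<^esub>,
       add = (\<lambda>X Y. \<Union>(a, s)\<in>X. \<Union>(b, t)\<in>Y.
         loc_frac R S ((a \<otimes>\<^bsub>R\<^esub> t) \<oplus>\<^bsub>R\<^esub> (b \<otimes>\<^bsub>R\<^esub> s)) (s \<otimes>\<^bsub>R\<^esub> t)) \<rparr>"

type_synonym 'k pseudomeasure = "('k functional \<times> 'k functional) set"

abbreviation pseudomeasures :: "nat \<Rightarrow> 'k::complete_ultrametric_field pseudomeasure ring" where
  "pseudomeasures p \<equiv> localization Iwasawa_algebra (denominators p)"

abbreviation pfrac :: "nat \<Rightarrow> 'k::complete_ultrametric_field functional \<Rightarrow> 'k functional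
    \<Rightarrow> 'k pseudomeasure" where
  "pfrac p \<equiv> loc_frac Iwasawa_algebra (denominators p)"

abbreviation of_measure :: "nat \<Rightarrow> 'k::complete_ultrametric_field functional
    \<Rightarrow> 'k pseudomeasure" where
  "of_measure p \<mu> \<equiv> pfrac p \<mu> \<one>\<^bsub>Iwasawa_algebra\<^esub>"


section \<open>The two zeta pseudomeasures\<close>

text \<open>\<open>t e\<^bsup>xt\<^esup> / (e\<^bsup>t\<^esup> - 1) = \<Sum>n. B\<^sub>n(x) t\<^bsup>n\<^esup> / n!\<close>.\<close>

definition bernpoly :: "nat \<Rightarrow> 'k::field_char_0 \<Rightarrow> 'k" where
  "bernpoly n x = fact n * fps_nth (fps_X * fps_exp x / (fps_exp 1 - 1)) n"

text \<open>
  The power series \<open>\<integral> (1 + T)\<^bsup>x\<^esup> d\<lambda>(x)\<close>, where \<open>(1 + T)\<^bsup>x\<^esup> = \<Sum>n. (x gchoose n) T\<^bsup>n\<^esup>\<close>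
  (this is \<^const>\<open>fps_binomial\<close>) is integrated coefficientwise.
\<close>

definition amice_transform :: "'k::complete_ultrametric_field functional \<Rightarrow> 'k fps" where
  "amice_transform \<mu> = Abs_fps (\<lambda>n. \<mu> (\<lambda>x. x gchoose n))"

text \<open>
  The two summands on the right-hand side have a pole at \<open>T = 0\<close>, so the identity is
  read in the field of formal Laurent series.
\<close>

definition is_half_shift_measure :: "nat \<Rightarrow> 'k::complete_ultrametric_field functional \<Rightarrow> bool" where
  "is_half_shift_measure c \<mu> \<longleftrightarrow>
     \<mu> \<in> bounded_measures Zp \<and>
     fps_to_fls (amice_transform \<mu>) =
       fps_to_fls (fps_binomial (1/2)) / fls_X
       - of_nat c * (fps_to_fls (fps_binomial (of_nat c / 2)) / ((1 + fls_X) ^ c - 1))"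

definition is_half_shift_zeta :: "nat \<Rightarrow> 'k::complete_ultrametric_field pseudomeasure \<Rightarrow> bool" where
  "is_half_shift_zeta p Z \<longleftrightarrow>
     (\<exists>c \<mu>. odd c \<and> c > 1 \<and> coprime c p \<and> is_half_shift_measure c \<mu> \<and>
       Z = pfrac p (restrict_measure Zp_units \<mu>) (r_elt c))"

definition is_classical_zeta :: "nat \<Rightarrow> 'k::complete_ultrametric_field pseudomeasure \<Rightarrow> bool" where
  "is_classical_zeta p Z \<longleftrightarrow>
     Z \<in> carrier (pseudomeasures p) \<and>
     (\<forall>c. odd c \<and> c > 1 \<and> coprime c p \<longrightarrow>
       (\<exists>\<rho> \<in> integral_measures Zp_units.
          of_measure p (r_elt c) \<otimes>\<^bsub>pseudomeasures p\<^esub> Z = of_measure p \<rho> \<and>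
          (\<forall>n. \<rho> (\<lambda>x. x ^ n) =
             - ((1 - of_nat c ^ (n + 1)) * (1 - of_nat p ^ n) *
                (bernpoly (n + 1) 0 / of_nat (n + 1))))))"


section \<open>Branches\<close>

definition teichmueller :: "nat \<Rightarrow> 'k::complete_ultrametric_field \<Rightarrow> 'k" where
  "teichmueller p x = (THE w. w ^ (p - 1) = 1 \<and> (\<exists>y\<in>Zp. x / w = 1 + of_nat p * y))"

definition angle :: "nat \<Rightarrow> 'k::complete_ultrametric_field \<Rightarrow> 'k" where
  "angle p x = x / teichmueller p x"

text \<open>
  For \<open>a \<in> 1 + p Zp\<close> and odd \<open>p\<close> the binomial series \<open>a\<^bsup>s\<^esup>\<close> converges on the following disc
  of \<open>K\<close>, which contains \<open>Zp\<close> and the valuation ring of \<open>K\<close>.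
\<close>

definition padic_power :: "'k::complete_ultrametric_field \<Rightarrow> 'k \<Rightarrow> 'k" where
  "padic_power a s = (\<Sum>k. (s gchoose k) * (a - 1) ^ k)"

definition power_disc :: "nat \<Rightarrow> 'k::complete_ultrametric_field set" where
  "power_disc p = {s. vabs s < real p powr (1 - 1 / (real p - 1))}"

definition mellin :: "nat \<Rightarrow> 'k::complete_ultrametric_field functional \<Rightarrow> int \<Rightarrow> 'k \<Rightarrow> 'k" where
  "mellin p \<rho> j s = \<rho> (\<lambda>x. teichmueller p x powi j * padic_power (angle p x) s)"

text \<open>
  A pseudomeasure is the set of pairs \<open>(A, r)\<close> representing it. Its branch takes at \<open>s\<close> the
  value \<open>M\<^sub>A(s) / M\<^sub>r(s)\<close> for any representative with \<open>M\<^sub>r(s) \<noteq> 0\<close>; it is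
  unspecified where there is none.
\<close>

definition branch :: "nat \<Rightarrow> 'k::complete_ultrametric_field pseudomeasure \<Rightarrow> int \<Rightarrow> 'k \<Rightarrow> 'k" where
  "branch p Q j s =
     (THE v. \<exists>(A, r)\<in>Q. mellin p r j s \<noteq> 0 \<and> v = mellin p A j s / mellin p r j s)"

text \<open>\<open>\<zeta>\<^bsub>p,j\<^esub>(u)\<close>, for \<open>Z\<close> the classical zeta pseudomeasure.\<close>

definition zeta_branch ::
    "nat \<Rightarrow> 'k::complete_ultrametric_field pseudomeasure \<Rightarrow> int \<Rightarrow> 'k \<Rightarrow> 'k" where
  "zeta_branch p Z j u = branch p Z j (- u)"

text \<open>
  \<open>f\<close> has a convergent Laurent expansion with finite principal part on a punctured disc
  around \<open>a\<close>, with residue \<open>R\<close>.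
\<close>

definition has_residue ::
    "('k::complete_ultrametric_field \<Rightarrow> 'k) \<Rightarrow> 'k \<Rightarrow> 'k \<Rightarrow> bool" where
  "has_residue f a R \<longleftrightarrow>
     (\<exists>F :: 'k fls. \<exists>\<epsilon>>0.
        (\<forall>s. 0 < vabs (s - a) \<and> vabs (s - a) < \<epsilon> \<longrightarrow>
          (\<lambda>n. fls_nth F (fls_subdegree F + int n) * (s - a) powi (fls_subdegree F + int n))
            sums f s) \<and>
        R = fls_residue F)"

end

theory Submission
  imports Defs "HOL-Number_Theory.Number_Theory"
begin

text \<open>
  Write \<open>G = Zp\<^sup>\<times>\<close>. A bounded measure on \<open>G\<close> is determined by its moments \<open>\<integral> x\<^sup>n\<close>, \<open>n \<ge> 0\<close>,
  because polynomials are dense in the continuous functions on \<open>G\<close>, and the moments of a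
  convolution are products of moments. This makes the Iwasawa algebra a commutative monoid in which
  each \<open>r\<^sub>c\<close>, with moments \<open>1 - c\<^bsup>n+1\<^esup> \<noteq> 0\<close>, can be cancelled, and it reduces the first claim to an
  equality of moments: for the measure \<open>\<rho>\<close> with \<open>r\<^sub>c \<star> Z = \<rho>\<close>, the restriction to \<open>G\<close> of the
  half-shift measure \<open>\<lambda>\<close> has to have the moments \<open>(1 - 2\<^bsup>-n\<^esup>) \<integral> x\<^sup>n d\<rho>\<close>.

  On \<open>Zp\<close>, the substitution \<open>T = e\<^sup>t - 1\<close> in the Amice transform gives
  \<open>\<integral> x\<^sup>n d\<lambda> = (1 - c\<^bsup>n+1\<^esup>) B\<^bsub>n+1\<^esub>(1/2) / (n+1)\<close>, and \<open>B\<^bsub>n+1\<^esub>(1/2) = (2\<^bsup>-n\<^esup> - 1) B\<^bsub>n+1\<^esub>\<close>. Hence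
  \<open>(1 - p\<^sup>n) \<integral>\<^bsub>Zp\<^esub> x\<^sup>n d\<lambda> = (1 - 2\<^bsup>-n\<^esup>) \<integral>\<^bsub>G\<^esub> x\<^sup>n d\<rho>\<close>. To restrict \<open>\<lambda>\<close> to \<open>G\<close>,
  replace \<open>n\<close> by \<open>n + (p-1) p\<^sup>k\<close> and let \<open>k\<close> tend
  to infinity. As \<open>x\<^bsup>(p-1) p^k\<^esup>\<close> tends uniformly on \<open>Zp\<close> to the indicator function of \<open>G\<close>,
  the left-hand side tends to \<open>\<integral>\<^bsub>G\<^esub> x\<^sup>n d\<lambda>\<close>, and the right-hand side to
  \<open>(1 - 2\<^bsup>-n\<^esup>) \<integral>\<^bsub>G\<^esub> x\<^sup>n d\<rho>\<close> (\<open>half_shift_restricted_moment\<close>, \<open>half_shift_eq_convolution\<close>).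

  The Mellin transform at \<open>(j, s)\<close> integrates the character \<open>\<omega>(x)\<^sup>j \<langle>x\<rangle>\<^sup>s\<close> of \<open>G\<close>, so it is
  multiplicative, and the branch of a pseudomeasure can be computed from any representative whose
  denominator does not vanish there (\<open>branch_pfrac\<close>). Away from \<open>j \<equiv> -1\<close>, \<open>s = -1\<close> some \<open>r\<^sub>c\<close> qualifies
  (\<open>ex_mellin_r_elt_nonzero\<close>). That \<open>a \<mapsto> a\<^sup>s\<close> is multiplicative follows from its being analytic in
  \<open>s\<close> (\<open>newton_series_analytic\<close>) and the identity theorem, since the integers accumulate at \<open>0\<close>.
  At \<open>s = n \<equiv> j\<close> the character is \<open>x\<^sup>n\<close>, and the branch is a quotient of moments.

  Near \<open>s = -1\<close> put \<open>h = s + 1\<close>. On the branch \<open>j = -1\<close> the denominator is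
  \<open>1 - \<langle>c\<rangle>\<^sup>h = - h (log \<langle>c\<rangle> + \<dots>)\<close>, so the residue is \<open>- \<integral> x\<^bsup>-1\<^esup> d\<lambda> / log \<langle>c\<rangle>\<close>. The
  integral is the limit of the moments of index \<open>(p-1) p\<^sup>k - 1\<close>; it equals \<open>- (1 - 1/p) log \<langle>c\<rangle>\<close>
  because \<open>(c\<^sup>m - 1) / m\<close> tends to \<open>log \<langle>c\<rangle>\<close> and \<open>B\<^sub>m\<close> to \<open>1 - 1/p\<close> along \<open>m = (p-1) p\<^sup>k\<close>
  (\<open>half_shift_inverse_moment\<close>, \<open>bernoulli_phi_tendsto\<close>).
\<close>

section \<open>Ultrametric fields\<close>

lemma dist_vabs: "dist x y = vabs (x - y)"
  unfolding vabs_def by (rule dist_diff)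

lemma vabs_nonneg [simp]: "0 \<le> vabs x"
  by (simp add: vabs_def)

lemma vabs_zero [simp]: "vabs 0 = 0"
  by (simp add: vabs_def)

lemma vabs_eq_0_iff [simp]: "vabs x = 0 \<longleftrightarrow> x = 0"
  by (simp add: vabs_def)

lemma vabs_pos_iff [simp]: "0 < vabs x \<longleftrightarrow> x \<noteq> 0"
  using vabs_nonneg[of x] vabs_eq_0_iff[of x] by linarith

lemma vabs_mult: "vabs (x * y) = vabs x * vabs y"
  by (simp add: vabs_def dist_mult)

lemma vabs_one [simp]: "vabs (1 :: 'k::complete_ultrametric_field) = 1"
  using vabs_mult[of "1::'k" 1] by simp

lemma vabs_power: "vabs (x ^ n) = vabs x ^ n"
  by (induction n) (simp_all add: vabs_mult)

lemma vabs_inverse: "vabs (inverse x) = inverse (vabs x)"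
proof (cases "x = 0")
  case False
  then have "vabs x * vabs (inverse x) = 1"
    by (metis right_inverse vabs_mult vabs_one)
  then show ?thesis
    using inverse_unique by metis
qed simp

lemma vabs_divide: "vabs (x / y) = vabs x / vabs y"
  by (simp add: divide_inverse vabs_mult vabs_inverse)

lemma vabs_minus [simp]: "vabs (- x) = vabs x"
proof -
  have "vabs (- 1 :: 'a) * vabs (- 1 :: 'a) = 1"
    by (metis mult_minus1_right minus_minus vabs_mult vabs_one)
  then have "vabs (- 1 :: 'a) = 1"
    using vabs_nonneg[of "-1::'a"] by (metis abs_of_nonneg power2_eq_1_iff power2_eq_square abs_1 abs_minus_cancel)
  then show ?thesis
    by (metis mult_1 mult_minus1 vabs_mult)
qed

lemma vabs_diff_commute: "vabs (x - y) = vabs (y - x)"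
  by (metis minus_diff_eq vabs_minus)

lemma vabs_add_le: "vabs x \<le> b \<Longrightarrow> vabs y \<le> b \<Longrightarrow> vabs (x + y) \<le> b"
  unfolding vabs_def using dist_ultra[of x y] by linarith

lemma vabs_diff_le: "vabs x \<le> b \<Longrightarrow> vabs y \<le> b \<Longrightarrow> vabs (x - y) \<le> b"
  using vabs_add_le[of x b "- y"] by simp

lemma vabs_trans_le: "vabs (x - y) \<le> b \<Longrightarrow> vabs (y - z) \<le> b \<Longrightarrow> vabs (x - z) \<le> b"
  using vabs_add_le[of "x - y" b "y - z"] by simp

lemma vabs_sum_le:
  assumes "0 \<le> b" "\<And>i. i \<in> A \<Longrightarrow> vabs (f i) \<le> b"
  shows "vabs (sum f A) \<le> b"
  using assms by (induction A rule: infinite_finite_induct) (auto intro!: vabs_add_le)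

lemma vabs_add_eq:
  assumes "vabs y < vabs x"
  shows "vabs (x + y) = vabs x"
proof (rule antisym)
  show "vabs (x + y) \<le> vabs x"
    using assms by (intro vabs_add_le) auto
  show "vabs x \<le> vabs (x + y)"
  proof (rule ccontr)
    assume "\<not> ?thesis"
    then have "vabs (x + y) \<le> max (vabs (x + y)) (vabs y)" "max (vabs (x + y)) (vabs y) < vabs x"
      using assms by auto
    moreover have "vabs (x + y - y) \<le> max (vabs (x + y)) (vabs y)"
      by (intro vabs_diff_le) auto
    ultimately show False by (auto simp: max_def split: if_splits)
  qed
qed

lemma vabs_eq_if_close:
  assumes "vabs (x - y) < vabs x"
  shows "vabs y = vabs x"
  using vabs_add_eq[of "- (x - y)" x] assms by (simp only: vabs_minus) simp

lemma vabs_of_nat_le: "vabs (of_nat n :: 'k::complete_ultrametric_field) \<le> 1"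
  by (induction n) (auto intro!: vabs_add_le)

lemma vabs_of_int_le: "vabs (of_int n :: 'k::complete_ultrametric_field) \<le> 1"
  by (cases n rule: int_cases2) (auto simp: vabs_of_nat_le)

lemma tendsto_dist_nhds_pair:
  fixes a b :: "'a::metric_space"
  shows "((\<lambda>x. dist (fst x) a) \<longlongrightarrow> 0) (nhds a \<times>\<^sub>F nhds b)"
    and "((\<lambda>x. dist (snd x) a) \<longlongrightarrow> 0) (nhds b \<times>\<^sub>F nhds a)"
  unfolding nhds_prod[symmetric]
  using tendsto_fst[OF filterlim_ident, of "(a, b)"] tendsto_snd[OF filterlim_ident, of "(b, a)"]
  by (simp_all flip: tendsto_dist_iff)

text \<open>Continuity of the ring operations opens the library's calculus of limits and sums.\<close>

instance complete_ultrametric_field \<subseteq> topological_ab_group_add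
proof
  fix a b :: 'a
  have *: "dist (x + y) (a + b) \<le> dist x a + dist y b" for x y
  proof -
    have "vabs ((x - a) + (y - b)) \<le> vabs (x - a) + vabs (y - b)"
      by (intro vabs_add_le) auto
    then show ?thesis
      by (simp add: dist_vabs algebra_simps)
  qed
  note fst = tendsto_dist_nhds_pair(1)[of a b] and snd = tendsto_dist_nhds_pair(2)[of b a]
  show "((\<lambda>x. fst x + snd x) \<longlongrightarrow> a + b) (nhds a \<times>\<^sub>F nhds b)"
    by (rule iffD2[OF tendsto_dist_iff], rule Lim_null_comparison[OF _ tendsto_add_zero[OF fst snd]])
       (use * in \<open>auto intro!: always_eventually\<close>)
  show "(uminus \<longlongrightarrow> - a) (nhds a)"
  proof -
    have "dist (- x) (- a) = dist x a" for x
      by (metis dist_vabs minus_diff_minus vabs_minus)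
    then show ?thesis
      using tendsto_dist_iff[of "\<lambda>x. x" a "nhds a"] tendsto_dist_iff[of uminus "- a" "nhds a"]
      by (simp add: filterlim_ident)
  qed
qed

instance complete_ultrametric_field \<subseteq> topological_comm_monoid_mult
proof
  fix a b :: 'a
  have *: "dist (x * y) (a * b) \<le> dist x a * dist y b + (vabs a * dist y b + dist x a * vabs b)" for x y
  proof -
    have "vabs ((x - a) * (y - b) + (a * (y - b) + (x - a) * b))
        \<le> vabs (x - a) * vabs (y - b) + (vabs a * vabs (y - b) + vabs (x - a) * vabs b)"
      by (intro vabs_add_le) (auto simp: vabs_mult intro!: add_increasing add_increasing2)
    then show ?thesis
      by (simp add: dist_vabs algebra_simps)
  qed
  note fst = tendsto_dist_nhds_pair(1)[of a b] and snd = tendsto_dist_nhds_pair(2)[of b a]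
  have "((\<lambda>x. dist (fst x) a * dist (snd x) b + (vabs a * dist (snd x) b + dist (fst x) a * vabs b))
      \<longlongrightarrow> 0 * 0 + (vabs a * 0 + 0 * vabs b)) (nhds a \<times>\<^sub>F nhds b)"
    by (intro tendsto_intros fst snd)
  then have "((\<lambda>x. dist (fst x) a * dist (snd x) b + (vabs a * dist (snd x) b + dist (fst x) a * vabs b))
      \<longlongrightarrow> 0) (nhds a \<times>\<^sub>F nhds b)"
    by simp
  note lim = this
  show "((\<lambda>x. fst x * snd x) \<longlongrightarrow> a * b) (nhds a \<times>\<^sub>F nhds b)"
    by (rule iffD2[OF tendsto_dist_iff], rule Lim_null_comparison[OF _ lim])
       (use * in \<open>auto intro!: always_eventually\<close>)
qed

lemma tendsto_vabs_iff:
  fixes f :: "'b \<Rightarrow> 'k::complete_ultrametric_field"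
  shows "(f \<longlongrightarrow> l) F \<longleftrightarrow> ((\<lambda>x. vabs (f x - l)) \<longlongrightarrow> 0) F"
  by (subst tendsto_dist_iff) (simp add: dist_vabs)

lemma tendsto_vabs:
  fixes f :: "'b \<Rightarrow> 'k::complete_ultrametric_field"
  shows "(f \<longlongrightarrow> l) F \<Longrightarrow> ((\<lambda>x. vabs (f x)) \<longlongrightarrow> vabs l) F"
  unfolding vabs_def by (intro tendsto_intros)

lemma vabs_limit_le:
  fixes f :: "nat \<Rightarrow> 'k::complete_ultrametric_field"
  assumes "f \<longlonglongrightarrow> l" "\<And>n. vabs (f n) \<le> b"
  shows "vabs l \<le> b"
  using Lim_bounded[OF tendsto_vabs[OF assms(1)], of 0] assms(2) by auto

lemma tendsto_if_vabs_le:
  fixes f :: "nat \<Rightarrow> 'k::complete_ultrametric_field"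
  assumes "\<And>n. vabs (f n - l) \<le> b n" "b \<longlonglongrightarrow> 0"
  shows "f \<longlonglongrightarrow> l"
  by (rule iffD2[OF tendsto_vabs_iff], rule Lim_null_comparison[OF _ assms(2)]) (use assms in auto)

lemma tendsto_0_vabs_le:
  fixes f :: "nat \<Rightarrow> 'k::complete_ultrametric_field"
  shows "(\<And>n. vabs (f n) \<le> b n) \<Longrightarrow> b \<longlonglongrightarrow> 0 \<Longrightarrow> f \<longlonglongrightarrow> 0"
  using tendsto_if_vabs_le[of f 0 b] by simp

text \<open>A block of terms is bounded by its largest member, so the partial sums form a Cauchy sequence.\<close>

lemma summable_if_tendsto_0:
  fixes f :: "nat \<Rightarrow> 'k::complete_ultrametric_field"
  assumes "f \<longlonglongrightarrow> 0"
  shows "summable f"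
proof -
  have "Cauchy (\<lambda>n. \<Sum>i<n. f i)"
    unfolding Cauchy_altdef2
  proof (intro allI impI)
    fix e :: real assume "e > 0"
    then obtain N where N: "\<And>n. n \<ge> N \<Longrightarrow> vabs (f n) < e / 2"
      using assms[unfolded lim_sequentially, rule_format, of "e/2"] by (auto simp: vabs_def)
    have "dist (\<Sum>i<n. f i) (\<Sum>i<N. f i) < e" if "n \<ge> N" for n
    proof -
      have "(\<Sum>i<n. f i) - (\<Sum>i<N. f i) = (\<Sum>i=N..<n. f i)"
        using that by (metis atLeast0LessThan le0 sum_diff_nat_ivl)
      moreover have "vabs (\<Sum>i=N..<n. f i) \<le> e / 2"
        using N \<open>e > 0\<close> by (intro vabs_sum_le) (auto intro: less_imp_le)
      ultimately show ?thesis
        using \<open>e > 0\<close> by (simp add: dist_vabs)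
    qed
    then show "\<exists>N. \<forall>n\<ge>N. dist (\<Sum>i<n. f i) (\<Sum>i<N. f i) < e" by blast
  qed
  then show ?thesis
    unfolding summable_def sums_def using Cauchy_convergent convergent_def by blast
qed

lemma vabs_sums_le:
  fixes f :: "nat \<Rightarrow> 'k::complete_ultrametric_field"
  assumes "f sums s" "\<And>n. vabs (f n) \<le> b"
  shows "vabs s \<le> b"
proof -
  have "0 \<le> b" using assms(2)[of 0] vabs_nonneg order_trans by blast
  then show ?thesis
    using assms by (intro vabs_limit_le[OF assms(1)[unfolded sums_def]] vabs_sum_le)
qed

lemma sums_cmult:
  fixes f :: "nat \<Rightarrow> 'k::complete_ultrametric_field"
  assumes "f sums s"
  shows "(\<lambda>n. c * f n) sums (c * s)"
  using tendsto_mult[OF tendsto_const assms[unfolded sums_def], of c]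
  by (simp add: sums_def sum_distrib_left)

lemma sums_minus:
  fixes f g :: "nat \<Rightarrow> 'k::complete_ultrametric_field"
  shows "f sums a \<Longrightarrow> g sums b \<Longrightarrow> (\<lambda>n. f n - g n) sums (a - b)"
  unfolding sums_def sum_subtractf by (rule tendsto_diff)

lemma sums_shift:
  fixes f :: "nat \<Rightarrow> 'k::complete_ultrametric_field"
  assumes "f sums s"
  shows "(\<lambda>k. f (k + N)) sums (s - (\<Sum>k<N. f k))"
proof -
  have "(\<Sum>k<n. f (k + N)) = (\<Sum>k<n + N. f k) - (\<Sum>k<N. f k)" for n
    by (induction n) auto
  then show ?thesis
    using tendsto_diff[OF LIMSEQ_ignore_initial_segment[OF assms[unfolded sums_def], of N] tendsto_const]
    by (simp add: sums_def)
qed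

text \<open>
  Rearranging a triangular double series: the two partial sums up to \<open>N\<close> differ by terms
  \<open>g n k\<close> with \<open>k \<ge> N\<close> only, hence by at most the supremum of \<open>b k\<close> over \<open>k \<ge> N\<close>.
\<close>

lemma triangular_double_series:
  fixes g :: "nat \<Rightarrow> nat \<Rightarrow> 'k::complete_ultrametric_field"
  assumes bound: "\<And>n k. n \<le> k \<Longrightarrow> vabs (g n k) \<le> b k" and b: "b \<longlonglongrightarrow> 0"
    and tri: "\<And>n k. k < n \<Longrightarrow> g n k = 0"
    and S: "(\<lambda>k. \<Sum>n\<le>k. g n k) sums S"
  shows "(\<lambda>n. \<Sum>k. g n k) sums S"
proof -
  have bk: "vabs (g n k) \<le> b k" for n k
    using bound[of n k] order_trans[OF vabs_nonneg bound[of k k]] tri[of k n]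
    by (cases "n \<le> k") auto
  have inner: "(\<lambda>k. g n k) sums (\<Sum>k. g n k)" for n
    by (intro summable_sums summable_if_tendsto_0 tendsto_0_vabs_le[OF bk b])
  have "(\<lambda>N. (\<Sum>n<N. \<Sum>k. g n k) - (\<Sum>k<N. \<Sum>n\<le>k. g n k)) \<longlonglongrightarrow> 0"
    unfolding lim_sequentially
  proof (intro allI impI)
    fix e :: real assume e: "e > 0"
    then obtain N0 where N0: "\<And>k. k \<ge> N0 \<Longrightarrow> b k < e / 2"
      using b[unfolded lim_sequentially, rule_format, of "e/2"] by (force simp: dist_real_def)
    have "dist ((\<Sum>n<N. \<Sum>k. g n k) - (\<Sum>k<N. \<Sum>n\<le>k. g n k)) 0 < e" if N: "N \<ge> N0" for N
    proof -
      have "(\<Sum>k<N. \<Sum>n\<le>k. g n k) = (\<Sum>k<N. \<Sum>n<N. g n k)"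
        by (intro sum.cong refl sum.mono_neutral_left) (auto intro!: tri)
      also have "\<dots> = (\<Sum>n<N. \<Sum>k<N. g n k)" by (rule sum.swap)
      finally have eq: "(\<Sum>n<N. \<Sum>k. g n k) - (\<Sum>k<N. \<Sum>n\<le>k. g n k)
          = (\<Sum>n<N. (\<Sum>k. g n k) - (\<Sum>k<N. g n k))"
        by (simp add: sum_subtractf)
      have "vabs ((\<Sum>k. g n k) - (\<Sum>k<N. g n k)) \<le> e / 2" for n
      proof (rule vabs_sums_le)
        show "(\<lambda>k. g n (k + N)) sums ((\<Sum>k. g n k) - (\<Sum>k<N. g n k))"
          by (rule sums_shift[OF inner])
        show "vabs (g n (k + N)) \<le> e / 2" for k
          using bk[of n "k + N"] N0[of "k + N"] N by linarith
      qed
      then have "vabs (\<Sum>n<N. (\<Sum>k. g n k) - (\<Sum>k<N. g n k)) \<le> e / 2"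
        using e by (intro vabs_sum_le) auto
      then show ?thesis
        unfolding eq dist_vabs using e by simp
    qed
    then show "\<exists>N0. \<forall>N\<ge>N0. dist ((\<Sum>n<N. \<Sum>k. g n k) - (\<Sum>k<N. \<Sum>n\<le>k. g n k)) 0 < e"
      by blast
  qed
  from tendsto_add[OF this S[unfolded sums_def]] show ?thesis
    by (simp add: sums_def)
qed

section \<open>The ring of p-adic integers\<close>

text \<open>
  The locale parameter \<open>K\<close> carries no data; it fixes the type of the ground field.
\<close>

locale padic_field =
  fixes p :: nat and K :: "'k::complete_ultrametric_field itself"
  assumes prime_p: "prime p" and odd_p: "odd p"
    and vabs_p: "vabs (of_nat p :: 'k) = 1 / real p"
begin

lemma p_ge_3: "p \<ge> 3"
  using prime_p odd_p prime_ge_2_nat[of p] by (cases "p = 2") auto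

lemma p_pos: "p > 0" "real p > 0" "real p > 1"
  using p_ge_3 by auto

lemma inv_p_less_1: "1 / real p < 1"
  using p_pos by simp

lemma inv_p_power_le: "m \<le> n \<Longrightarrow> (1 / real p) ^ n \<le> (1 / real p) ^ m"
  using p_pos by (intro power_decreasing) auto

lemma inv_p_power_tendsto_0: "(\<lambda>n. (1 / real p) ^ n) \<longlonglongrightarrow> 0"
  using p_pos by (intro LIMSEQ_power_zero) auto

lemma ex_inv_p_power_less:
  assumes "e > 0"
  shows "\<exists>n. (1 / real p) ^ n < e"
  using real_arch_pow_inv[OF assms, of "1 / real p"] p_pos by auto

lemma vabs_p_power: "vabs (of_nat p ^ n :: 'k) = (1 / real p) ^ n"
  by (simp add: vabs_power vabs_p)

lemma vabs_of_int_dvd: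
  assumes "int p ^ m dvd a"
  shows "vabs (of_int a :: 'k) \<le> (1 / real p) ^ m"
proof -
  obtain b where b: "a = int p ^ m * b" using assms by auto
  have "vabs (of_int a :: 'k) = (1 / real p) ^ m * vabs (of_int b :: 'k)"
    by (simp add: b vabs_mult vabs_p_power)
  also have "\<dots> \<le> (1 / real p) ^ m * 1"
    by (intro mult_left_mono vabs_of_int_le) auto
  finally show ?thesis by simp
qed

lemma vabs_of_nat_dvd:
  assumes "p ^ m dvd n"
  shows "vabs (of_nat n :: 'k) \<le> (1 / real p) ^ m"
  using vabs_of_int_dvd[of m "int n"] assms by (simp flip: of_nat_power)

text \<open>
  A relation \<open>a x = 1 + p t\<close> would be violated modulo the maximal ideal if \<open>|a| < 1\<close>.
\<close>

lemma vabs_of_int_unit: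
  assumes "\<not> int p dvd a"
  shows "vabs (of_int a :: 'k) = 1"
proof (rule ccontr)
  assume "\<not> ?thesis"
  then have less: "vabs (of_int a :: 'k) < 1" using vabs_of_int_le[of a, where 'k='k] by simp
  have "coprime a (int p)"
    using assms prime_p by (metis coprime_commute prime_imp_coprime prime_nat_int_transfer)
  then obtain x where "[a * x = 1] (mod int p)" using cong_solve_coprime_int by blast
  then obtain t where t: "a * x = 1 + int p * t"
    by (metis cong_iff_lin cong_sym)
  have "(1 :: 'k) = of_int a * of_int x - of_int (int p * t)"
    by (simp only: of_int_mult[symmetric] t) simp
  moreover have "vabs (of_int a * of_int x - of_int (int p * t) :: 'k) \<le> max (vabs (of_int a :: 'k)) (1 / real p)"
  proof (intro vabs_diff_le)
    have "vabs (of_int a * of_int x :: 'k) \<le> vabs (of_int a :: 'k) * 1"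
      unfolding vabs_mult by (intro mult_left_mono vabs_of_int_le) auto
    then show "vabs (of_int a * of_int x :: 'k) \<le> max (vabs (of_int a :: 'k)) (1 / real p)" by simp
    show "vabs (of_int (int p * t) :: 'k) \<le> max (vabs (of_int a :: 'k)) (1 / real p)"
      using vabs_of_int_dvd[of 1 "int p * t"] by simp
  qed
  ultimately have "1 \<le> max (vabs (of_int a :: 'k)) (1 / real p)" by (metis vabs_one)
  then show False using less p_pos by (auto simp: max_def split: if_splits)
qed

lemma vabs_of_nat_unit:
  assumes "\<not> p dvd n"
  shows "vabs (of_nat n :: 'k) = 1"
  using vabs_of_int_unit[of "int n"] assms by simp

lemma vabs_of_nat_less_1_iff: "vabs (of_nat n :: 'k) < 1 \<longleftrightarrow> p dvd n"
proof
  assume "p dvd n"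
  then have "vabs (of_nat n :: 'k) \<le> 1 / real p" using vabs_of_nat_dvd[of 1 n] by simp
  then show "vabs (of_nat n :: 'k) < 1" using inv_p_less_1 by linarith
next
  assume "vabs (of_nat n :: 'k) < 1"
  then show "p dvd n" using vabs_of_nat_unit[of n] by linarith
qed

lemma Qp_approx:
  assumes "x \<in> (Qp :: 'k set)" "e > 0"
  obtains q where "q \<in> \<rat>" "vabs (q - x) < e"
  using assms unfolding Qp_def closure_approachable by (auto simp: dist_vabs)

lemma QpI:
  assumes "\<And>e. e > 0 \<Longrightarrow> \<exists>q\<in>\<rat>. vabs (q - x) < e"
  shows "x \<in> (Qp :: 'k set)"
  using assms unfolding Qp_def closure_approachable by (auto simp: dist_vabs)

lemma Qp_mult:
  assumes "x \<in> (Qp :: 'k set)" "y \<in> Qp"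
  shows "x * y \<in> Qp"
proof -
  obtain f g where "\<And>n. f n \<in> \<rat>" "f \<longlonglongrightarrow> x" "\<And>n. g n \<in> \<rat>" "g \<longlonglongrightarrow> y"
    using assms unfolding Qp_def closure_sequential by blast
  then show ?thesis
    unfolding Qp_def closure_sequential by (intro exI[of _ "\<lambda>n. f n * g n"]) (auto intro: tendsto_mult)
qed

lemma Qp_add:
  assumes "x \<in> (Qp :: 'k set)" "y \<in> Qp"
  shows "x + y \<in> Qp"
proof -
  obtain f g where "\<And>n. f n \<in> \<rat>" "f \<longlonglongrightarrow> x" "\<And>n. g n \<in> \<rat>" "g \<longlonglongrightarrow> y"
    using assms unfolding Qp_def closure_sequential by blast
  then show ?thesis
    unfolding Qp_def closure_sequential by (intro exI[of _ "\<lambda>n. f n + g n"]) (auto intro: tendsto_add)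
qed

lemma Rats_subset_Qp: "\<rat> \<subseteq> (Qp :: 'k set)"
  unfolding Qp_def by (rule closure_subset)

lemma Qp_diff: "x \<in> (Qp :: 'k set) \<Longrightarrow> y \<in> Qp \<Longrightarrow> x - y \<in> Qp"
  using Qp_add[of x "-1 * y"] Qp_mult[of "-1" y] subsetD[OF Rats_subset_Qp, of "-1"] by simp

text \<open>
  By density of \<open>\<rat>\<close> it suffices to approximate a rational number \<open>a / b\<close> of absolute value at
  most \<open>1\<close>. In lowest terms \<open>p\<close> does not divide \<open>b\<close>, so \<open>b\<close> is invertible modulo \<open>p\<^sup>m\<close>.
\<close>

lemma Zp_approx:
  assumes "x \<in> (Zp :: 'k set)"
  shows "\<exists>n<p ^ m. vabs (x - of_nat n) \<le> (1 / real p) ^ m"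
proof -
  have x: "x \<in> Qp" "vabs x \<le> 1" using assms by (auto simp: Zp_def)
  obtain q where q: "q \<in> \<rat>" "vabs (q - x) < (1 / real p) ^ m"
    by (rule Qp_approx[OF x(1), of "(1 / real p) ^ m"]) (use p_pos in auto)
  have "(1 / real p) ^ m \<le> 1" using inv_p_power_le[of 0 m] by simp
  then have q1: "vabs q \<le> 1"
    using q(2) x(2) vabs_add_le[of "q - x" 1 x] by simp
  obtain r where r: "q = of_rat r" using q(1) by (elim Rats_cases)
  obtain a b where ab: "quotient_of r = (a, b)" by (cases "quotient_of r")
  have b: "b > 0" "coprime a b" and rab: "r = of_int a / of_int b"
    using quotient_of_denom_pos[OF ab] quotient_of_coprime[OF ab] quotient_of_div[OF ab] by auto
  have qab: "q = of_int a / of_int b" unfolding r rab by (simp add: of_rat_divide)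
  have pb: "\<not> int p dvd b"
  proof
    assume pb: "int p dvd b"
    then have "\<not> int p dvd a"
      using b(2) prime_p by (metis coprime_common_divisor not_prime_unit prime_nat_int_transfer)
    then have "vabs (of_int a :: 'k) = 1" by (rule vabs_of_int_unit)
    moreover have "vabs (of_int b :: 'k) \<le> 1 / real p" using vabs_of_int_dvd[of 1 b] pb by simp
    moreover have "vabs (of_int b :: 'k) > 0" using b(1) by simp
    ultimately have "vabs q \<ge> real p" unfolding qab vabs_divide
      using p_pos by (simp add: field_simps)
    then show False using q1 p_pos by linarith
  qed
  then have vb: "vabs (of_int b :: 'k) = 1" by (rule vabs_of_int_unit)
  have "coprime b (int p ^ m)"
    using pb prime_p by (metis coprime_commute coprime_power_right_iff prime_imp_coprime prime_nat_int_transfer)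
  then obtain y where y: "[b * y = 1] (mod int p ^ m)" using cong_solve_coprime_int by blast
  define n where "n = nat ((a * y) mod int p ^ m)"
  have pm: "int p ^ m > 0" using p_pos by simp
  have n: "int n = (a * y) mod int p ^ m" using pm by (simp add: n_def)
  have nlt: "n < p ^ m"
  proof -
    have "int n < int (p ^ m)" unfolding n using pm by simp
    then show ?thesis by linarith
  qed
  have "[int n * b = a] (mod int p ^ m)"
  proof -
    have "[int n * b = a * y * b] (mod int p ^ m)"
      unfolding n by (intro cong_mult) (auto simp: cong_def)
    also have "[a * y * b = a * 1] (mod int p ^ m)"
      using cong_mult[OF cong_refl[of a] y] by (simp add: mult_ac)
    finally show ?thesis by simp
  qed
  then have "int p ^ m dvd a - int n * b"
    by (simp add: cong_iff_dvd_diff dvd_diff_commute)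
  then have "vabs (of_int (a - int n * b) :: 'k) \<le> (1 / real p) ^ m" by (rule vabs_of_int_dvd)
  moreover have "q - of_nat n = of_int (a - int n * b) / of_int b"
    using b(1) by (simp add: qab field_simps)
  ultimately have "vabs (q - of_nat n) \<le> (1 / real p) ^ m"
    by (simp add: vabs_divide vb)
  moreover have "vabs (x - q) \<le> (1 / real p) ^ m"
    using q(2) by (subst vabs_diff_commute) (rule less_imp_le)
  ultimately have "vabs (x - of_nat n) \<le> (1 / real p) ^ m" by (rule vabs_trans_le[rotated])
  then show ?thesis using nlt by blast
qed

lemma Zp_mult: "x \<in> (Zp :: 'k set) \<Longrightarrow> y \<in> Zp \<Longrightarrow> x * y \<in> Zp"
  by (simp add: Zp_def vabs_mult Qp_mult mult_le_one)

lemma Zp_diff: "x \<in> (Zp :: 'k set) \<Longrightarrow> y \<in> Zp \<Longrightarrow> x - y \<in> Zp"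
  by (simp add: Zp_def Qp_diff vabs_diff_le)

lemma of_nat_in_Zp: "(of_nat n :: 'k) \<in> Zp"
  using Rats_subset_Qp by (auto simp: Zp_def vabs_of_nat_le)

lemma Zp_power: "x \<in> (Zp :: 'k set) \<Longrightarrow> x ^ n \<in> Zp"
  using of_nat_in_Zp[of 1] by (induction n) (auto intro: Zp_mult)

lemma closed_Zp: "closed (Zp :: 'k set)"
proof -
  have "(Zp :: 'k set) = closure \<rat> \<inter> cball 0 1"
    by (auto simp: Zp_def Qp_def vabs_def dist_commute)
  then show ?thesis by (metis closed_Int closed_cball closed_closure)
qed

text \<open>A natural number congruent to \<open>x\<close> modulo \<open>p\<close> is divisible by \<open>p\<close>, hence so is \<open>x\<close>.\<close>

lemma Zp_vabs_less_1:
  assumes "x \<in> (Zp :: 'k set)" "vabs x < 1"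
  shows "vabs x \<le> 1 / real p"
proof -
  obtain n where n: "vabs (x - of_nat n) \<le> 1 / real p" using Zp_approx[OF assms(1), of 1] by auto
  have "vabs (of_nat n :: 'k) \<le> max (vabs x) (1 / real p)"
    using vabs_diff_le[of x "max (vabs x) (1 / real p)" "x - of_nat n"] n by simp
  also have "\<dots> < 1" using assms p_pos by simp
  finally have "p dvd n" by (simp add: vabs_of_nat_less_1_iff)
  then have "vabs (of_nat n :: 'k) \<le> 1 / real p" using vabs_of_nat_dvd[of 1 n] by simp
  then show ?thesis using vabs_add_le[OF n, of "of_nat n"] by simp
qed

text \<open>
  Complete, and covered by the \<open>p\<^sup>m\<close> discs around the integers \<open>0, \<dots>, p\<^sup>m - 1\<close>.
\<close>

lemma compact_Zp: "compact (Zp :: 'k set)"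
  unfolding compact_eq_totally_bounded
proof (intro conjI allI impI)
  show "complete (Zp :: 'k set)" using closed_Zp by (simp add: complete_eq_closed)
  fix e :: real assume "e > 0"
  then obtain m where m: "(1 / real p) ^ m < e" using ex_inv_p_power_less by blast
  show "\<exists>k. finite k \<and> (Zp :: 'k set) \<subseteq> (\<Union>x\<in>k. ball x e)"
  proof (intro exI conjI subsetI)
    show "finite ((of_nat :: nat \<Rightarrow> 'k) ` {..<p ^ m})" by simp
    fix x :: 'k assume "x \<in> Zp"
    then obtain n where "n < p ^ m" "vabs (x - of_nat n) \<le> (1 / real p) ^ m" using Zp_approx by blast
    then show "x \<in> (\<Union>x\<in>(of_nat :: nat \<Rightarrow> 'k) ` {..<p ^ m}. ball x e)"
      using m by (force simp: dist_vabs vabs_diff_commute)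
  qed
qed

lemma Zp_units_iff: "x \<in> (Zp_units :: 'k set) \<longleftrightarrow> x \<in> Zp \<and> vabs x = 1"
proof
  assume "x \<in> Zp_units"
  then obtain y where y: "x \<in> Zp" "y \<in> Zp" "x * y = 1" by (auto simp: Zp_units_def)
  then have "vabs x * vabs y = 1" by (metis vabs_mult vabs_one)
  moreover have "vabs x \<le> 1" "vabs y \<le> 1" using y by (auto simp: Zp_def)
  moreover from this have "vabs x * vabs y \<le> vabs x * 1" by (intro mult_left_mono) auto
  ultimately have "vabs x = 1" by linarith
  then show "x \<in> Zp \<and> vabs x = 1" using y by simp
next
  assume x: "x \<in> Zp \<and> vabs x = 1"
  have "inverse x \<in> Qp"
  proof (rule QpI)
    fix e :: real assume e: "e > 0"
    have "x \<in> Qp" using x by (simp add: Zp_def)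
    then obtain q where q: "q \<in> \<rat>" "vabs (q - x) < min e 1"
      using Qp_approx[of x "min e 1"] e by auto
    have "vabs q = 1" using vabs_eq_if_close[of x q] q x by (simp add: vabs_diff_commute)
    then have "q \<noteq> 0" "x \<noteq> 0" using x by auto
    then have "inverse q - inverse x = - ((q - x) / (q * x))" by (simp add: field_simps)
    then have "vabs (inverse q - inverse x) = vabs (q - x)"
      using x \<open>vabs q = 1\<close> by (simp only: vabs_minus) (simp add: vabs_divide vabs_mult)
    then show "\<exists>r\<in>\<rat>. vabs (r - inverse x) < e"
      using q by (intro bexI[of _ "inverse q"]) auto
  qed
  then have "inverse x \<in> Zp" using x by (simp add: Zp_def vabs_inverse)
  moreover have "x * inverse x = 1" using x by (metis right_inverse vabs_zero zero_neq_one)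
  ultimately show "x \<in> Zp_units" using x by (auto simp: Zp_units_def)
qed

lemma Zp_units_nonzero: "x \<in> (Zp_units :: 'k set) \<Longrightarrow> x \<noteq> 0"
  by (auto simp: Zp_units_iff)

lemma Zp_units_mult: "x \<in> (Zp_units :: 'k set) \<Longrightarrow> y \<in> Zp_units \<Longrightarrow> x * y \<in> Zp_units"
  by (simp add: Zp_units_iff vabs_mult Zp_mult)

lemma Zp_units_inverse:
  assumes "x \<in> (Zp_units :: 'k set)"
  shows "inverse x \<in> Zp_units"
proof -
  obtain y where y: "y \<in> Zp" "x \<in> Zp" "x * y = 1" using assms by (auto simp: Zp_units_def)
  then have "inverse x = y" by (simp add: inverse_unique)
  then show ?thesis using y by (auto simp: Zp_units_def intro!: bexI[of _ x] simp: mult.commute)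
qed

lemma Zp_units_divide: "x \<in> (Zp_units :: 'k set) \<Longrightarrow> y \<in> Zp_units \<Longrightarrow> x / y \<in> Zp_units"
  unfolding divide_inverse by (intro Zp_units_mult Zp_units_inverse)

lemma of_nat_in_Zp_units: "coprime n p \<Longrightarrow> (of_nat n :: 'k) \<in> Zp_units"
  using vabs_of_nat_unit[of n] prime_p
  by (metis Zp_units_iff coprime_common_divisor dvd_refl not_prime_unit of_nat_in_Zp)

lemma one_in_Zp_units: "(1 :: 'k) \<in> Zp_units"
  using of_nat_in_Zp_units[of 1] by simp

lemma compact_Zp_units: "compact (Zp_units :: 'k set)"
proof -
  have "(Zp_units :: 'k set) = Zp \<inter> (cball 0 1 - ball 0 1)"
    by (auto simp: Zp_units_iff vabs_def dist_commute)
  moreover have "closed (cball (0 :: 'k) 1 - ball 0 1)" by (intro closed_Diff closed_cball open_ball)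
  ultimately show ?thesis using compact_Int_closed[OF compact_Zp] by metis
qed

lemma vabs_power_diff_le:
  assumes "vabs (x :: 'k) \<le> 1" "vabs y \<le> 1"
  shows "vabs (x ^ n - y ^ n) \<le> vabs (x - y)"
proof (induction n)
  case (Suc n)
  have "x ^ Suc n - y ^ Suc n = x * (x ^ n - y ^ n) + (x - y) * y ^ n" by (simp add: algebra_simps)
  moreover have "vabs (x * (x ^ n - y ^ n)) \<le> 1 * vabs (x - y)"
    unfolding vabs_mult using assms Suc by (intro mult_mono) auto
  moreover have "vabs ((x - y) * y ^ n) \<le> vabs (x - y) * 1"
    unfolding vabs_mult vabs_power using assms by (intro mult_mono power_le_one) auto
  ultimately show ?case by (metis mult_1 mult_1_right vabs_add_le)
qed simp

lemma vabs_eq_1_if_close_1: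
  assumes "vabs (u - 1 :: 'k) < 1"
  shows "vabs u = 1"
  using vabs_eq_if_close[of 1 u] assms by (simp add: vabs_diff_commute)

text \<open>
  Raising to the \<open>p\<close>-th power improves the approximation to \<open>1\<close>: in
  \<open>u\<^sup>p - 1 = (u - 1) (1 + u + \<dots> + u\<^bsup>p-1\<^esup>)\<close> the second factor is congruent to \<open>p\<close>.
\<close>

lemma pth_power_close_1:
  assumes "vabs (u - 1 :: 'k) \<le> (1 / real p) ^ Suc i"
  shows "vabs (u ^ p - 1) \<le> (1 / real p) ^ Suc (Suc i)"
proof -
  have u: "vabs (u - 1) \<le> 1 / real p" using assms inv_p_power_le[of 1 "Suc i"] by simp
  also have "\<dots> < 1" using p_pos by simp
  finally have u1: "vabs u = 1" by (rule vabs_eq_1_if_close_1)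
  have "(\<Sum>j<p. u ^ j) = of_nat p + (\<Sum>j<p. u ^ j - 1)" by (simp add: sum_subtractf)
  moreover have "vabs (u ^ j - 1) \<le> 1 / real p" for j
    using order_trans[OF vabs_power_diff_le[of u 1 j] u] u1 by simp
  ultimately have s: "vabs (\<Sum>j<p. u ^ j) \<le> 1 / real p"
    by (metis vabs_add_le vabs_sum_le vabs_p order_refl zero_le_divide_1_iff of_nat_0_le_iff)
  have "u ^ p - 1 = (u - 1) * (\<Sum>j<p. u ^ j)" by (rule power_diff_1_eq)
  then have "vabs (u ^ p - 1) = vabs (u - 1) * vabs (\<Sum>j<p. u ^ j)" by (simp add: vabs_mult)
  also have "\<dots> \<le> (1 / real p) ^ Suc i * (1 / real p)"
    by (intro mult_mono assms s) auto
  finally show ?thesis by (simp add: mult.commute)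
qed

lemma p_power_close_1:
  assumes "vabs (u - 1 :: 'k) \<le> 1 / real p"
  shows "vabs (u ^ (p ^ k) - 1) \<le> (1 / real p) ^ Suc k"
proof (induction k)
  case (Suc k)
  have "u ^ p ^ Suc k = (u ^ p ^ k) ^ p" by (simp add: mult.commute flip: power_mult)
  then show ?case using pth_power_close_1[OF Suc] by simp
qed (use assms in simp)

lemma Fermat_Zp_units:
  assumes "x \<in> (Zp_units :: 'k set)"
  shows "vabs (x ^ (p - 1) - 1) \<le> 1 / real p"
proof -
  have x: "x \<in> Zp" "vabs x = 1" using assms by (auto simp: Zp_units_iff)
  obtain n where n: "vabs (x - of_nat n) \<le> 1 / real p" using Zp_approx[OF x(1), of 1] by auto
  have "vabs (of_nat n :: 'k) = 1"
    using vabs_eq_if_close[of x "of_nat n"] n x(2) inv_p_less_1 by simp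
  then have "\<not> p dvd n" using vabs_of_nat_less_1_iff[of n] by simp
  then have "[n ^ (p - 1) = 1] (mod p)" using fermat_theorem prime_p by blast
  then have "int p dvd int (n ^ (p - 1)) - 1"
    by (metis cong_iff_dvd_diff cong_int_iff of_nat_1)
  from vabs_of_int_dvd[of 1, simplified, OF this]
  have "vabs (of_nat n ^ (p - 1) - 1 :: 'k) \<le> 1 / real p" by simp
  moreover have "vabs (x ^ (p - 1) - of_nat n ^ (p - 1)) \<le> 1 / real p"
    using vabs_power_diff_le[of x "of_nat n" "p - 1"] n x by (simp add: vabs_of_nat_le)
  ultimately show ?thesis using vabs_trans_le by blast
qed

text \<open>
  Together with \<open>nonunit_power_close_0\<close>: on \<open>Zp\<close> the powers \<open>x\<^bsup>(p-1) p^k\<^esup>\<close> tend uniformly to the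
  indicator function of the units. Both the density of polynomials and the restriction of measures
  from \<open>Zp\<close> to the units rest on this.
\<close>

lemma unit_power_close_1:
  assumes "x \<in> (Zp_units :: 'k set)"
  shows "vabs (x ^ ((p - 1) * p ^ k) - 1) \<le> (1 / real p) ^ Suc k"
  using p_power_close_1[OF Fermat_Zp_units[OF assms]] by (simp add: power_mult)

lemma exponent_ge: "Suc k \<le> (p - 1) * p ^ k"
proof -
  have "Suc k \<le> 2 ^ k" by (rule Suc_leI[OF less_exp])
  also have "\<dots> \<le> p ^ k" using p_ge_3 by (intro power_mono) auto
  also have "\<dots> \<le> (p - 1) * p ^ k" using p_ge_3 by simp
  finally show ?thesis .
qed

lemma nonunit_power_close_0:
  assumes "x \<in> (Zp :: 'k set)" "x \<notin> Zp_units"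
  shows "vabs (x ^ ((p - 1) * p ^ k)) \<le> (1 / real p) ^ Suc k"
proof -
  have "vabs x < 1" using assms by (auto simp: Zp_units_iff Zp_def)
  then have "vabs x \<le> 1 / real p" using assms Zp_vabs_less_1 by blast
  then have "vabs (x ^ ((p - 1) * p ^ k)) \<le> (1 / real p) ^ ((p - 1) * p ^ k)"
    unfolding vabs_power by (intro power_mono) auto
  also have "\<dots> \<le> (1 / real p) ^ Suc k" by (rule inv_p_power_le[OF exponent_ge])
  finally show ?thesis .
qed

end

section \<open>Bounded measures\<close>

lemma vabs_le_0_iff [simp]: "vabs x \<le> 0 \<longleftrightarrow> x = 0"
  using vabs_nonneg[of x] by (simp add: order_antisym_conv)

lemma continuous_on_poly_ultrametric [continuous_intros]:
  fixes q :: "'k::complete_ultrametric_field poly"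
  shows "continuous_on X (poly q)"
  by (induction q) (auto intro!: continuous_intros)

lemma bounded_measuresI:
  assumes "\<And>f g. continuous_on X f \<Longrightarrow> continuous_on X g \<Longrightarrow> \<mu> (\<lambda>x. f x + g x) = \<mu> f + \<mu> g"
    and "\<And>a f. continuous_on X f \<Longrightarrow> \<mu> (\<lambda>x. a * f x) = a * \<mu> f"
    and "\<And>f b. continuous_on X f \<Longrightarrow> (\<And>x. x \<in> X \<Longrightarrow> vabs (f x) \<le> b) \<Longrightarrow> vabs (\<mu> f) \<le> C * b"
    and "\<And>f. \<not> continuous_on X f \<Longrightarrow> \<mu> f = 0"
  shows "\<mu> \<in> bounded_measures X"
  using assms unfolding bounded_measures_def by blast

definition norm_bound :: "'k::complete_ultrametric_field set \<Rightarrow> 'k functional \<Rightarrow> real \<Rightarrow> bool" where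
  "norm_bound X \<mu> C \<longleftrightarrow> 0 \<le> C \<and>
     (\<forall>f b. continuous_on X f \<longrightarrow> 0 \<le> b \<longrightarrow> (\<forall>x\<in>X. vabs (f x) \<le> b) \<longrightarrow> vabs (\<mu> f) \<le> C * b)"

lemma norm_boundD:
  assumes "norm_bound X \<mu> C"
  shows "0 \<le> C"
    and "continuous_on X f \<Longrightarrow> 0 \<le> b \<Longrightarrow> (\<And>x. x \<in> X \<Longrightarrow> vabs (f x) \<le> b) \<Longrightarrow> vabs (\<mu> f) \<le> C * b"
  using assms unfolding norm_bound_def by blast+

context
  fixes X :: "'k::complete_ultrametric_field set" and \<mu> :: "'k functional"
  assumes \<mu>: "\<mu> \<in> bounded_measures X"
begin

lemma measure_add: "continuous_on X f \<Longrightarrow> continuous_on X g \<Longrightarrow> \<mu> (\<lambda>x. f x + g x) = \<mu> f + \<mu> g"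
  using \<mu> unfolding bounded_measures_def by blast

lemma measure_cmult: "continuous_on X f \<Longrightarrow> \<mu> (\<lambda>x. a * f x) = a * \<mu> f"
  using \<mu> unfolding bounded_measures_def by blast

lemma measure_discontinuous: "\<not> continuous_on X f \<Longrightarrow> \<mu> f = 0"
  using \<mu> unfolding bounded_measures_def by blast

lemma measure_bound: "\<exists>C. norm_bound X \<mu> C"
proof -
  obtain C where C: "\<forall>f b. continuous_on X f \<longrightarrow> (\<forall>x\<in>X. vabs (f x) \<le> b) \<longrightarrow> vabs (\<mu> f) \<le> C * b"
    using \<mu> by (auto simp: bounded_measures_def)
  have "norm_bound X \<mu> (max C 0)"
    unfolding norm_bound_def
  proof (intro conjI allI impI)
    fix f :: "'k \<Rightarrow> 'k" and b assume *: "continuous_on X f" "0 \<le> b" "\<forall>x\<in>X. vabs (f x) \<le> b"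
    have "C * b \<le> max C 0 * b" using * by (intro mult_right_mono) auto
    then show "vabs (\<mu> f) \<le> max C 0 * b" using C * order_trans by blast
  qed simp
  then show ?thesis ..
qed

lemma measure_mult_const: "continuous_on X f \<Longrightarrow> \<mu> (\<lambda>x. f x * a) = \<mu> f * a"
  using measure_cmult[of f a] by (simp add: mult.commute)

lemma measure_minus: "continuous_on X f \<Longrightarrow> \<mu> (\<lambda>x. - f x) = - \<mu> f"
  using measure_cmult[of f "-1"] by simp

lemma measure_diff: "continuous_on X f \<Longrightarrow> continuous_on X g \<Longrightarrow> \<mu> (\<lambda>x. f x - g x) = \<mu> f - \<mu> g"
  using measure_add[of f "\<lambda>x. - g x"] measure_minus[of g] by (simp add: continuous_intros)

lemma measure_zero: "\<mu> (\<lambda>x. 0) = 0"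
  using measure_cmult[of "\<lambda>x. 0" 0] by simp

lemma measure_sum:
  "(\<And>i. i \<in> A \<Longrightarrow> continuous_on X (f i)) \<Longrightarrow> \<mu> (\<lambda>x. \<Sum>i\<in>A. f i x) = (\<Sum>i\<in>A. \<mu> (f i))"
proof (induction A rule: infinite_finite_induct)
  case (insert a A)
  then show ?case
    using measure_add[of "f a" "\<lambda>x. \<Sum>i\<in>A. f i x"] by (simp add: continuous_on_sum)
qed (simp_all add: measure_zero)

lemma measure_poly: "\<mu> (poly q) = (\<Sum>i\<le>Polynomial.degree q. Polynomial.coeff q i * \<mu> (\<lambda>x. x ^ i))"
  unfolding poly_altdef by (subst measure_sum) (auto intro!: continuous_intros sum.cong measure_cmult)

lemma measure_cong:
  assumes "\<And>x. x \<in> X \<Longrightarrow> f x = g x"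
  shows "\<mu> f = \<mu> g"
proof (cases "continuous_on X f")
  case True
  then have g: "continuous_on X g" using assms by (simp cong: continuous_on_cong_simp)
  obtain C where "norm_bound X \<mu> C" using measure_bound by blast
  note C = norm_boundD(2)[OF this]
  have "vabs (\<mu> (\<lambda>x. f x - g x)) \<le> C * 0"
    using True g assms by (intro C continuous_intros) auto
  then show ?thesis using measure_diff[OF True g] by simp
next
  case False
  then have "\<not> continuous_on X g" using assms by (simp cong: continuous_on_cong_simp)
  with False show ?thesis by (simp add: measure_discontinuous)
qed

lemma measure_uniform_limit:
  assumes "\<And>n. continuous_on X (f n)" "continuous_on X g"
    and e: "e \<longlonglongrightarrow> 0" "\<And>n x. x \<in> X \<Longrightarrow> vabs (f n x - g x) \<le> e n"
  shows "(\<lambda>n. \<mu> (f n)) \<longlonglongrightarrow> \<mu> g"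
proof -
  obtain C where "norm_bound X \<mu> C" using measure_bound by blast
  note C = norm_boundD[OF this]
  have "vabs (\<mu> (f n) - \<mu> g) \<le> C * \<bar>e n\<bar>" for n
  proof -
    have "vabs (\<mu> (\<lambda>x. f n x - g x)) \<le> C * \<bar>e n\<bar>"
      using assms(1,2) order_trans[OF e(2)[of _ n] abs_ge_self] by (intro C continuous_intros) auto
    then show ?thesis using measure_diff[OF assms(1)[of n] assms(2)] by simp
  qed
  moreover have "(\<lambda>n. C * \<bar>e n\<bar>) \<longlonglongrightarrow> 0"
    using tendsto_mult_right_zero[OF tendsto_rabs_zero[OF e(1)]] .
  ultimately show ?thesis by (rule tendsto_if_vabs_le)
qed

end

lemma dirac_bounded:
  assumes "u \<in> X"
  shows "dirac X u \<in> bounded_measures X"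
  by (rule bounded_measuresI[where C = 1]) (use assms in \<open>auto simp: dirac_def continuous_intros\<close>)

lemma measure_linear_combination:
  fixes X :: "'k::complete_ultrametric_field set"
  assumes \<mu>: "\<mu> \<in> bounded_measures X" and \<nu>: "\<nu> \<in> bounded_measures X" and "X \<noteq> {}"
  shows "(\<lambda>f. \<mu> f - a * \<nu> f) \<in> bounded_measures X"
proof -
  obtain C where "norm_bound X \<mu> C" using measure_bound[OF \<mu>] by blast
  note C = norm_boundD(2)[OF this]
  obtain D where "norm_bound X \<nu> D" using measure_bound[OF \<nu>] by blast
  note D = norm_boundD(2)[OF this]
  show ?thesis
  proof (rule bounded_measuresI[where C = "max C (vabs a * D)"])
    fix f :: "'k \<Rightarrow> 'k" and b assume f: "continuous_on X f" "\<And>x. x \<in> X \<Longrightarrow> vabs (f x) \<le> b"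
    then have b: "b \<ge> 0" using assms(3) by (meson equals0I order_trans vabs_nonneg)
    have "C * b \<le> max C (vabs a * D) * b" "vabs a * D * b \<le> max C (vabs a * D) * b"
      using b by (auto intro: mult_right_mono)
    moreover have "vabs (a * \<nu> f) \<le> vabs a * D * b"
      using mult_left_mono[OF D[OF f(1) b f(2)] vabs_nonneg] by (simp add: vabs_mult mult.assoc)
    ultimately show "vabs (\<mu> f - a * \<nu> f) \<le> max C (vabs a * D) * b"
      using C[OF f(1) b f(2)] by (intro vabs_diff_le) auto
  qed (simp_all add: measure_add[OF \<mu>] measure_add[OF \<nu>] measure_cmult[OF \<mu>] measure_cmult[OF \<nu>]
        measure_discontinuous[OF \<mu>] measure_discontinuous[OF \<nu>] algebra_simps)
qed

section \<open>Polynomials are dense, and moments determine a measure\<close>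

context padic_field
begin

lemma dvd_if_vabs_le:
  assumes "vabs (of_int a :: 'k) \<le> (1 / real p) ^ m"
  shows "int p ^ m dvd a"
  using assms
proof (induction m arbitrary: a)
  case (Suc m)
  have "(1 / real p) ^ Suc m \<le> 1 / real p" using inv_p_power_le[of 1 "Suc m"] by simp
  then have "vabs (of_int a :: 'k) < 1" using Suc.prems inv_p_less_1 by linarith
  then have "int p dvd a" using vabs_of_int_unit[of a] by auto
  then obtain b where b: "a = int p * b" by auto
  have "1 / real p * vabs (of_int b :: 'k) \<le> 1 / real p * (1 / real p) ^ m"
    using Suc.prems by (simp add: b vabs_mult vabs_p)
  moreover have "0 < 1 / real p" using p_pos by simp
  ultimately have "vabs (of_int b :: 'k) \<le> (1 / real p) ^ m"
    by (simp only: mult_le_cancel_left_pos)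
  then show ?case using Suc.IH[of b] by (simp add: b)
qed simp

text \<open>
  The indicator function of the disc \<open>a + p\<^bsup>m+1\<^esup> Zp\<close> is the product of that of \<open>a + p\<^sup>m Zp\<close>
  with the indicator of the nonunits evaluated at \<open>(x - a) / p\<^sup>m\<close>. The latter is approximated
  by \<open>1 - y\<^bsup>(p-1) p^k\<^esup>\<close>, whose growth outside the bigger disc is absorbed by
  approximating the former indicator well enough.
\<close>

lemma disc_indicator_approx:
  assumes a: "a \<in> (Zp :: 'k set)" and e: "0 < e"
  shows "\<exists>q. \<forall>x\<in>Zp. vabs (poly q x - (if vabs (x - a) \<le> (1 / real p) ^ m then 1 else 0)) \<le> e"
  using e
proof (induction m arbitrary: e)
  case 0
  have "vabs (x - a) \<le> 1" if "x \<in> Zp" for x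
    using Zp_diff[OF that a] by (simp add: Zp_def)
  then show ?case using 0 by (intro exI[of _ 1]) auto
next
  case (Suc m)
  define e' where "e' = min e 1"
  have e': "0 < e'" "e' \<le> e" "e' \<le> 1" using Suc.prems by (auto simp: e'_def)
  obtain k where k: "(1 / real p) ^ k < e'" using ex_inv_p_power_less e'(1) by blast
  then have k': "(1 / real p) ^ Suc k \<le> e'" using inv_p_power_le[of k "Suc k"] by linarith
  define N where "N = (p - 1) * p ^ k"
  define P :: 'k where "P = of_nat p ^ m"
  have P: "P \<noteq> 0" "vabs P = (1 / real p) ^ m" using p_pos by (auto simp: P_def vabs_p_power)
  \<comment> \<open>\<open>M\<close> bounds \<open>y\<^sup>N\<close> at \<open>y = (x - a) / p\<^sup>m\<close> for all \<open>x\<close> in \<open>Zp\<close>, also outside the bigger disc.\<close>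
  define M where "M = (real p ^ m) ^ N"
  have M: "M \<ge> 1" "M > 0" using p_pos by (auto simp: M_def intro!: one_le_power)
  have "0 < e' / M" using e' M by simp
  from Suc.IH[OF this] obtain q where
    q: "\<And>x. x \<in> Zp \<Longrightarrow> vabs (poly q x - (if vabs (x - a) \<le> (1 / real p) ^ m then 1 else 0)) \<le> e' / M"
    by blast
  define g where "g = 1 - [:- a / P, 1 / P:] ^ N"
  have g: "poly g x = 1 - ((x - a) / P) ^ N" for x
    by (simp add: g_def diff_divide_distrib)
  show ?case
  proof (intro exI[of _ "g * q"] ballI)
    fix x :: 'k assume x: "x \<in> Zp"
    show "vabs (poly (g * q) x - (if vabs (x - a) \<le> (1 / real p) ^ Suc m then 1 else 0)) \<le> e"
    proof (cases "vabs (x - a) \<le> (1 / real p) ^ m")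
      case True
      define y where "y = (x - a) / P"
      have vy: "vabs y \<le> 1" using True p_pos by (simp add: y_def vabs_divide P field_simps)
      have "inverse P \<in> Qp" unfolding P_def by (intro subsetD[OF Rats_subset_Qp]) simp
      then have y: "y \<in> Zp" using vy Zp_diff[OF x a]
        by (simp add: Zp_def y_def divide_inverse Qp_mult)
      have iff: "vabs (x - a) \<le> (1 / real p) ^ Suc m \<longleftrightarrow> y \<notin> Zp_units"
      proof -
        have "vabs (x - a) \<le> (1 / real p) ^ Suc m \<longleftrightarrow> vabs y \<le> 1 / real p"
          using p_pos by (simp add: y_def vabs_divide P field_simps)
        also have "\<dots> \<longleftrightarrow> vabs y \<noteq> 1"
          using Zp_vabs_less_1[OF y] vy inv_p_less_1 by force
        finally show ?thesis using y by (simp add: Zp_units_iff)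
      qed
      have 1: "vabs (poly g x - (if vabs (x - a) \<le> (1 / real p) ^ Suc m then 1 else 0)) \<le> e'"
        unfolding g iff y_def[symmetric] N_def
        using unit_power_close_1[of y k] nonunit_power_close_0[OF y, of k] k'
        by (auto simp: vabs_diff_commute[of 1])
      have "vabs (poly g x) \<le> 1"
        unfolding g y_def[symmetric] using vy by (intro vabs_diff_le) (auto simp: vabs_power power_le_one)
      moreover have "vabs (poly q x - 1) \<le> e' / M" using q[OF x] True by simp
      ultimately have "vabs (poly g x * (poly q x - 1)) \<le> 1 * (e' / M)"
        unfolding vabs_mult by (intro mult_mono) auto
      also have "\<dots> \<le> e'" using M e' by (simp add: field_simps)
      finally have 2: "vabs (poly (g * q) x - poly g x) \<le> e'" by (simp add: algebra_simps)
      show ?thesis using vabs_trans_le[OF 2 1] e' by simp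
    next
      case False
      then have F: "\<not> vabs (x - a) \<le> (1 / real p) ^ Suc m"
        using inv_p_power_le[of m "Suc m"] by simp
      have "vabs (x - a) \<le> 1" using Zp_diff[OF x a] by (simp add: Zp_def)
      then have "vabs ((x - a) / P) \<le> real p ^ m"
        using p_pos by (simp add: vabs_divide P field_simps)
      then have "vabs (((x - a) / P) ^ N) \<le> M"
        unfolding vabs_power M_def by (intro power_mono) auto
      then have "vabs (poly g x) \<le> M"
        unfolding g using M by (intro vabs_diff_le) auto
      moreover have "vabs (poly q x) \<le> e' / M" using q[OF x] False by simp
      ultimately have "vabs (poly g x * poly q x) \<le> M * (e' / M)"
        unfolding vabs_mult using M by (intro mult_mono) auto
      then show ?thesis using F M e' by simp
    qed
  qed
qed

lemma uniformly_continuous_on_Zp_units: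
  fixes f :: "'k \<Rightarrow> 'k"
  assumes "continuous_on Zp_units f" "e > 0"
  obtains d where "d > 0" "\<And>x y. x \<in> Zp_units \<Longrightarrow> y \<in> Zp_units \<Longrightarrow> vabs (x - y) < d \<Longrightarrow> vabs (f x - f y) < e"
proof -
  have "uniformly_continuous_on Zp_units f"
    using assms(1) compact_Zp_units by (rule compact_uniformly_continuous)
  then show ?thesis
    using that assms(2) unfolding uniformly_continuous_on_def dist_vabs by metis
qed

text \<open>
  A uniformly continuous \<open>f\<close> is nearly constant on small discs, hence close to the finite sum
  \<open>\<Sum>n. f n * 1\<^bsub>n + p^m Zp\<^esub>\<close>. The ultrametric inequality keeps the errors of the approximated
  indicator functions from accumulating.
\<close>

lemma polynomials_dense:
  fixes f :: "'k \<Rightarrow> 'k"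
  assumes f: "continuous_on Zp_units f" and e: "e > 0"
  shows "\<exists>q. \<forall>x\<in>Zp_units. vabs (poly q x - f x) \<le> e"
proof -
  obtain d where d: "d > 0" "\<And>x y. x \<in> Zp_units \<Longrightarrow> y \<in> Zp_units \<Longrightarrow> vabs (x - y) < d \<Longrightarrow> vabs (f x - f y) < e"
    using uniformly_continuous_on_Zp_units[OF f e] by blast
  obtain m where m: "(1 / real p) ^ m < min d 1" using ex_inv_p_power_less d(1) by (metis min_less_iff_conj zero_less_one)
  define A where "A = {n. n < p ^ m \<and> (of_nat n :: 'k) \<in> Zp_units}"
  have fA: "finite A" by (simp add: A_def)
  define M where "M = 1 + (\<Sum>n\<in>A. vabs (f (of_nat n)))"
  have M: "M \<ge> 1" by (simp add: M_def sum_nonneg)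
  have fM: "vabs (f (of_nat n)) \<le> M" if "n \<in> A" for n
    using member_le_sum[OF that, of "\<lambda>n. vabs (f (of_nat n))"] fA by (simp add: M_def)
  have "0 < e / M" using e M by simp
  then have "\<exists>q :: 'k poly. \<forall>x\<in>Zp. vabs (poly q x - (if vabs (x - of_nat n) \<le> (1 / real p) ^ m then 1 else 0)) \<le> e / M" for n
    using disc_indicator_approx[OF of_nat_in_Zp, of "e / M" n m] by blast
  then obtain q :: "nat \<Rightarrow> 'k poly" where q: "\<And>n x. x \<in> Zp \<Longrightarrow> vabs (poly (q n) x - (if vabs (x - of_nat n) \<le> (1 / real p) ^ m then 1 else 0)) \<le> e / M"
    by metis
  show ?thesis
  proof (intro exI[of _ "\<Sum>n\<in>A. Polynomial.smult (f (of_nat n)) (q n)"] ballI)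
    fix x :: 'k assume x: "x \<in> Zp_units"
    then have xZ: "x \<in> Zp" "vabs x = 1" by (auto simp: Zp_units_iff)
    then obtain n0 where n0: "n0 < p ^ m" "vabs (x - of_nat n0) \<le> (1 / real p) ^ m" using Zp_approx by blast
    have "vabs (of_nat n0 :: 'k) = 1" using vabs_eq_if_close[of x "of_nat n0"] n0 m xZ by simp
    then have un0: "(of_nat n0 :: 'k) \<in> Zp_units" by (simp add: Zp_units_iff of_nat_in_Zp)
    then have n0A: "n0 \<in> A" using n0 by (simp add: A_def)
    have uniq: "n = n0" if "n \<in> A" "vabs (x - of_nat n) \<le> (1 / real p) ^ m" for n
    proof -
      have "vabs (of_nat n - x) \<le> (1 / real p) ^ m" using that by (simp add: vabs_diff_commute)
      from vabs_trans_le[OF this n0(2)]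
      have "vabs (of_int (int n - int n0) :: 'k) \<le> (1 / real p) ^ m" by simp
      then have "int p ^ m dvd int n - int n0" by (rule dvd_if_vabs_le)
      then have "[n = n0] (mod p ^ m)"
        by (metis cong_iff_dvd_diff cong_int_iff of_nat_power)
      then show ?thesis using n0 that by (simp add: A_def cong_def)
    qed
    have 1: "vabs (\<Sum>n\<in>A. f (of_nat n) * poly (q n) x - (if n = n0 then f (of_nat n) else 0)) \<le> e"
    proof (rule vabs_sum_le)
      fix n assume n: "n \<in> A"
      have iff: "vabs (x - of_nat n) \<le> (1 / real p) ^ m \<longleftrightarrow> n = n0" using uniq[OF n] n0 by auto
      have "vabs (f (of_nat n) * (poly (q n) x - (if n = n0 then 1 else 0))) \<le> M * (e / M)"
        unfolding vabs_mult using q[OF xZ(1), of n] fM[OF n] M unfolding iff by (intro mult_mono) auto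
      also have "f (of_nat n) * (poly (q n) x - (if n = n0 then 1 else 0))
          = f (of_nat n) * poly (q n) x - (if n = n0 then f (of_nat n) else 0)"
        by (simp add: algebra_simps)
      finally show "vabs (f (of_nat n) * poly (q n) x - (if n = n0 then f (of_nat n) else 0)) \<le> e"
        using M by simp
    qed (use e in simp)
    have 2: "(\<Sum>n\<in>A. f (of_nat n) * poly (q n) x - (if n = n0 then f (of_nat n) else 0))
        = (\<Sum>n\<in>A. f (of_nat n) * poly (q n) x) - f (of_nat n0)"
      using fA n0A by (simp add: sum_subtractf)
    have "vabs (f (of_nat n0) - f x) \<le> e"
      using d(2)[OF un0 x] n0 m by (simp add: vabs_diff_commute[of _ x])
    from vabs_trans_le[OF 1[unfolded 2] this]
    show "vabs (poly (\<Sum>n\<in>A. Polynomial.smult (f (of_nat n)) (q n)) x - f x) \<le> e"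
      by (simp add: poly_sum)
  qed
qed

text \<open>
  All identities between measures on the units are proved through this lemma; it also stands in for
  Fubini's theorem in the algebra of measures.
\<close>

lemma measure_eq_if_moments_eq:
  assumes \<mu>: "\<mu> \<in> bounded_measures (Zp_units :: 'k set)" and \<nu>: "\<nu> \<in> bounded_measures Zp_units"
    and eq: "\<And>n. \<mu> (\<lambda>x. x ^ n) = \<nu> (\<lambda>x. x ^ n)"
  shows "\<mu> = \<nu>"
proof
  fix f :: "'k \<Rightarrow> 'k"
  show "\<mu> f = \<nu> f"
  proof (cases "continuous_on Zp_units f")
    case f: True
    have "\<forall>n. \<exists>q. \<forall>x\<in>Zp_units. vabs (poly q x - f x) \<le> (1 / real p) ^ n"
      using polynomials_dense[OF f] p_pos by simp
    then obtain q :: "nat \<Rightarrow> 'k poly" where q: "\<And>n x. x \<in> Zp_units \<Longrightarrow> vabs (poly (q n) x - f x) \<le> (1 / real p) ^ n" by metis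
    have "(\<lambda>n. \<mu> (poly (q n))) \<longlonglongrightarrow> \<mu> f"
      using continuous_on_poly_ultrametric f inv_p_power_tendsto_0 q by (rule measure_uniform_limit[OF \<mu>])
    moreover have "(\<lambda>n. \<nu> (poly (q n))) \<longlonglongrightarrow> \<nu> f"
      using continuous_on_poly_ultrametric f inv_p_power_tendsto_0 q by (rule measure_uniform_limit[OF \<nu>])
    moreover have "\<mu> (poly (q n)) = \<nu> (poly (q n))" for n
      by (simp add: measure_poly[OF \<mu>] measure_poly[OF \<nu>] eq)
    ultimately show ?thesis using LIMSEQ_unique by auto
  qed (simp add: measure_discontinuous[OF \<mu>] measure_discontinuous[OF \<nu>])
qed

section \<open>The Iwasawa algebra\<close>

lemma continuous_on_translate:
  fixes f :: "'k \<Rightarrow> 'k"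
  assumes "continuous_on Zp_units f" "x \<in> Zp_units"
  shows "continuous_on Zp_units (\<lambda>y. f (x * y))"
  by (rule continuous_on_compose2[OF assms(1)])
     (use assms(2) in \<open>auto intro!: continuous_intros Zp_units_mult\<close>)

text \<open>
  Uniform continuity of \<open>f\<close> on the compact group of units makes \<open>y \<mapsto> f (x y)\<close> depend
  continuously on \<open>x\<close> in the supremum norm, since \<open>|x' y - x y| = |x' - x|\<close> for a unit \<open>y\<close>.
\<close>

lemma continuous_on_inner_integral:
  assumes \<nu>: "\<nu> \<in> bounded_measures (Zp_units :: 'k set)" and f: "continuous_on Zp_units f"
  shows "continuous_on Zp_units (\<lambda>x. \<nu> (\<lambda>y. f (x * y)))"
  unfolding continuous_on_iff
proof (intro ballI allI impI)
  fix x :: 'k and e :: real assume x: "x \<in> Zp_units" and e: "e > 0"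
  obtain C where "norm_bound Zp_units \<nu> C" using measure_bound[OF \<nu>] by blast
  note C = norm_boundD[OF this]
  define e' where "e' = e / (C + 1)"
  have e': "e' > 0" "C * e' < e" using e C(1) by (auto simp: e'_def field_simps)
  obtain d where d: "d > 0" "\<And>x y. x \<in> Zp_units \<Longrightarrow> y \<in> Zp_units \<Longrightarrow> vabs (x - y) < d \<Longrightarrow> vabs (f x - f y) < e'"
    using uniformly_continuous_on_Zp_units[OF f e'(1)] by blast
  show "\<exists>d>0. \<forall>x'\<in>Zp_units. dist x' x < d \<longrightarrow> dist (\<nu> (\<lambda>y. f (x' * y))) (\<nu> (\<lambda>y. f (x * y))) < e"
  proof (intro exI[of _ d] conjI d ballI impI)
    fix x' :: 'k assume x': "x' \<in> Zp_units" "dist x' x < d"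
    have "vabs (f (x' * y) - f (x * y)) \<le> e'" if y: "y \<in> Zp_units" for y
    proof -
      have "vabs (x' * y - x * y) = vabs (x' - x)"
        using y by (simp add: Zp_units_iff vabs_mult flip: left_diff_distrib)
      then show ?thesis using x x' y d(2)[of "x' * y" "x * y"] by (simp add: Zp_units_mult dist_vabs)
    qed
    then have "vabs (\<nu> (\<lambda>y. f (x' * y) - f (x * y))) \<le> C * e'"
      using e' x x'(1) f by (intro C(2)) (auto intro!: continuous_intros continuous_on_translate)
    then show "dist (\<nu> (\<lambda>y. f (x' * y))) (\<nu> (\<lambda>y. f (x * y))) < e"
      using measure_diff[OF \<nu> continuous_on_translate[OF f x'(1)] continuous_on_translate[OF f x]] e'
      by (simp add: dist_vabs)
  qed
qed

lemma convolution_bounded: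
  assumes \<mu>: "\<mu> \<in> bounded_measures (Zp_units :: 'k set)" and \<nu>: "\<nu> \<in> bounded_measures Zp_units"
  shows "convolution Zp_units \<mu> \<nu> \<in> bounded_measures Zp_units"
proof -
  obtain C where "norm_bound Zp_units \<mu> C" using measure_bound[OF \<mu>] by blast
  note C = norm_boundD[OF this]
  obtain D where "norm_bound Zp_units \<nu> D" using measure_bound[OF \<nu>] by blast
  note D = norm_boundD[OF this]
  show ?thesis
  proof (rule bounded_measuresI[where C = "C * D"])
    fix f g :: "'k \<Rightarrow> 'k" assume f: "continuous_on Zp_units f" and g: "continuous_on Zp_units g"
    have "\<mu> (\<lambda>x. \<nu> (\<lambda>y. f (x * y) + g (x * y))) = \<mu> (\<lambda>x. \<nu> (\<lambda>y. f (x * y)) + \<nu> (\<lambda>y. g (x * y)))"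
      by (intro measure_cong[OF \<mu>] measure_add[OF \<nu>] continuous_on_translate f g)
    also have "\<dots> = \<mu> (\<lambda>x. \<nu> (\<lambda>y. f (x * y))) + \<mu> (\<lambda>x. \<nu> (\<lambda>y. g (x * y)))"
      by (intro measure_add[OF \<mu>] continuous_on_inner_integral \<nu> f g)
    finally show "convolution Zp_units \<mu> \<nu> (\<lambda>x. f x + g x)
        = convolution Zp_units \<mu> \<nu> f + convolution Zp_units \<mu> \<nu> g"
      using f g by (simp add: convolution_def continuous_intros)
  next
    fix a and f :: "'k \<Rightarrow> 'k" assume f: "continuous_on Zp_units f"
    have "\<mu> (\<lambda>x. \<nu> (\<lambda>y. a * f (x * y))) = \<mu> (\<lambda>x. a * \<nu> (\<lambda>y. f (x * y)))"
      by (intro measure_cong[OF \<mu>] measure_cmult[OF \<nu>] continuous_on_translate f)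
    also have "\<dots> = a * \<mu> (\<lambda>x. \<nu> (\<lambda>y. f (x * y)))"
      by (intro measure_cmult[OF \<mu>] continuous_on_inner_integral \<nu> f)
    finally show "convolution Zp_units \<mu> \<nu> (\<lambda>x. a * f x) = a * convolution Zp_units \<mu> \<nu> f"
      using f by (simp add: convolution_def continuous_intros)
  next
    fix f :: "'k \<Rightarrow> 'k" and b assume f: "continuous_on Zp_units f" "\<And>x. x \<in> Zp_units \<Longrightarrow> vabs (f x) \<le> b"
    have b: "b \<ge> 0" using f(2)[OF one_in_Zp_units] order_trans vabs_nonneg by blast
    have "vabs (\<nu> (\<lambda>y. f (x * y))) \<le> D * b" if "x \<in> Zp_units" for x
      using that b f by (intro D) (auto intro: continuous_on_translate Zp_units_mult)
    then have "vabs (\<mu> (\<lambda>x. \<nu> (\<lambda>y. f (x * y)))) \<le> C * (D * b)"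
      using b D(1) by (intro C continuous_on_inner_integral \<nu> f) auto
    then show "vabs (convolution Zp_units \<mu> \<nu> f) \<le> C * D * b"
      using f by (simp add: convolution_def mult.assoc)
  qed (simp add: convolution_def)
qed

text \<open>
  Applied below both to the moments \<open>x\<^sup>n\<close> and to the characters \<open>\<omega>(x)\<^sup>j \<langle>x\<rangle>\<^sup>s\<close>.
\<close>

lemma convolution_multiplicative:
  assumes \<mu>: "\<mu> \<in> bounded_measures (Zp_units :: 'k set)" and \<nu>: "\<nu> \<in> bounded_measures Zp_units"
    and f: "continuous_on Zp_units f"
    and mult: "\<And>x y. x \<in> Zp_units \<Longrightarrow> y \<in> Zp_units \<Longrightarrow> f (x * y) = f x * f y"
  shows "convolution Zp_units \<mu> \<nu> f = \<mu> f * \<nu> f"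
proof -
  have "\<mu> (\<lambda>x. \<nu> (\<lambda>y. f (x * y))) = \<mu> (\<lambda>x. f x * \<nu> f)"
  proof (rule measure_cong[OF \<mu>])
    fix x :: 'k assume x: "x \<in> Zp_units"
    have "\<nu> (\<lambda>y. f (x * y)) = \<nu> (\<lambda>y. f x * f y)"
      using x mult by (intro measure_cong[OF \<nu>]) auto
    then show "\<nu> (\<lambda>y. f (x * y)) = f x * \<nu> f" by (simp add: measure_cmult[OF \<nu> f])
  qed
  then show ?thesis using f by (simp add: convolution_def measure_mult_const[OF \<mu> f])
qed

lemma convolution_moment:
  assumes "\<mu> \<in> bounded_measures (Zp_units :: 'k set)" "\<nu> \<in> bounded_measures Zp_units"
  shows "convolution Zp_units \<mu> \<nu> (\<lambda>x. x ^ n) = \<mu> (\<lambda>x. x ^ n) * \<nu> (\<lambda>x. x ^ n)"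
  using assms by (rule convolution_multiplicative) (auto intro: continuous_intros simp: power_mult_distrib)

abbreviation \<Lambda> :: "'k functional ring" where "\<Lambda> \<equiv> Iwasawa_algebra"

lemma Iwasawa_simps:
  "carrier \<Lambda> = bounded_measures Zp_units" "mult \<Lambda> = convolution Zp_units" "one \<Lambda> = dirac Zp_units 1"
  by (simp_all add: Iwasawa_algebra_def)

lemma one_moment: "dirac (Zp_units :: 'k set) u (\<lambda>x. x ^ n) = u ^ n"
  by (simp add: dirac_def continuous_intros)

text \<open>
  All monoid laws, commutativity included, hold because both sides have the same moments: the
  moments of a convolution are the products of the moments.
\<close>

lemma Iwasawa_comm_monoid: "comm_monoid \<Lambda>"
proof (rule comm_monoidI)
  show one: "\<one>\<^bsub>\<Lambda>\<^esub> \<in> carrier \<Lambda>" by (simp add: Iwasawa_simps dirac_bounded one_in_Zp_units)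
  fix x y assume x: "x \<in> carrier \<Lambda>" and y: "y \<in> carrier \<Lambda>"
  show xy: "x \<otimes>\<^bsub>\<Lambda>\<^esub> y \<in> carrier \<Lambda>" using x y by (simp add: Iwasawa_simps convolution_bounded)
  show "x \<otimes>\<^bsub>\<Lambda>\<^esub> y = y \<otimes>\<^bsub>\<Lambda>\<^esub> x" using x y unfolding Iwasawa_simps
    by (intro measure_eq_if_moments_eq convolution_bounded) (auto simp: convolution_moment mult.commute)
  show "\<one>\<^bsub>\<Lambda>\<^esub> \<otimes>\<^bsub>\<Lambda>\<^esub> x = x" using x one unfolding Iwasawa_simps
    by (intro measure_eq_if_moments_eq convolution_bounded) (auto simp: convolution_moment one_moment)
  fix z assume z: "z \<in> carrier \<Lambda>"
  show "x \<otimes>\<^bsub>\<Lambda>\<^esub> y \<otimes>\<^bsub>\<Lambda>\<^esub> z = x \<otimes>\<^bsub>\<Lambda>\<^esub> (y \<otimes>\<^bsub>\<Lambda>\<^esub> z)" using x y z unfolding Iwasawa_simps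
    by (intro measure_eq_if_moments_eq convolution_bounded) (auto simp: convolution_moment convolution_bounded mult.assoc)
qed

lemma r_elt_bounded: "coprime c p \<Longrightarrow> r_elt c \<in> bounded_measures (Zp_units :: 'k set)"
  unfolding r_elt_def using one_in_Zp_units
  by (intro measure_linear_combination dirac_bounded of_nat_in_Zp_units) auto

lemma r_elt_continuous:
  "continuous_on Zp_units f \<Longrightarrow> (r_elt c :: 'k functional) f = f 1 - of_nat c * f (of_nat c)"
  by (simp add: r_elt_def dirac_def)

lemma r_elt_moment: "(r_elt c :: 'k functional) (\<lambda>x. x ^ n) = 1 - of_nat c ^ Suc n"
  by (simp add: r_elt_continuous continuous_intros)

lemma r_elt_moment_nonzero:
  assumes "c > 1"
  shows "(1 - of_nat c ^ Suc n :: 'k) \<noteq> 0"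
proof -
  have "c ^ Suc n > 1" using assms by (intro one_less_power) auto
  then have "c ^ Suc n \<noteq> 1" by linarith
  then have "of_nat (c ^ Suc n) \<noteq> (of_nat 1 :: 'k)" unfolding of_nat_eq_iff .
  then show ?thesis by (metis eq_iff_diff_eq_0 of_nat_1 of_nat_power)
qed

lemma denominators_subset: "denominators p \<subseteq> carrier \<Lambda>"
proof
  interpret comm_monoid \<Lambda> by (rule Iwasawa_comm_monoid)
  fix r :: "'k functional" assume "r \<in> denominators p"
  then show "r \<in> carrier \<Lambda>"
  proof induction
    case (mult c r)
    have "r_elt c \<in> carrier \<Lambda>" using r_elt_bounded mult by (simp add: Iwasawa_simps)
    then show ?case using mult by simp
  qed simp
qed

lemma denominators_mult:
  assumes "(r :: 'k functional) \<in> denominators p" "s \<in> denominators p"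
  shows "r \<otimes>\<^bsub>\<Lambda>\<^esub> s \<in> denominators p"
  using assms
proof (induction rule: denominators.induct)
  interpret comm_monoid \<Lambda> by (rule Iwasawa_comm_monoid)
  {
    case one
    then show ?case using subsetD[OF denominators_subset one] by simp
  next
    case (mult c r)
    have "r_elt c \<in> carrier \<Lambda>" "r \<in> carrier \<Lambda>" "s \<in> carrier \<Lambda>"
      using r_elt_bounded mult denominators_subset by (auto simp: Iwasawa_simps)
    then have "r_elt c \<otimes>\<^bsub>\<Lambda>\<^esub> r \<otimes>\<^bsub>\<Lambda>\<^esub> s = r_elt c \<otimes>\<^bsub>\<Lambda>\<^esub> (r \<otimes>\<^bsub>\<Lambda>\<^esub> s)" by (simp add: m_assoc)
    then show ?case using mult denominators.mult by metis
  }
qed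

lemma r_elt_in_denominators:
  assumes "odd c" "c > 1" "coprime c p"
  shows "(r_elt c :: 'k functional) \<in> denominators p"
proof -
  interpret comm_monoid \<Lambda> by (rule Iwasawa_comm_monoid)
  have "r_elt c \<in> carrier \<Lambda>" using r_elt_bounded assms by (simp add: Iwasawa_simps)
  then show ?thesis using denominators.mult[OF assms denominators.one, where 'k='k] by simp
qed

lemma denominators_moment_nonzero:
  "(r :: 'k functional) \<in> denominators p \<Longrightarrow> r (\<lambda>x. x ^ n) \<noteq> 0"
proof (induction rule: denominators.induct)
  case (mult c r)
  have "r \<in> carrier \<Lambda>" using mult denominators_subset by blast
  then have "(r_elt c \<otimes>\<^bsub>\<Lambda>\<^esub> r) (\<lambda>x. x ^ n) = (1 - of_nat c ^ Suc n) * r (\<lambda>x. x ^ n)"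
    using r_elt_bounded[of c] mult by (simp add: Iwasawa_simps convolution_moment r_elt_moment)
  then show ?case using r_elt_moment_nonzero[of c n] mult by simp
qed (simp add: Iwasawa_simps one_moment)

text \<open>
  All moments of a denominator are nonzero, so the moments of \<open>a\<close> can be recovered from those of \<open>r a\<close>.
\<close>

lemma denominators_cancel:
  assumes r: "(r :: 'k functional) \<in> denominators p" and a: "a \<in> carrier \<Lambda>" "b \<in> carrier \<Lambda>"
    and eq: "r \<otimes>\<^bsub>\<Lambda>\<^esub> a = r \<otimes>\<^bsub>\<Lambda>\<^esub> b"
  shows "a = b"
proof (rule measure_eq_if_moments_eq)
  show "a \<in> bounded_measures Zp_units" "b \<in> bounded_measures Zp_units" using a by (auto simp: Iwasawa_simps)
  moreover have "r \<in> bounded_measures Zp_units" using r denominators_subset by (auto simp: Iwasawa_simps)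
  ultimately show "a (\<lambda>x. x ^ n) = b (\<lambda>x. x ^ n)" for n
    using arg_cong[OF eq, of "\<lambda>\<mu>. \<mu> (\<lambda>x. x ^ n)"] denominators_moment_nonzero[OF r, of n]
    by (simp add: Iwasawa_simps convolution_moment)
qed

end

section \<open>Localization of a commutative monoid\<close>

context
  fixes R :: "('a, 'b) ring_scheme" (structure) and S :: "'a set"
  assumes R: "comm_monoid R" and S: "S \<subseteq> carrier R"
    and S_mult: "\<And>s t. s \<in> S \<Longrightarrow> t \<in> S \<Longrightarrow> s \<otimes> t \<in> S" and S_one: "\<one> \<in> S"
begin

interpretation comm_monoid R by (rule R)

lemma loc_rel_equiv: "equiv (carrier R \<times> S) (loc_rel R S)"
proof (rule equivI)
  show "loc_rel R S \<subseteq> (carrier R \<times> S) \<times> carrier R \<times> S" by (auto simp: loc_rel_def)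
  show "refl_on (carrier R \<times> S) (loc_rel R S)"
    using S_one by (auto simp: refl_on_def loc_rel_def)
  show "sym (loc_rel R S)"
    unfolding sym_def loc_rel_def by clarsimp metis
  show "trans (loc_rel R S)"
  proof (rule transI)
    fix X Y Z assume "(X, Y) \<in> loc_rel R S" "(Y, Z) \<in> loc_rel R S"
    then obtain a s b t c r u v where XYZ: "X = (a, s)" "Y = (b, t)" "Z = (c, r)"
      and car: "a \<in> carrier R" "b \<in> carrier R" "c \<in> carrier R" "s \<in> S" "t \<in> S" "r \<in> S" "u \<in> S" "v \<in> S"
      and u: "u \<otimes> (a \<otimes> t) = u \<otimes> (b \<otimes> s)" and v: "v \<otimes> (b \<otimes> r) = v \<otimes> (c \<otimes> t)"
      unfolding loc_rel_def by auto
    have [simp]: "s \<in> carrier R" "t \<in> carrier R" "r \<in> carrier R" "u \<in> carrier R" "v \<in> carrier R"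
      using car S by auto
    note [simp] = car
    have "(u \<otimes> v \<otimes> t) \<otimes> (a \<otimes> r) = (v \<otimes> r) \<otimes> (u \<otimes> (a \<otimes> t))" by (simp add: m_ac)
    also have "\<dots> = (u \<otimes> s) \<otimes> (v \<otimes> (b \<otimes> r))" unfolding u by (simp add: m_ac)
    also have "\<dots> = (u \<otimes> v \<otimes> t) \<otimes> (c \<otimes> s)" unfolding v by (simp add: m_ac)
    finally show "(X, Z) \<in> loc_rel R S"
      using car S_mult unfolding XYZ loc_rel_def by (auto intro!: bexI[of _ "u \<otimes> v \<otimes> t"])
  qed
qed

lemma loc_frac_eqI:
  assumes "a \<in> carrier R" "b \<in> carrier R" "s \<in> S" "t \<in> S" "u \<in> S" "u \<otimes> (a \<otimes> t) = u \<otimes> (b \<otimes> s)"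
  shows "loc_frac R S a s = loc_frac R S b t"
  unfolding loc_frac_def
  by (rule equiv_class_eq[OF loc_rel_equiv]) (use assms in \<open>auto simp: loc_rel_def\<close>)

lemma loc_frac_mem:
  assumes "(b, t) \<in> loc_frac R S a s"
  shows "b \<in> carrier R" "t \<in> S" "\<exists>u\<in>S. u \<otimes> (a \<otimes> t) = u \<otimes> (b \<otimes> s)" "a \<in> carrier R" "s \<in> S"
  using assms by (auto simp: loc_frac_def loc_rel_def)

lemma loc_frac_self: "a \<in> carrier R \<Longrightarrow> s \<in> S \<Longrightarrow> (a, s) \<in> loc_frac R S a s"
  unfolding loc_frac_def using equiv_class_self[OF loc_rel_equiv] by blast

lemma loc_frac_mult:
  assumes "a \<in> carrier R" "b \<in> carrier R" "s \<in> S" "t \<in> S"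
  shows "loc_frac R S a s \<otimes>\<^bsub>localization R S\<^esub> loc_frac R S b t = loc_frac R S (a \<otimes> b) (s \<otimes> t)"
proof -
  have *: "loc_frac R S (a' \<otimes> b') (s' \<otimes> t') = loc_frac R S (a \<otimes> b) (s \<otimes> t)"
    if a': "(a', s') \<in> loc_frac R S a s" and b': "(b', t') \<in> loc_frac R S b t" for a' s' b' t'
  proof -
    obtain u where u: "u \<in> S" "u \<otimes> (a \<otimes> s') = u \<otimes> (a' \<otimes> s)" using loc_frac_mem[OF a'] by blast
    obtain v where v: "v \<in> S" "v \<otimes> (b \<otimes> t') = v \<otimes> (b' \<otimes> t)" using loc_frac_mem[OF b'] by blast
    note mem = loc_frac_mem(1,2)[OF a'] loc_frac_mem(1,2)[OF b'] assms u(1) v(1)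
    then have [simp]: "a \<in> carrier R" "b \<in> carrier R" "a' \<in> carrier R" "b' \<in> carrier R" "s \<in> carrier R"
      "t \<in> carrier R" "s' \<in> carrier R" "t' \<in> carrier R" "u \<in> carrier R" "v \<in> carrier R"
      using S by auto
    have "(u \<otimes> v) \<otimes> ((a' \<otimes> b') \<otimes> (s \<otimes> t)) = (u \<otimes> (a' \<otimes> s)) \<otimes> (v \<otimes> (b' \<otimes> t))" by (simp add: m_ac)
    also have "\<dots> = (u \<otimes> v) \<otimes> ((a \<otimes> b) \<otimes> (s' \<otimes> t'))"
      unfolding u(2)[symmetric] v(2)[symmetric] by (simp add: m_ac)
    finally have eq: "(u \<otimes> v) \<otimes> ((a' \<otimes> b') \<otimes> (s \<otimes> t)) = (u \<otimes> v) \<otimes> ((a \<otimes> b) \<otimes> (s' \<otimes> t'))" .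
    have "a' \<otimes> b' \<in> carrier R" "a \<otimes> b \<in> carrier R" by simp_all
    moreover have "s' \<otimes> t' \<in> S" "s \<otimes> t \<in> S" "u \<otimes> v \<in> S" using mem S_mult by simp_all
    ultimately show ?thesis using eq by (rule loc_frac_eqI)
  qed
  have const: "\<Union> (F ` X) = C" if "x \<in> X" "\<And>x. x \<in> X \<Longrightarrow> F x = C"
    for F :: "'a \<times> 'a \<Rightarrow> ('a \<times> 'a) set" and X x C
    using that by blast
  have "(\<Union>(a', s')\<in>loc_frac R S a s. \<Union>(b', t')\<in>loc_frac R S b t. loc_frac R S (a' \<otimes> b') (s' \<otimes> t'))
      = loc_frac R S (a \<otimes> b) (s \<otimes> t)"
    using * by (intro const[OF loc_frac_self[OF assms(1,3)]], clarify)
      (intro const[OF loc_frac_self[OF assms(2,4)]], clarify)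
  then show ?thesis by (simp add: localization_def)
qed

lemma localization_elem:
  assumes "X \<in> carrier (localization R S)"
  obtains a s where "a \<in> carrier R" "s \<in> S" "X = loc_frac R S a s"
  using assms by (auto simp: localization_def loc_frac_def elim!: quotientE)

end

section \<open>Bernoulli polynomials and the moments of the half-shift measure\<close>

definition bern_fps :: "'k::field_char_0 \<Rightarrow> 'k fps" where
  "bern_fps x = fps_X * fps_exp x / (fps_exp 1 - 1)"

lemma bernpoly_eq: "bernpoly n x = fact n * bern_fps x $ n"
  by (simp add: bernpoly_def bern_fps_def)

lemma bern_fps_mult: "bern_fps x * (fps_exp 1 - 1) = fps_X * fps_exp (x :: 'k::field_char_0)"
proof -
  have "subdegree (fps_exp 1 - 1 :: 'k fps) = 1"
    by (rule subdegreeI) auto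
  moreover have "subdegree (fps_X * fps_exp x) = 1"
    by (rule subdegreeI) auto
  ultimately have "(fps_exp 1 - 1 :: 'k fps) dvd fps_X * fps_exp x"
    by (subst fps_dvd_iff) auto
  then show ?thesis unfolding bern_fps_def by (rule dvd_div_mult_self)
qed

lemma bern_fps_scaled_mult:
  "(bern_fps x oo (fps_const c * fps_X)) * (fps_exp c - 1)
     = fps_const c * fps_X * fps_exp (c * x :: 'k::field_char_0)"
proof -
  let ?g = "fps_const c * fps_X :: 'k fps"
  have g: "?g $ 0 = 0" by simp
  have "(bern_fps x * (fps_exp 1 - 1)) oo ?g = (bern_fps x oo ?g) * (fps_exp c - 1)"
    by (simp add: fps_compose_mult_distrib[OF g] fps_compose_sub_distrib)
  moreover have "(fps_X * fps_exp x) oo ?g = fps_const c * fps_X * fps_exp (c * x)"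
    by (simp add: fps_compose_mult_distrib[OF g])
  ultimately show ?thesis by (simp add: bern_fps_mult)
qed

text \<open>
  With \<open>u = e\<^bsup>t/2\<^esup>\<close> this is the identity \<open>t / (u - 1) - t / (u\<^sup>2 - 1) = t u / (u\<^sup>2 - 1)\<close>.
\<close>

lemma bernpoly_half:
  "bernpoly (Suc n) (1 / 2 :: 'k::field_char_0) = (inverse 2 ^ n - 1) * bernpoly (Suc n) 0"
proof -
  define U :: "'k fps" where "U = fps_exp (1 / 2)"
  have U2: "fps_exp 1 = U * U" unfolding U_def by (simp flip: fps_exp_add_mult)
  define W where "W = bern_fps (0 :: 'k) oo (fps_const (1 / 2) * fps_X)"
  have W: "W * (U - 1) = fps_const (1 / 2) * fps_X"
    using bern_fps_scaled_mult[of "0 :: 'k" "1 / 2"] by (simp add: W_def U_def)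
  have B0: "bern_fps (0 :: 'k) * (U * U - 1) = fps_X"
    using bern_fps_mult[of "0 :: 'k"] by (simp add: U2)
  have "(2 * W - bern_fps 0) * (U * U - 1) = 2 * (W * (U - 1)) * (U + 1) - bern_fps 0 * (U * U - 1)"
    by (simp add: algebra_simps)
  also have "2 * (W * (U - 1)) = fps_X"
    unfolding W by (simp add: mult.assoc[symmetric] numeral_fps_const)
  also have "fps_X * (U + 1) - bern_fps 0 * (U * U - 1) = fps_X * U"
    unfolding B0 by (simp add: algebra_simps)
  finally have "(2 * W - bern_fps 0) * (fps_exp 1 - 1) = fps_X * fps_exp (1 / 2)"
    unfolding U2[symmetric] by (simp only: U_def)
  then have "(2 * W - bern_fps 0) * (fps_exp 1 - 1) = bern_fps (1 / 2) * (fps_exp 1 - 1)"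
    by (simp only: bern_fps_mult)
  then have "2 * W - bern_fps 0 = bern_fps (1 / 2)" by simp
  then have "bern_fps (1 / 2) $ Suc n = (2 * W - bern_fps 0) $ Suc n" by simp
  also have "\<dots> = (2 * (1 / 2) ^ Suc n - 1) * bern_fps 0 $ Suc n"
    by (simp add: W_def fps_compose_linear numeral_fps_const left_diff_distrib)
  also have "2 * (1 / 2) ^ Suc n = (inverse 2 ^ n :: 'k)" unfolding power_Suc inverse_eq_divide by simp
  finally show ?thesis by (simp add: bernpoly_eq)
qed

text \<open>The substitution \<open>T = e\<^sup>t - 1\<close> turns the Amice transform into the moment generating function.\<close>

lemma fps_binomial_compose_exp: "fps_binomial x oo (fps_exp 1 - 1) = fps_exp (x :: 'k::field_char_0)"
proof -
  let ?g = "fps_exp 1 - 1 :: 'k fps"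
  have g: "?g $ 0 = 0" by simp
  have "fps_deriv (fps_binomial x) * (1 + fps_X) = fps_const x * fps_binomial x"
    unfolding fps_binomial_deriv by (simp add: fps_divide_unit mult.assoc inverse_mult_eq_1)
  then have "(fps_deriv (fps_binomial x) * (1 + fps_X)) oo ?g = (fps_const x * fps_binomial x) oo ?g"
    by simp
  then have "(fps_deriv (fps_binomial x) oo ?g) * fps_exp 1 = fps_const x * (fps_binomial x oo ?g)"
    by (simp add: fps_compose_mult_distrib[OF g] fps_compose_add_distrib)
  then have "fps_deriv (fps_binomial x oo ?g) = fps_const x * (fps_binomial x oo ?g)"
    by (simp add: fps_compose_deriv[OF g])
  then show ?thesis
    by (subst (asm) fps_exp_unique_ODE) simp
qed

lemma continuous_on_gbinomial [continuous_intros]: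
  "continuous_on X (\<lambda>x :: 'k::complete_ultrametric_field. x gchoose n)"
proof (induction n)
  case (Suc n)
  have "(\<lambda>x :: 'k. x gchoose Suc n) = (\<lambda>x. (x gchoose n) * (x - of_nat n) * inverse (of_nat (Suc n)))"
    by (simp add: gbinomial_prod_rev field_simps del: of_nat_Suc)
  moreover have "continuous_on X (\<lambda>x :: 'k. (x gchoose n) * (x - of_nat n) * inverse (of_nat (Suc n)))"
    by (intro continuous_intros Suc)
  ultimately show ?case by metis
qed simp

lemma amice_transform_moments:
  assumes "\<mu> \<in> bounded_measures X"
  shows "(amice_transform \<mu> oo (fps_exp 1 - 1)) $ n
      = \<mu> (\<lambda>x :: 'k::complete_ultrametric_field. x ^ n) / fact n"
proof -
  let ?e = "\<lambda>i. ((fps_exp 1 - 1) ^ i $ n :: 'k)"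
  have "(amice_transform \<mu> oo (fps_exp 1 - 1)) $ n = (\<Sum>i=0..n. \<mu> (\<lambda>x. x gchoose i) * ?e i)"
    by (simp add: fps_compose_nth amice_transform_def)
  also have "\<dots> = (\<Sum>i=0..n. \<mu> (\<lambda>x. (x gchoose i) * ?e i))"
    by (intro sum.cong refl measure_mult_const[OF assms, symmetric] continuous_intros)
  also have "\<dots> = \<mu> (\<lambda>x. \<Sum>i=0..n. (x gchoose i) * ?e i)"
    by (intro measure_sum[OF assms, symmetric] continuous_intros)
  also have "(\<lambda>x. \<Sum>i=0..n. (x gchoose i) * ?e i) = (\<lambda>x. (fps_binomial x oo (fps_exp 1 - 1)) $ n)"
    by (simp add: fps_compose_nth)
  also have "\<dots> = (\<lambda>x. x ^ n * inverse (fact n))"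
    by (simp add: fps_binomial_compose_exp divide_inverse)
  also have "\<mu> \<dots> = \<mu> (\<lambda>x. x ^ n) * inverse (fact n)"
    by (intro measure_mult_const[OF assms] continuous_intros)
  finally show ?thesis by (simp add: divide_inverse)
qed

text \<open>
  Clearing denominators and substituting \<open>T = e\<^sup>t - 1\<close>, the defining identity becomes
  \<open>t A = b(t) - b(c t)\<close>, where \<open>A\<close> generates the moments and \<open>b(t) = t e\<^bsup>t/2\<^esup> / (e\<^sup>t - 1)\<close>
  generates the values \<open>B\<^sub>n(1/2) / n!\<close>.
\<close>

lemma half_shift_moment:
  fixes \<mu> :: "'k::complete_ultrametric_field functional"
  assumes \<mu>: "is_half_shift_measure c \<mu>" and c: "c > 0"
  shows "\<mu> (\<lambda>x. x ^ n) = (1 - of_nat c ^ Suc n) * (bernpoly (Suc n) (1 / 2) / of_nat (Suc n))"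
proof -
  define A where "A = amice_transform \<mu>"
  define D :: "'k fps" where "D = (1 + fps_X) ^ c - 1"
  have bm: "\<mu> \<in> bounded_measures Zp" using \<mu> by (simp add: is_half_shift_measure_def)
  have D: "D oo (fps_exp 1 - 1) = fps_exp (of_nat c) - 1"
    unfolding D_def fps_binomial_of_nat[symmetric]
    by (simp add: fps_compose_sub_distrib fps_binomial_compose_exp)
  have D0: "D \<noteq> 0"
  proof
    assume "D = 0"
    then have "fps_exp (of_nat c) - 1 = (0 :: 'k fps)" using D by simp
    then show False using c by simp
  qed
  have fls: "fps_to_fls A = fps_to_fls (fps_binomial (1/2)) / fls_X
       - of_nat c * (fps_to_fls (fps_binomial (of_nat c / 2)) / ((1 + fls_X) ^ c - 1))"
    using \<mu> by (simp add: is_half_shift_measure_def A_def)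
  have Dfls: "(1 + fls_X) ^ c - 1 = fps_to_fls D"
    by (simp add: D_def fps_to_fls_power)
  have clear: "(a / x - m * (b / d)) * x * d = a * d - m * b * x" if "x \<noteq> 0" "d \<noteq> 0"
    for a b d m x :: "'k fls"
    using that by (simp add: field_simps)
  have "fps_to_fls A * fls_X * fps_to_fls D
      = fps_to_fls (fps_binomial (1/2)) * fps_to_fls D - of_nat c * fps_to_fls (fps_binomial (of_nat c / 2)) * fls_X"
    unfolding fls Dfls using D0 by (intro clear) auto
  also have "fps_to_fls A * fls_X * fps_to_fls D = fps_to_fls (A * fps_X * D)"
    by (simp add: fls_times_fps_to_fls)
  also have "fps_to_fls (fps_binomial (1/2)) * fps_to_fls D - of_nat c * fps_to_fls (fps_binomial (of_nat c / 2)) * fls_X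
      = fps_to_fls (fps_binomial (1/2) * D - of_nat c * fps_binomial (of_nat c / 2) * fps_X)"
    by (simp add: fls_times_fps_to_fls fps_to_fls_of_nat)
  finally have id: "A * fps_X * D = fps_binomial (1/2) * D - of_nat c * fps_binomial (of_nat c / 2) * fps_X"
    by (simp only: fps_to_fls_eq_iff)
  define g :: "'k fps" where "g = fps_exp 1 - 1"
  define gc :: "'k fps" where "gc = fps_exp (of_nat c) - 1"
  have g: "g $ 0 = 0" "g \<noteq> 0" "gc \<noteq> 0" using c by (auto simp: g_def gc_def)
  have const: "(of_nat c :: 'k fps) oo g = of_nat c" by (simp flip: fps_of_nat)
  have binomial_exp: "fps_binomial x oo g = fps_exp x" for x :: 'k
    unfolding g_def by (rule fps_binomial_compose_exp)
  have id': "(A oo g) * g * gc = fps_exp (1/2) * gc - of_nat c * fps_exp (of_nat c / 2) * g"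
    using arg_cong[OF id, of "\<lambda>f. f oo g"] D g(1) const
    by (simp add: fps_compose_mult_distrib fps_compose_sub_distrib
        binomial_exp flip: g_def gc_def)
  define B :: "'k fps" where "B = bern_fps (1 / 2)"
  define Bc :: "'k fps" where "Bc = B oo (fps_const (of_nat c) * fps_X)"
  have B: "B * g = fps_X * fps_exp (1 / 2)" unfolding B_def g_def by (rule bern_fps_mult)
  have Bc: "Bc * gc = of_nat c * fps_X * fps_exp (of_nat c / 2)"
    using bern_fps_scaled_mult[of "1 / 2 :: 'k" "of_nat c"] by (simp add: Bc_def B_def gc_def flip: fps_of_nat)
  have "(fps_X * (A oo g)) * (g * gc) = fps_X * ((A oo g) * g * gc)" by (simp add: mult_ac)
  also have "\<dots> = (fps_X * fps_exp (1 / 2)) * gc - (of_nat c * fps_X * fps_exp (of_nat c / 2)) * g"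
    unfolding id' by (simp add: algebra_simps)
  also have "\<dots> = (B - Bc) * (g * gc)"
    unfolding B[symmetric] Bc[symmetric] by (simp add: algebra_simps)
  finally have "fps_X * (A oo g) = B - Bc" using g by simp
  from arg_cong[OF this, of "\<lambda>f. f $ Suc n"]
  have "(A oo g) $ n = (1 - of_nat c ^ Suc n) * B $ Suc n"
    by (simp add: Bc_def fps_compose_linear left_diff_distrib)
  moreover have "(A oo g) $ n = \<mu> (\<lambda>x. x ^ n) / fact n"
    unfolding A_def g_def by (rule amice_transform_moments[OF bm])
  ultimately have "\<mu> (\<lambda>x. x ^ n) = fact n * ((1 - of_nat c ^ Suc n) * B $ Suc n)"
    by (simp add: field_simps)
  also have "\<dots> = (1 - of_nat c ^ Suc n) * (bernpoly (Suc n) (1 / 2) / of_nat (Suc n))"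
    by (simp add: bernpoly_eq B_def del: of_nat_Suc)
  finally show ?thesis .
qed

text \<open>
  Faulhaber's formula for power sums, from \<open>(1 + e\<^sup>t + \<dots> + e\<^bsup>(N-1)t\<^esup>) (e\<^sup>t - 1) = e\<^bsup>Nt\<^esup> - 1\<close>.
\<close>

lemma faulhaber:
  "(\<Sum>a<N. of_nat a ^ m :: 'k::field_char_0)
     = (\<Sum>i\<le>m. of_nat (m choose i) * bernpoly (m - i) 0 * of_nat N ^ Suc i / of_nat (Suc i))"
proof -
  define S :: "'k fps" where "S = (\<Sum>a<N. fps_exp (of_nat a))"
  have "S * (fps_exp 1 - 1) = fps_exp (of_nat N) - 1"
    unfolding S_def by (induction N) (simp_all add: algebra_simps flip: fps_exp_add_mult)
  then have "(fps_X * S) * (fps_exp 1 - 1) = fps_X * (fps_exp (of_nat N) - 1)"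
    by (simp add: mult.assoc)
  also have "\<dots> = bern_fps 0 * (fps_exp (of_nat N) - 1) * (fps_exp 1 - 1)"
    using bern_fps_mult[of "0 :: 'k"] by (simp add: mult_ac)
  finally have "fps_X * S = (fps_exp (of_nat N) - 1) * bern_fps 0" by (simp add: mult.commute)
  then have "(fps_X * S) $ Suc m = (\<Sum>i=0..Suc m. (fps_exp (of_nat N) - 1) $ i * bern_fps 0 $ (Suc m - i))"
    by (simp only: fps_mult_nth)
  then have "S $ m = (\<Sum>i=0..Suc m. (fps_exp (of_nat N) - 1) $ i * bern_fps 0 $ (Suc m - i))"
    by (simp only: fps_X_mult_nth) simp
  also have "\<dots> = (\<Sum>i=Suc 0..Suc m. (fps_exp (of_nat N) - 1) $ i * bern_fps 0 $ (Suc m - i))"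
    by (subst sum.atLeast_Suc_atMost) auto
  also have "\<dots> = (\<Sum>i\<le>m. of_nat N ^ Suc i / fact (Suc i) * bern_fps 0 $ (m - i))"
    by (subst sum.atLeast_Suc_atMost_Suc_shift) (simp add: atMost_atLeast0)
  finally have S: "S $ m = \<dots>" .
  have "(\<Sum>a<N. of_nat a ^ m :: 'k) = fact m * S $ m"
    by (simp add: S_def fps_sum_nth sum_distrib_left)
  also have "\<dots> = (\<Sum>i\<le>m. fact m * (of_nat N ^ Suc i / fact (Suc i) * bern_fps 0 $ (m - i)))"
    unfolding S by (rule sum_distrib_left)
  also have "\<dots> = (\<Sum>i\<le>m. of_nat (m choose i) * bernpoly (m - i) 0 * of_nat N ^ Suc i / of_nat (Suc i))"
    by (intro sum.cong refl) (simp add: bernpoly_eq binomial_fact field_simps)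
  finally show ?thesis .
qed

section \<open>The Teichmueller character\<close>

context padic_field
begin

text \<open>
  In \<open>u\<^bsup>p-1\<^esup> - 1 = (u - 1) (1 + u + \<dots> + u\<^bsup>p-2\<^esup>)\<close> the second factor is congruent to
  \<open>p - 1\<close>, hence nonzero. This gives the uniqueness of Teichmueller representatives.
\<close>

lemma root_of_unity_close_1:
  assumes u: "u ^ (p - 1) = (1 :: 'k)" and close: "vabs (u - 1) \<le> 1 / real p"
  shows "u = 1"
proof (rule ccontr)
  assume "u \<noteq> 1"
  have u1: "vabs u = 1" using close inv_p_less_1 by (intro vabs_eq_1_if_close_1) simp
  have "0 = (u - 1) * (\<Sum>j<p - 1. u ^ j)" using power_diff_1_eq[of u "p - 1"] u by simp
  then have 0: "(\<Sum>j<p - 1. u ^ j) = 0" using \<open>u \<noteq> 1\<close> by simp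
  have "vabs (u ^ j - 1) \<le> 1 / real p" for j
    using order_trans[OF vabs_power_diff_le[of u 1 j] close] u1 by simp
  then have "vabs (\<Sum>j<p - 1. u ^ j - 1) \<le> 1 / real p" by (intro vabs_sum_le) auto
  then have "vabs (of_nat (p - 1) :: 'k) < 1"
    using 0 inv_p_less_1 by (simp add: sum_subtractf)
  then have "p dvd p - 1" by (simp add: vabs_of_nat_less_1_iff)
  then show False using p_ge_3 by (auto dest: dvd_imp_le)
qed

text \<open>
  The representative is the limit of \<open>x\<^bsup>p^k\<^esup>\<close>; consecutive terms differ by the factor
  \<open>x\<^bsup>(p-1) p^k\<^esup>\<close>, which tends to \<open>1\<close>.
\<close>

lemma Teichmueller_limit:
  assumes x: "x \<in> (Zp_units :: 'k set)"
  shows "\<exists>w\<in>Zp_units. w ^ (p - 1) = 1 \<and> vabs (x - w) \<le> 1 / real p"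
proof -
  define f where "f k = x ^ (p ^ Suc k) - x ^ (p ^ k)" for k
  have vx: "vabs x = 1" "x \<in> Zp" using x by (auto simp: Zp_units_iff)
  have f: "vabs (f k) \<le> (1 / real p) ^ Suc k" for k
  proof -
    have "p ^ Suc k = p ^ k + (p - 1) * p ^ k" using p_ge_3 by (simp add: algebra_simps)
    then have "f k = x ^ (p ^ k) * (x ^ ((p - 1) * p ^ k) - 1)"
      by (simp only: f_def right_diff_distrib power_add mult_1_right)
    then show ?thesis using unit_power_close_1[OF x, of k] by (simp add: vabs_mult vabs_power vx)
  qed
  have "f \<longlonglongrightarrow> 0" using f LIMSEQ_Suc[OF inv_p_power_tendsto_0] by (rule tendsto_0_vabs_le)
  then have "summable f" by (rule summable_if_tendsto_0)
  then obtain t where t: "f sums t" by (auto simp: summable_def)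
  define w where "w = x + t"
  have part: "(\<Sum>k<n. f k) = x ^ (p ^ n) - x" for n
    using sum_lessThan_telescope[of "\<lambda>k. x ^ (p ^ k)" n] by (simp add: f_def)
  have "(\<lambda>n. (\<Sum>k<n. f k) + x) \<longlonglongrightarrow> t + x"
    using t unfolding sums_def by (intro tendsto_add tendsto_const)
  then have lim: "(\<lambda>n. x ^ (p ^ n)) \<longlonglongrightarrow> w" by (simp add: part w_def add.commute)
  have "vabs t \<le> 1 / real p"
  proof (rule vabs_sums_le[OF t])
    show "vabs (f n) \<le> 1 / real p" for n
      using f[of n] inv_p_power_le[of 1 "Suc n"] by simp
  qed
  then have close: "vabs (x - w) \<le> 1 / real p" by (simp add: w_def)
  then have "vabs w = 1" using vabs_eq_if_close[of x w] vx inv_p_less_1 by simp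
  moreover have "w \<in> Zp"
    by (rule closed_sequentially[OF closed_Zp _ lim]) (use vx in \<open>auto intro: Zp_power\<close>)
  ultimately have "w \<in> Zp_units" by (simp add: Zp_units_iff)
  moreover have "w ^ (p - 1) = 1"
  proof (rule LIMSEQ_unique)
    show "(\<lambda>n. (x ^ (p ^ n)) ^ (p - 1)) \<longlonglongrightarrow> w ^ (p - 1)"
      using tendsto_power_strong[OF lim tendsto_const] .
    have "vabs ((x ^ (p ^ n)) ^ (p - 1) - 1) \<le> (1 / real p) ^ Suc n" for n
      using unit_power_close_1[OF x, of n] by (simp add: mult.commute flip: power_mult)
    then show "(\<lambda>n. (x ^ (p ^ n)) ^ (p - 1)) \<longlonglongrightarrow> 1"
      using LIMSEQ_Suc[OF inv_p_power_tendsto_0] by (rule tendsto_if_vabs_le)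
  qed
  ultimately show ?thesis using close by blast
qed

lemma vabs_divide_close_iff:
  assumes "vabs (w :: 'k) = 1"
  shows "vabs (x / w - 1) = vabs (x - w)"
proof -
  have "w \<noteq> 0" using assms by auto
  then have "x / w - 1 = (x - w) / w" by (simp add: field_simps)
  then show ?thesis by (simp add: vabs_divide assms)
qed

lemma vabs_root_of_unity: "w ^ (p - 1) = (1 :: 'k) \<Longrightarrow> vabs w = 1"
  using vabs_power[of w "p - 1"] p_ge_3
  by (intro power_eq_imp_eq_base[of "vabs w" "p - 1" 1]) (auto simp del: One_nat_def)

lemma Teichmueller_unique:
  assumes "w ^ (p - 1) = 1" "vabs (x - w) \<le> 1 / real p" "v ^ (p - 1) = 1" "vabs (x - v) \<le> 1 / real p"
  shows "w = (v :: 'k)"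
proof -
  have v1: "vabs v = 1" using assms(3) by (rule vabs_root_of_unity)
  have "vabs (w - v) \<le> 1 / real p"
    using vabs_trans_le[of w x "1 / real p" v] assms by (simp add: vabs_diff_commute)
  then have "vabs (w / v - 1) \<le> 1 / real p" by (simp add: vabs_divide_close_iff v1)
  moreover have "(w / v) ^ (p - 1) = 1" by (simp only: power_divide assms(1,3) div_by_1)
  ultimately have "w / v = 1" using root_of_unity_close_1 by blast
  then show ?thesis by auto
qed

lemma teichmueller_unfold:
  assumes x: "x \<in> (Zp_units :: 'k set)"
  shows "teichmueller p x \<in> Zp_units" "teichmueller p x ^ (p - 1) = 1" "vabs (x - teichmueller p x) \<le> 1 / real p"
proof -
  obtain w where w: "w \<in> Zp_units" "w ^ (p - 1) = 1" "vabs (x - w) \<le> 1 / real p"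
    using Teichmueller_limit[OF x] by blast
  have w1: "vabs w = 1" using w by (simp add: Zp_units_iff)
  have "teichmueller p x = w"
    unfolding teichmueller_def
  proof (rule the_equality)
    define y where "y = (x / w - 1) / of_nat p"
    have "x / w \<in> Qp" using Zp_units_divide[OF x w(1)] by (simp add: Zp_units_iff Zp_def)
    then have "y \<in> Qp" unfolding y_def divide_inverse[of _ "of_nat p"]
      by (intro Qp_mult Qp_diff) (use Rats_subset_Qp in auto)
    moreover have "vabs y \<le> 1"
      using w p_pos by (simp add: y_def vabs_divide vabs_divide_close_iff[OF w1, unfolded vabs_divide] vabs_p field_simps)
    ultimately have "y \<in> Zp" by (simp add: Zp_def)
    moreover have "x / w = 1 + of_nat p * y" using p_pos by (simp add: y_def)
    ultimately show "w ^ (p - 1) = 1 \<and> (\<exists>y\<in>Zp. x / w = 1 + of_nat p * y)" using w by blast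
    fix v assume v: "v ^ (p - 1) = 1 \<and> (\<exists>y\<in>Zp. x / v = 1 + of_nat p * y)"
    then obtain y where y: "y \<in> Zp" "x / v = 1 + of_nat p * y" by blast
    have "vabs v = 1" using v vabs_root_of_unity by blast
    then have "vabs (x - v) = vabs (of_nat p * y)" using y vabs_divide_close_iff[of v x] by simp
    also have "\<dots> \<le> 1 / real p * 1"
      unfolding vabs_mult vabs_p using y by (intro mult_left_mono) (auto simp: Zp_def)
    finally show "v = w" using v w Teichmueller_unique[of v x w] by simp
  qed
  then show "teichmueller p x \<in> Zp_units" "teichmueller p x ^ (p - 1) = 1" "vabs (x - teichmueller p x) \<le> 1 / real p"
    using w by auto
qed

lemma teichmueller_eqI:
  assumes "x \<in> (Zp_units :: 'k set)" "w ^ (p - 1) = 1" "vabs (x - w) \<le> 1 / real p"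
  shows "teichmueller p x = w"
  using teichmueller_unfold[OF assms(1)] assms(2,3) Teichmueller_unique by blast

lemma teichmueller_nonzero: "x \<in> (Zp_units :: 'k set) \<Longrightarrow> teichmueller p x \<noteq> 0"
  using teichmueller_unfold(1) Zp_units_nonzero by blast

lemma teichmueller_mult:
  assumes "x \<in> (Zp_units :: 'k set)" "y \<in> Zp_units"
  shows "teichmueller p (x * y) = teichmueller p x * teichmueller p y"
proof (rule teichmueller_eqI)
  note X = teichmueller_unfold[OF assms(1)] and Y = teichmueller_unfold[OF assms(2)]
  show "x * y \<in> Zp_units" using assms by (rule Zp_units_mult)
  show "(teichmueller p x * teichmueller p y) ^ (p - 1) = 1" by (simp only: power_mult_distrib X(2) Y(2) mult_1)
  have "x * y - teichmueller p x * teichmueller p y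
      = x * (y - teichmueller p y) + (x - teichmueller p x) * teichmueller p y" by (simp add: algebra_simps)
  moreover have "vabs x = 1" "vabs (teichmueller p y) = 1" using assms Y by (auto simp: Zp_units_iff)
  ultimately show "vabs (x * y - teichmueller p x * teichmueller p y) \<le> 1 / real p"
    using X Y by (auto intro!: vabs_add_le simp: vabs_mult)
qed

lemma teichmueller_locally_constant:
  assumes "x \<in> (Zp_units :: 'k set)" "y \<in> Zp_units" "vabs (x - y) \<le> 1 / real p"
  shows "teichmueller p x = teichmueller p y"
  using teichmueller_unfold[OF assms(2)] vabs_trans_le[OF assms(3)] assms(1)
  by (intro teichmueller_eqI) auto

lemma teichmueller_inverse:
  assumes "x \<in> (Zp_units :: 'k set)"
  shows "teichmueller p (inverse x) = inverse (teichmueller p x)"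
proof (rule teichmueller_eqI)
  note X = teichmueller_unfold[OF assms]
  show "inverse x \<in> Zp_units" using assms by (rule Zp_units_inverse)
  show "inverse (teichmueller p x) ^ (p - 1) = 1" by (simp only: power_inverse X(2) inverse_1)
  have nz: "x \<noteq> 0" "teichmueller p x \<noteq> 0" using assms X(1) Zp_units_nonzero by auto
  then have "inverse x - inverse (teichmueller p x) = - ((x - teichmueller p x) / (x * teichmueller p x))"
    by (simp add: field_simps)
  moreover have "vabs x = 1" "vabs (teichmueller p x) = 1" using assms X by (auto simp: Zp_units_iff)
  ultimately show "vabs (inverse x - inverse (teichmueller p x)) \<le> 1 / real p"
    using X(3) by (simp add: vabs_divide vabs_mult)
qed

lemma teichmueller_powi_mod:
  assumes x: "x \<in> (Zp_units :: 'k set)" and j: "[i = j] (mod (int p - 1))"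
  shows "teichmueller p x powi i = teichmueller p x powi j"
proof -
  obtain k where k: "i = j + (int p - 1) * k" using j by (metis cong_iff_lin cong_sym)
  have "teichmueller p x powi (int p - 1) = 1"
    using teichmueller_unfold(2)[OF x] p_ge_3 by (simp add: power_int_def nat_diff_distrib)
  then show ?thesis
    unfolding k by (simp add: power_int_add power_int_mult teichmueller_nonzero[OF x])
qed

lemma continuous_on_teichmueller_powi:
  "continuous_on (Zp_units :: 'k set) (\<lambda>x. teichmueller p x powi j)"
  unfolding continuous_on_iff
proof (intro ballI allI impI)
  fix x :: 'k and e :: real assume x: "x \<in> Zp_units" and e: "e > 0"
  have "dist (teichmueller p x' powi j) (teichmueller p x powi j) < e"
    if "x' \<in> Zp_units" "dist x' x < 1 / real p" for x'
    using teichmueller_locally_constant[OF that(1) x] that(2) e by (simp add: dist_vabs)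
  moreover have "1 / real p > 0" using p_pos by simp
  ultimately show "\<exists>d>0. \<forall>x'\<in>Zp_units. dist x' x < d
      \<longrightarrow> dist (teichmueller p x' powi j) (teichmueller p x powi j) < e"
    by blast
qed

lemma angle_close_1:
  assumes "x \<in> (Zp_units :: 'k set)"
  shows "vabs (angle p x - 1) \<le> 1 / real p"
  using teichmueller_unfold[OF assms] by (simp add: angle_def vabs_divide_close_iff Zp_units_iff)

lemma teichmueller_times_angle: "x \<in> (Zp_units :: 'k set) \<Longrightarrow> teichmueller p x * angle p x = x"
  using teichmueller_nonzero[of x] by (simp add: angle_def)

lemma angle_mult:
  assumes "x \<in> (Zp_units :: 'k set)" "y \<in> Zp_units"
  shows "angle p (x * y) = angle p x * angle p y"
  using assms by (simp add: angle_def teichmueller_mult)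

lemma continuous_on_angle: "continuous_on (Zp_units :: 'k set) (angle p)"
proof -
  have eq: "angle p = (\<lambda>x :: 'k. x * teichmueller p x powi (- 1))"
    by (auto simp: angle_def power_int_minus divide_inverse)
  show ?thesis
    by (subst eq) (intro continuous_intros continuous_on_teichmueller_powi)
qed

section \<open>The p-adic power function\<close>

definition q_radius :: real where "q_radius = real p powr (1 - 1 / (real p - 1))"

text \<open>
  The number \<open>p\<^bsup>-1/(p-1)\<^esup>\<close>, which governs the size of factorials: \<open>|k!| \<ge> \<theta>\<^bsup>k-1\<^esup>\<close>.
\<close>

definition theta :: real where "theta = q_radius / real p"

lemma theta_eq: "theta = real p powr (- 1 / (real p - 1))"
proof -
  have "1 - 1 / (real p - 1) = 1 + - 1 / (real p - 1)" by simp
  then have "real p powr (1 - 1 / (real p - 1)) = real p powr 1 * real p powr (- 1 / (real p - 1))"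
    by (simp only: powr_add)
  then show ?thesis using p_pos by (simp add: theta_def q_radius_def)
qed

lemma theta_pos: "theta > 0" using p_pos by (simp add: theta_eq)

lemma theta_le_1: "theta \<le> 1"
proof -
  have "real p powr (- 1 / (real p - 1)) \<le> real p powr 0" using p_pos by (intro powr_mono) auto
  then show ?thesis using p_pos by (simp add: theta_eq)
qed

lemma theta_power: "theta ^ (p - 1) = 1 / real p"
proof -
  have "theta ^ (p - 1) = real p powr (- 1 / (real p - 1) * real (p - 1))"
    using theta_pos by (simp only: powr_realpow[symmetric]) (simp only: theta_eq powr_powr)
  also have "- 1 / (real p - 1) * real (p - 1) = - 1" using p_ge_3 by (simp add: of_nat_diff)
  finally show ?thesis using p_pos by (simp add: powr_minus_divide)
qed

lemma q_radius_gt_1: "q_radius > 1"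
proof -
  have "1 / (real p - 1) < 1" using p_ge_3 by simp
  then have "real p powr 0 < real p powr (1 - 1 / (real p - 1))" using p_pos by (intro powr_less_mono) auto
  then show ?thesis using p_pos by (simp add: q_radius_def)
qed

lemma q_radius_eq: "q_radius = real p * theta" using p_pos by (simp add: theta_def)

lemma power_disc_iff: "s \<in> power_disc p \<longleftrightarrow> vabs s < q_radius"
  by (simp add: power_disc_def q_radius_def)

text \<open>Legendre's bound \<open>v(k!) \<le> (k - 1) / (p - 1)\<close> decides where the binomial series converges.\<close>

lemma vabs_fact_add: "r < p \<Longrightarrow> vabs (fact (p * m + r) :: 'k) = vabs (fact (p * m) :: 'k)"
proof (induction r)
  case (Suc r)
  have "\<not> p dvd Suc r" using Suc.prems by (auto dest: dvd_imp_le)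
  then have "\<not> p dvd p * m + Suc r" by (subst dvd_add_right_iff) auto
  then have "vabs (of_nat (p * m + Suc r) :: 'k) = 1" by (rule vabs_of_nat_unit)
  moreover have "(fact (p * m + Suc r) :: 'k) = of_nat (p * m + Suc r) * fact (p * m + r)"
    by (simp only: add_Suc_right fact_Suc)
  ultimately show ?case using Suc by (simp only: vabs_mult)
qed simp

lemma vabs_fact_p_mult: "vabs (fact (p * m) :: 'k) = (1 / real p) ^ m * vabs (fact m :: 'k)"
proof (induction m)
  case (Suc m)
  have "p * Suc m = Suc (p * m + (p - 1))" using p_ge_3 by simp
  then have "(fact (p * Suc m) :: 'k) = of_nat (p * Suc m) * fact (p * m + (p - 1))"
    by (simp only: fact_Suc)
  then have "vabs (fact (p * Suc m) :: 'k) = vabs (of_nat p * of_nat (Suc m) :: 'k) * vabs (fact (p * m + (p - 1)) :: 'k)"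
    by (simp only: vabs_mult of_nat_mult)
  also have "vabs (fact (p * m + (p - 1)) :: 'k) = vabs (fact (p * m) :: 'k)"
    using p_ge_3 by (intro vabs_fact_add) auto
  also have "\<dots> = (1 / real p) ^ m * vabs (fact m :: 'k)" by (rule Suc)
  also have "vabs (of_nat p * of_nat (Suc m) :: 'k) * \<dots> = (1 / real p) ^ Suc m * vabs (of_nat (Suc m) * fact m :: 'k)"
    by (simp only: vabs_mult vabs_p) simp
  finally show ?case by (simp only: fact_Suc)
qed simp

lemma vabs_fact_ge: "theta ^ (k - 1) \<le> vabs (fact k :: 'k)"
proof (induction k rule: less_induct)
  case (less k)
  define m r where "m = k div p" and "r = k mod p"
  have k: "k = p * m + r" "r < p" using p_pos by (auto simp: m_def r_def)
  have vk: "vabs (fact k :: 'k) = (1 / real p) ^ m * vabs (fact m :: 'k)"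
    using vabs_fact_add[OF k(2), of m] by (simp add: k vabs_fact_p_mult)
  show ?case
  proof (cases "m = 0")
    case True
    then show ?thesis using vk theta_pos theta_le_1 by (simp add: power_le_one)
  next
    case False
    then have "m < p * m" using p_ge_3 by simp
    then have "m < k" using k by linarith
    have "theta ^ (k - 1) \<le> theta ^ ((p - 1) * m + (m - 1))"
    proof (rule power_decreasing)
      have "p * m = (p - 1) * m + m" using p_ge_3 by (simp add: algebra_simps)
      then show "(p - 1) * m + (m - 1) \<le> k - 1" using k False by simp
    qed (use theta_pos theta_le_1 in auto)
    also have "\<dots> = (1 / real p) ^ m * theta ^ (m - 1)"
      by (simp only: power_add power_mult theta_power)
    also have "\<dots> \<le> vabs (fact k :: 'k)"
      unfolding vk using less[OF \<open>m < k\<close>] by (intro mult_left_mono) auto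
    finally show ?thesis .
  qed
qed

lemma vabs_gbinomial_le:
  "vabs ((s :: 'k) gchoose Suc k) \<le> vabs s * (max 1 (vabs s) / theta) ^ k"
proof -
  have "vabs (\<Prod>i<n. s - of_nat (Suc i)) \<le> max 1 (vabs s) ^ n" for n
  proof (induction n)
    case (Suc n)
    have "vabs (s - of_nat (Suc n)) \<le> max 1 (vabs s)"
      using vabs_of_nat_le[of "Suc n", where 'k='k] by (intro vabs_diff_le) auto
    then have "vabs (\<Prod>i<n. s - of_nat (Suc i)) * vabs (s - of_nat (Suc n)) \<le> max 1 (vabs s) ^ n * max 1 (vabs s)"
      by (intro mult_mono Suc) auto
    then show ?case by (simp add: vabs_mult mult.commute)
  qed simp
  then have prod: "vabs (\<Prod>i<k. s - of_nat (Suc i)) \<le> max 1 (vabs s) ^ k" .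
  have "s gchoose Suc k = s * (\<Prod>i<k. s - of_nat (Suc i)) / fact (Suc k)"
    unfolding gbinomial_prod_rev atLeast0LessThan by (subst prod.lessThan_Suc_shift) simp
  then have "vabs (s gchoose Suc k) = vabs s * vabs (\<Prod>i<k. s - of_nat (Suc i)) / vabs (fact (Suc k) :: 'k)"
    by (simp only: vabs_mult vabs_divide)
  also have "\<dots> \<le> vabs s * max 1 (vabs s) ^ k / theta ^ k"
    using prod vabs_fact_ge[of "Suc k"] theta_pos by (intro frac_le mult_left_mono mult_nonneg_nonneg) auto
  finally show ?thesis by (simp add: power_divide)
qed

text \<open>
  The ratio of the geometric series that dominates the binomial series at \<open>s\<close>.
\<close>

definition ratio :: "'k \<Rightarrow> real" where "ratio s = max 1 (vabs s) / q_radius"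

lemma ratio_bounds: "s \<in> power_disc p \<Longrightarrow> 0 < ratio s \<and> ratio s < 1"
  using q_radius_gt_1 by (auto simp: ratio_def power_disc_iff)

lemma vabs_gbinomial_term_le:
  assumes "vabs m \<le> C * (1 / real p) ^ k" "C \<ge> 0"
  shows "vabs ((s gchoose Suc k) * m) \<le> vabs s * C * ratio (s :: 'k) ^ k"
proof -
  have "vabs ((s gchoose Suc k) * m) \<le> (vabs s * (max 1 (vabs s) / theta) ^ k) * (C * (1 / real p) ^ k)"
    unfolding vabs_mult using assms theta_pos
    by (intro mult_mono vabs_gbinomial_le) (auto intro!: mult_nonneg_nonneg)
  also have "\<dots> = vabs s * C * ratio s ^ k"
    by (simp add: ratio_def q_radius_eq power_divide power_mult_distrib mult_ac)
  finally show ?thesis .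
qed

lemma newton_series_summable:
  assumes s: "s \<in> power_disc p" and m: "\<And>k. vabs (m k :: 'k) \<le> C * (1 / real p) ^ k"
  shows "summable (\<lambda>k. (s gchoose k) * m k)"
proof (rule summable_if_tendsto_0)
  have C: "C \<ge> 0" using order_trans[OF vabs_nonneg m[of 0]] by simp
  have "vabs ((s gchoose Suc k) * m (Suc k)) \<le> vabs s * C * ratio s ^ k" for k
    using C order_trans[OF m[of "Suc k"] mult_left_mono[OF inv_p_power_le[of k "Suc k"] C]]
    by (intro vabs_gbinomial_term_le) auto
  moreover have "(\<lambda>k. vabs s * C * ratio s ^ k) \<longlonglongrightarrow> 0"
    using ratio_bounds[OF s] by (intro tendsto_mult_right_zero LIMSEQ_power_zero) auto
  ultimately have "(\<lambda>k. (s gchoose Suc k) * m (Suc k)) \<longlonglongrightarrow> 0" by (rule tendsto_0_vabs_le)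
  then show "(\<lambda>k. (s gchoose k) * m k) \<longlonglongrightarrow> 0"
    by (subst (asm) filterlim_sequentially_Suc)
qed

lemma vabs_close_power: "vabs (a - 1 :: 'k) \<le> 1 / real p \<Longrightarrow> vabs ((a - 1) ^ k) \<le> 1 * (1 / real p) ^ k"
  by (simp add: vabs_power power_mono)

lemma padic_power_sums:
  assumes "s \<in> power_disc p" "vabs (a - 1 :: 'k) \<le> 1 / real p"
  shows "(\<lambda>k. (s gchoose k) * (a - 1) ^ k) sums padic_power a s"
  unfolding padic_power_def
  by (intro summable_sums newton_series_summable[OF assms(1) vabs_close_power[OF assms(2)]])

lemma padic_power_of_nat: "padic_power a (of_nat n) = (a :: 'k) ^ n"
proof -
  have "a ^ n = ((a - 1) + 1) ^ n" by simp
  also have "\<dots> = (\<Sum>k\<le>n. of_nat (n choose k) * (a - 1) ^ k)"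
    by (subst binomial_ring) simp
  also have "\<dots> = (\<Sum>k\<le>n. (of_nat n gchoose k) * (a - 1) ^ k)" by (simp add: binomial_gbinomial)
  also have "\<dots> = padic_power a (of_nat n)"
    unfolding padic_power_def by (rule suminf_finite[symmetric]) (auto simp flip: binomial_gbinomial)
  finally show ?thesis ..
qed

lemma power_disc_of_nat: "(of_nat n :: 'k) \<in> power_disc p"
  using vabs_of_nat_le[of n, where 'k='k] q_radius_gt_1 by (simp add: power_disc_iff)

lemma power_disc_add: "s \<in> power_disc p \<Longrightarrow> t \<in> power_disc p \<Longrightarrow> (s :: 'k) + t \<in> power_disc p"
  using vabs_add_le[of s "max (vabs s) (vabs t)" t] by (auto simp: power_disc_iff)

lemma power_disc_minus: "(s :: 'k) \<in> power_disc p \<Longrightarrow> - s \<in> power_disc p"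
  by (simp add: power_disc_iff)

text \<open>Pascal's rule for generalized binomial coefficients, summed up.\<close>

lemma padic_power_Suc:
  assumes s: "s \<in> power_disc p" and a: "vabs (a - 1 :: 'k) \<le> 1 / real p"
  shows "padic_power a (s + 1) = a * padic_power a s"
proof -
  let ?u = "\<lambda>k. (s gchoose k) * (a - 1) ^ k" and ?v = "\<lambda>k. (s + 1 gchoose k) * (a - 1) ^ k"
  have s1: "s + 1 \<in> power_disc p" using power_disc_add[OF s power_disc_of_nat[of 1]] by simp
  have "(\<lambda>k. ?u (Suc k) + (a - 1) * ?u k) sums (padic_power a s - 1 + (a - 1) * padic_power a s)"
    using sums_shift[OF padic_power_sums[OF s a], of 1]
    by (intro sums_add sums_cmult padic_power_sums[OF s a]) simp
  also have "(\<lambda>k. ?u (Suc k) + (a - 1) * ?u k) = (\<lambda>k. ?v (Suc k))"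
    by (rule ext) (simp only: power_Suc gbinomial_Suc_Suc distrib_right, simp only: add_ac mult_ac)
  finally have 1: "(\<lambda>k. ?v (Suc k)) sums (padic_power a s - 1 + (a - 1) * padic_power a s)" .
  have 2: "(\<lambda>k. ?v (Suc k)) sums (padic_power a (s + 1) - 1)"
    using sums_shift[OF padic_power_sums[OF s1 a], of 1] by simp
  show ?thesis using sums_unique2[OF 1 2] by (simp add: algebra_simps)
qed

lemma padic_power_one: "padic_power 1 s = (1 :: 'k)"
  unfolding padic_power_def by (subst suminf_finite[of "{0}"]) auto

text \<open>The linear term \<open>s (a - 1)\<close> dominates the binomial series of \<open>a\<^sup>s - 1\<close>.\<close>

lemma vabs_padic_power_minus_1:
  assumes s: "s \<in> power_disc p" and a: "vabs (a - 1 :: 'k) \<le> 1 / real p"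
  shows "vabs (padic_power a s - 1) = vabs s * vabs (a - 1)"
proof (cases "s = 0 \<or> a = 1")
  case True
  then show ?thesis
    using padic_power_of_nat[of a 0] padic_power_one by auto
next
  case False
  let ?u = "\<lambda>k. (s gchoose k) * (a - 1) ^ k"
  have "(\<lambda>k. ?u (k + 2)) sums (padic_power a s - (\<Sum>k<2. ?u k))"
    by (rule sums_shift[OF padic_power_sums[OF s a]])
  moreover have "(\<Sum>k<2. ?u k) = 1 + s * (a - 1)" by (simp add: numeral_2_eq_2)
  ultimately have sums: "(\<lambda>k. ?u (Suc (Suc k))) sums (padic_power a s - 1 - s * (a - 1))"
    by (simp add: algebra_simps)
  have "vabs (padic_power a s - 1 - s * (a - 1)) \<le> vabs s * vabs (a - 1) * ratio s"
  proof (rule vabs_sums_le[OF sums])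
    fix k
    have "vabs ((a - 1) ^ Suc k) \<le> (1 / real p) ^ Suc k"
      unfolding vabs_power using a by (intro power_mono) auto
    then have "vabs ((a - 1) ^ Suc (Suc k)) \<le> vabs (a - 1) * (1 / real p) ^ Suc k"
      by (simp only: power_Suc[of _ "Suc k"] vabs_mult) (intro mult_left_mono, auto)
    then have "vabs (?u (Suc (Suc k))) \<le> vabs s * vabs (a - 1) * ratio s ^ Suc k"
      by (rule vabs_gbinomial_term_le) simp
    also have "\<dots> \<le> vabs s * vabs (a - 1) * ratio s ^ 1"
      using ratio_bounds[OF s] by (intro mult_left_mono power_decreasing) auto
    finally show "vabs (?u (Suc (Suc k))) \<le> vabs s * vabs (a - 1) * ratio s" by simp
  qed
  also have "\<dots> < vabs s * vabs (a - 1) * 1"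
    using ratio_bounds[OF s] False by (intro mult_strict_left_mono) auto
  finally have "vabs (padic_power a s - 1 - s * (a - 1)) < vabs (s * (a - 1))" by (simp add: vabs_mult)
  from vabs_add_eq[OF this] show ?thesis by (simp add: vabs_mult)
qed

lemma padic_power_close_1:
  assumes "s \<in> power_disc p" "vabs (a - 1 :: 'k) \<le> 1 / real p"
  shows "vabs (padic_power a s - 1) < 1"
proof -
  have "vabs s * vabs (a - 1) \<le> vabs s * (1 / real p)" using assms by (intro mult_left_mono) auto
  also have "\<dots> < q_radius * (1 / real p)"
    using assms p_pos by (intro mult_strict_right_mono) (auto simp: power_disc_iff)
  also have "\<dots> \<le> 1" using theta_le_1 by (simp add: theta_def)
  finally show ?thesis by (simp only: vabs_padic_power_minus_1[OF assms])
qed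

lemma vabs_close_mult:
  assumes "vabs (a - 1 :: 'k) \<le> 1 / real p" "vabs (b - 1) \<le> 1 / real p"
  shows "vabs (a * b - 1) \<le> 1 / real p"
proof -
  have "vabs a = 1" using assms inv_p_less_1 by (intro vabs_eq_1_if_close_1) simp
  then have "vabs (a * (b - 1) + (a - 1)) \<le> 1 / real p" using assms by (intro vabs_add_le) (auto simp: vabs_mult)
  then show ?thesis by (simp add: algebra_simps)
qed

end

section \<open>Power series with geometrically bounded coefficients\<close>

text \<open>
  The product is the rearrangement of a triangular double series that is dominated by the
  geometric series of ratio \<open>R |s|\<close>.
\<close>

lemma power_series_mult:
  fixes A B :: "nat \<Rightarrow> 'k::complete_ultrametric_field"
  assumes A: "\<And>n. vabs (A n) \<le> C * R ^ n" "(\<lambda>n. A n * s ^ n) sums a"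
    and B: "\<And>n. vabs (B n) \<le> D * R ^ n" "(\<lambda>n. B n * s ^ n) sums b"
    and R: "0 \<le> R" "R * vabs s < 1"
  shows "(\<lambda>n. (\<Sum>i\<le>n. A i * B (n - i)) * s ^ n) sums (a * b)"
proof -
  have nonneg: "C \<ge> 0" "D \<ge> 0" using order_trans[OF vabs_nonneg A(1)[of 0]] order_trans[OF vabs_nonneg B(1)[of 0]] by auto
  define r where "r = R * vabs s"
  have r: "0 \<le> r" "r < 1" using R by (auto simp: r_def)
  define G where "G n k = (if n \<le> k then A n * B (k - n) * s ^ k else 0)" for n k
  have G: "vabs (G n k) \<le> C * D * r ^ k" for n k
  proof (cases "n \<le> k")
    case True
    have "vabs (A n) * vabs (B (k - n)) \<le> (C * R ^ n) * (D * R ^ (k - n))"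
      using nonneg R by (intro mult_mono A B) auto
    also have "\<dots> = C * D * R ^ k" using True by (simp add: mult_ac flip: power_add)
    finally have "vabs (A n) * vabs (B (k - n)) * vabs s ^ k \<le> C * D * R ^ k * vabs s ^ k"
      by (rule mult_right_mono) simp
    then show ?thesis using True by (simp add: G_def vabs_mult vabs_power r_def power_mult_distrib mult_ac)
  qed (use nonneg r in \<open>simp add: G_def\<close>)
  have lim: "(\<lambda>k. C * D * r ^ k) \<longlonglongrightarrow> 0"
    using r by (intro tendsto_mult_right_zero LIMSEQ_power_zero) auto
  have diag: "(\<Sum>n\<le>k. G n k) = (\<Sum>n\<le>k. A n * B (k - n)) * s ^ k" for k
    unfolding sum_distrib_right by (intro sum.cong) (auto simp: G_def)
  have "vabs (\<Sum>n\<le>k. G n k) \<le> C * D * r ^ k" for k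
    using G nonneg r by (intro vabs_sum_le) auto
  then have "summable (\<lambda>k. \<Sum>n\<le>k. G n k)"
    using lim by (intro summable_if_tendsto_0 tendsto_0_vabs_le)
  then obtain S where S: "(\<lambda>k. \<Sum>n\<le>k. G n k) sums S" by (auto simp: summable_def)
  have "(\<lambda>n. \<Sum>k. G n k) sums S"
    using G lim _ S by (rule triangular_double_series) (simp add: G_def)
  moreover have "(\<Sum>k. G n k) = A n * s ^ n * b" for n
  proof (rule sums_unique[symmetric])
    have "(\<lambda>k. A n * s ^ n * (B k * s ^ k)) sums (A n * s ^ n * b)" by (rule sums_cmult[OF B(2)])
    moreover have "(\<Sum>k<m + n. G n k) = (\<Sum>k<m. A n * s ^ n * (B k * s ^ k))" for m
      by (induction m) (auto simp: G_def power_add mult_ac)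
    ultimately show "(\<lambda>k. G n k) sums (A n * s ^ n * b)"
      unfolding sums_def using LIMSEQ_offset[of "\<lambda>m. \<Sum>k<m. G n k" n] by simp
  qed
  moreover have "(\<lambda>n. A n * s ^ n * b) sums (a * b)"
    using sums_cmult[OF A(2), of b] by (simp add: mult.commute)
  ultimately have "S = a * b" using sums_unique2 by simp
  then show ?thesis using S by (simp add: diag)
qed

text \<open>Inverses stay geometrically bounded, by the recursion for the coefficients of an inverse.\<close>

lemma vabs_fps_inverse_nth_le:
  fixes E :: "'k::complete_ultrametric_field fps"
  assumes E: "\<And>n. vabs (E $ n) \<le> vabs (E $ 0) * R ^ n" and E0: "E $ 0 \<noteq> 0" and R: "R \<ge> 0"
  shows "vabs (inverse E $ n) \<le> R ^ n / vabs (E $ 0)"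
proof (induction n rule: less_induct)
  case (less n)
  show ?case
  proof (cases n)
    case 0
    then show ?thesis by (simp add: vabs_inverse divide_inverse)
  next
    case (Suc m)
    have rec: "inverse E $ n = - inverse (E $ 0) * (\<Sum>i=1..n. E $ i * inverse E $ (n - i))"
      using Suc by (simp add: fps_inverse_def)
    have "vabs (\<Sum>i=1..n. E $ i * inverse E $ (n - i)) \<le> R ^ n"
    proof (rule vabs_sum_le)
      fix i assume i: "i \<in> {1..n}"
      have "vabs (E $ i) * vabs (inverse E $ (n - i)) \<le> (vabs (E $ 0) * R ^ i) * (R ^ (n - i) / vabs (E $ 0))"
        using i R by (intro mult_mono E less) auto
      also have "\<dots> = R ^ n" using E0 i by (simp flip: power_add)
      finally show "vabs (E $ i * inverse E $ (n - i)) \<le> R ^ n" by (simp add: vabs_mult)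
    qed (use R in simp)
    then have "vabs (inverse E $ n) \<le> inverse (vabs (E $ 0)) * R ^ n"
      unfolding rec by (simp only: vabs_mult vabs_minus vabs_inverse) (intro mult_left_mono, auto)
    then show ?thesis by (simp add: divide_inverse mult.commute)
  qed
qed

text \<open>
  The quotient is computed as a formal power series; the geometric bound for the inverse makes it
  converge to the quotient of the values wherever \<open>|h| < |E\<^sub>0|\<close>.
\<close>

lemma quotient_power_series:
  fixes E N :: "nat \<Rightarrow> 'k::complete_ultrametric_field"
  assumes E: "\<And>n. vabs (E n) \<le> 1" "E 0 \<noteq> 0" and N: "\<And>n. vabs (N n) \<le> C"
  obtains Q where "Q 0 = N 0 / E 0"
    "\<And>h d v. vabs h < vabs (E 0) \<Longrightarrow> (\<lambda>n. E n * h ^ n) sums d \<Longrightarrow> (\<lambda>n. N n * h ^ n) sums v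
      \<Longrightarrow> d \<noteq> 0 \<and> (\<lambda>n. Q n * h ^ n) sums (v / d)"
proof -
  define R where "R = 1 / vabs (E 0)"
  have E0: "0 < vabs (E 0)" "vabs (E 0) \<le> 1" using E by auto
  then have R: "R \<ge> 1" by (simp add: R_def)
  have Rn: "1 \<le> R ^ n" for n using R by (rule one_le_power)
  have C: "C \<ge> 0" using order_trans[OF vabs_nonneg N[of 0]] .
  define I where "I = inverse (Abs_fps E)"
  have "vabs (Abs_fps E $ n) \<le> vabs (Abs_fps E $ 0) * R ^ n" for n
  proof (cases n)
    case (Suc m)
    have "vabs (E 0) * R ^ Suc m \<ge> 1" using E0 Rn[of m] by (simp add: R_def)
    then show ?thesis using E(1)[of n] Suc by simp
  qed simp
  then have I: "vabs (I $ n) \<le> R * R ^ n" for n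
    using vabs_fps_inverse_nth_le[of "Abs_fps E" R n] E(2) R by (simp add: I_def R_def)
  have mult: "(Abs_fps X * I) $ n = (\<Sum>i\<le>n. X i * I $ (n - i))" for X n
    by (simp add: fps_mult_nth atMost_atLeast0)
  have EI: "Abs_fps E * I = 1" unfolding I_def using E(2) by (intro inverse_mult_eq_1') simp
  show ?thesis
  proof (rule that[of "\<lambda>n. (Abs_fps N * I) $ n"])
    show "(Abs_fps N * I) $ 0 = N 0 / E 0" by (simp add: I_def divide_inverse)
    fix h d v
    assume h: "vabs h < vabs (E 0)" and d: "(\<lambda>n. E n * h ^ n) sums d" and v: "(\<lambda>n. N n * h ^ n) sums v"
    have Rh: "0 \<le> R" "R * vabs h < 1" using R h E0 by (auto simp: R_def)
    have "vabs (I $ n * h ^ n) \<le> R * (R * vabs h) ^ n" for n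
      using mult_right_mono[OF I[of n], of "vabs h ^ n"]
      by (simp add: vabs_mult vabs_power power_mult_distrib mult.assoc)
    then have "(\<lambda>n. I $ n * h ^ n) \<longlonglongrightarrow> 0"
      by (rule tendsto_0_vabs_le) (use R Rh in \<open>intro tendsto_mult_right_zero LIMSEQ_power_zero, simp\<close>)
    then obtain w where w: "(\<lambda>n. I $ n * h ^ n) sums w"
      using summable_if_tendsto_0 by (auto simp: summable_def)
    have "vabs (E n) \<le> 1 * R ^ n" "vabs (N n) \<le> C * R ^ n" for n
      using E(1)[of n] N[of n] Rn[of n] mult_left_mono[OF Rn[of n] C] by auto
    note prod = power_series_mult[OF this(1) d I w Rh] power_series_mult[OF this(2) v I w Rh]
    have "(\<lambda>n. (Abs_fps E * I) $ n * h ^ n) = (\<lambda>n. if n = 0 then 1 else 0)" by (auto simp: EI)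
    then have "(\<lambda>n. (Abs_fps E * I) $ n * h ^ n) sums 1" using sums_single[of 0 "\<lambda>_. 1 :: 'k"] by simp
    then have "d * w = 1" using prod(1) sums_unique2 unfolding mult by blast
    moreover from this have "w = inverse d" by (simp add: inverse_unique)
    ultimately show "d \<noteq> 0 \<and> (\<lambda>n. (Abs_fps N * I) $ n * h ^ n) sums (v / d)"
      using prod(2) unfolding mult divide_inverse by auto
  qed
qed

context padic_field
begin

text \<open>
  The identity theorem: the first nonzero coefficient would dominate the sum at \<open>p\<^sup>m\<close> for
  large \<open>m\<close>.
\<close>

lemma power_series_identity:
  assumes d: "\<And>n. vabs (d n :: 'k) \<le> C" and zero: "\<And>k. (\<lambda>n. d n * of_nat k ^ n) sums 0"
  shows "d n = 0"
proof (induction n rule: less_induct)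
  case (less n)
  have C: "C \<ge> 0" using order_trans[OF vabs_nonneg d[of 0]] .
  have "vabs (d n) \<le> C * (1 / real p) ^ m" for m
  proof -
    define x :: 'k where "x = of_nat p ^ m"
    have x: "vabs x = (1 / real p) ^ m" "x \<noteq> 0" using p_pos by (auto simp: x_def vabs_p_power)
    have "(\<lambda>k. d (k + Suc n) * x ^ (k + Suc n)) sums (0 - (\<Sum>k<Suc n. d k * x ^ k))"
      using sums_shift[OF zero[of "p ^ m"], of "Suc n"] by (simp add: x_def)
    also have "(\<Sum>k<Suc n. d k * x ^ k) = d n * x ^ n" using less by simp
    finally have s: "(\<lambda>k. d (k + Suc n) * x ^ (k + Suc n)) sums (- (d n * x ^ n))" by simp
    have "vabs (- (d n * x ^ n)) \<le> C * vabs x ^ Suc n"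
    proof (rule vabs_sums_le[OF s])
      fix k
      have "vabs x ^ (k + Suc n) \<le> vabs x ^ Suc n"
        using x p_pos by (intro power_decreasing) (auto intro: power_le_one)
      then show "vabs (d (k + Suc n) * x ^ (k + Suc n)) \<le> C * vabs x ^ Suc n"
        unfolding vabs_mult vabs_power using d C by (intro mult_mono) auto
    qed
    then have "vabs (d n) * vabs x ^ n \<le> (C * vabs x) * vabs x ^ n"
      by (simp add: vabs_mult vabs_power mult_ac)
    moreover have "vabs x ^ n > 0" using x(2) by simp
    ultimately have "vabs (d n) \<le> C * vabs x" by (rule mult_right_le_imp_le)
    then show ?thesis by (simp add: x(1))
  qed
  moreover have "(\<lambda>m. C * (1 / real p) ^ m) \<longlonglongrightarrow> 0"
    using tendsto_mult_right_zero[OF inv_p_power_tendsto_0] .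
  ultimately have "vabs (d n) \<le> 0" by (intro LIMSEQ_le_const) auto
  then show ?case by simp
qed

text \<open>
  A Newton series \<open>\<Sum>k. (s choose k) m\<^sub>k\<close> is analytic in \<open>s\<close>: expand the binomial polynomials,
  whose coefficients are integers divided by \<open>k!\<close>, and rearrange.
\<close>

definition gbinomial_poly :: "nat \<Rightarrow> 'k poly" where
  "gbinomial_poly k = Polynomial.smult (inverse (fact k)) (\<Prod>i<k. [:- of_nat i, 1:])"

lemma poly_gbinomial_poly: "poly (gbinomial_poly k) s = s gchoose k"
  by (simp add: gbinomial_poly_def poly_prod gbinomial_prod_rev atLeast0LessThan field_simps)

lemma degree_gbinomial_poly: "Polynomial.degree (gbinomial_poly k) \<le> k"
proof -
  have "Polynomial.degree (\<Prod>i<k. [:- of_nat i, 1 :: 'k:]) = k" for k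
    by (subst degree_prod_eq_sum_degree) auto
  then show ?thesis unfolding gbinomial_poly_def using degree_smult_le le_trans by metis
qed

lemma vabs_coeff_gbinomial_poly: "vabs (Polynomial.coeff (gbinomial_poly k) n) \<le> (1 / theta) ^ k"
proof -
  have "vabs (Polynomial.coeff (\<Prod>i<k. [:- of_nat i, 1 :: 'k:]) n) \<le> 1" for n
  proof (induction k arbitrary: n)
    case (Suc k)
    let ?f = "\<Prod>i<k. [:- of_nat i, 1 :: 'k:]"
    have "Polynomial.coeff (\<Prod>i<Suc k. [:- of_nat i, 1 :: 'k:]) n
        = (case n of 0 \<Rightarrow> 0 | Suc n' \<Rightarrow> Polynomial.coeff ?f n') - of_nat k * Polynomial.coeff ?f n"
      by (simp add: mult.commute coeff_pCons split: nat.split)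
    moreover have "vabs (of_nat k * Polynomial.coeff ?f n) \<le> 1"
      unfolding vabs_mult using Suc[of n] vabs_of_nat_le by (intro mult_le_one) auto
    ultimately show ?case using Suc by (simp only:) (intro vabs_diff_le, auto split: nat.split)
  qed auto
  then have "vabs (Polynomial.coeff (gbinomial_poly k) n) \<le> inverse (vabs (fact k :: 'k)) * 1"
    unfolding gbinomial_poly_def by (simp only: coeff_smult vabs_mult vabs_inverse) (intro mult_left_mono, auto)
  also have "\<dots> \<le> inverse (theta ^ k) * 1"
  proof (intro mult_right_mono le_imp_inverse_le)
    have "theta ^ k \<le> theta ^ (k - 1)" using theta_pos theta_le_1 by (intro power_decreasing) auto
    then show "theta ^ k \<le> vabs (fact k :: 'k)" using vabs_fact_ge[of k] by linarith
  qed (use theta_pos in auto)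
  finally show ?thesis by (simp add: divide_inverse power_inverse)
qed

lemma poly_sum_atMost:
  assumes "Polynomial.degree (f :: 'k poly) \<le> k"
  shows "poly f s = (\<Sum>n\<le>k. Polynomial.coeff f n * s ^ n)"
  unfolding poly_altdef using assms by (intro sum.mono_neutral_left) (auto intro: coeff_eq_0)

lemma newton_series_analytic:
  assumes m: "\<And>k. vabs (m k :: 'k) \<le> C * (1 / real p) ^ k"
  obtains N where "\<And>n. vabs (N n) \<le> C * (1 / q_radius) ^ n" "N 0 = m 0"
    "\<And>s. s \<in> power_disc p \<Longrightarrow> (\<lambda>n. N n * s ^ n) sums (\<Sum>k. (s gchoose k) * m k)"
proof -
  have C: "C \<ge> 0" using order_trans[OF vabs_nonneg m[of 0]] by simp
  define G where "G n k = Polynomial.coeff (gbinomial_poly k) n * m k" for n k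
  have q: "q_radius > 1" by (rule q_radius_gt_1)
  have tri: "G n k = 0" if "k < n" for n k
    using that degree_gbinomial_poly[of k] by (simp add: G_def coeff_eq_0)
  have G: "vabs (G n k) \<le> C * (1 / q_radius) ^ k" for n k
  proof -
    have "vabs (G n k) \<le> (1 / theta) ^ k * (C * (1 / real p) ^ k)"
      unfolding G_def vabs_mult using theta_pos by (intro mult_mono vabs_coeff_gbinomial_poly m) auto
    also have "\<dots> = C * (1 / q_radius) ^ k"
      by (simp add: q_radius_eq power_divide power_mult_distrib mult_ac)
    finally show ?thesis .
  qed
  have lim: "(\<lambda>k. C * (1 / q_radius) ^ k) \<longlonglongrightarrow> 0"
    using q by (intro tendsto_mult_right_zero LIMSEQ_power_zero) auto
  define N where "N n = (\<Sum>k. G n k)" for n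
  have N: "(\<lambda>k. G n k) sums N n" for n
    unfolding N_def by (intro summable_sums summable_if_tendsto_0 tendsto_0_vabs_le[OF G lim])
  show ?thesis
  proof (rule that[of N])
    fix n show "vabs (N n) \<le> C * (1 / q_radius) ^ n"
    proof (rule vabs_sums_le[OF N])
      fix k
      show "vabs (G n k) \<le> C * (1 / q_radius) ^ n"
      proof (cases "k < n")
        case False
        then have "(1 / q_radius) ^ k \<le> (1 / q_radius) ^ n" using q by (intro power_decreasing) auto
        then show ?thesis using G[of n k] mult_left_mono[OF _ C] order_trans by blast
      qed (use tri C q in simp)
    qed
  next
    have "G 0 k = (if k = 0 then m 0 else 0)" for k
      using poly_gbinomial_poly[of k 0] by (cases k) (auto simp: G_def poly_0_coeff_0)
    then have "(\<lambda>k. G 0 k) sums m 0"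
      unfolding N_def using sums_single[of 0 m] by (simp cong: if_cong)
    then show "N 0 = m 0" using N sums_unique2 by blast
  next
    fix s :: 'k assume s: "s \<in> power_disc p"
    have "(\<lambda>n. \<Sum>k. G n k * s ^ n) sums (\<Sum>k. (s gchoose k) * m k)"
    proof (rule triangular_double_series)
      fix n k :: nat assume "n \<le> k"
      have "vabs s ^ n \<le> max 1 (vabs s) ^ n" by (intro power_mono) auto
      also have "\<dots> \<le> max 1 (vabs s) ^ k" using \<open>n \<le> k\<close> by (intro power_increasing) auto
      finally have "vabs (G n k) * vabs s ^ n \<le> (C * (1 / q_radius) ^ k) * max 1 (vabs s) ^ k"
        using G C q by (intro mult_mono) auto
      also have "\<dots> = C * ratio s ^ k" by (simp add: ratio_def power_divide)
      finally show "vabs (G n k * s ^ n) \<le> C * ratio s ^ k" by (simp add: vabs_mult vabs_power)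
    next
      show "(\<lambda>k. C * ratio s ^ k) \<longlonglongrightarrow> 0"
        using ratio_bounds[OF s] by (intro tendsto_mult_right_zero LIMSEQ_power_zero) auto
      show "G n k * s ^ n = 0" if "k < n" for n k using tri[OF that] by simp
      have "(\<Sum>n\<le>k. G n k * s ^ n) = (s gchoose k) * m k" for k
      proof -
        have "(s gchoose k) = (\<Sum>n\<le>k. Polynomial.coeff (gbinomial_poly k) n * s ^ n)"
          unfolding poly_gbinomial_poly[symmetric] by (rule poly_sum_atMost[OF degree_gbinomial_poly])
        then show ?thesis by (simp add: G_def sum_distrib_left sum_distrib_right mult_ac)
      qed
      then show "(\<lambda>k. \<Sum>n\<le>k. G n k * s ^ n) sums (\<Sum>k. (s gchoose k) * m k)"
        using summable_sums[OF newton_series_summable[OF s m]] by simp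
    qed
    moreover have "(\<Sum>k. G n k * s ^ n) = N n * s ^ n" for n
      using sums_cmult[OF N[of n], of "s ^ n"] by (simp add: mult.commute sums_iff)
    ultimately show "(\<lambda>n. N n * s ^ n) sums (\<Sum>k. (s gchoose k) * m k)" by simp
  qed
qed

lemma padic_power_analytic:
  assumes a: "vabs (a - 1 :: 'k) \<le> 1 / real p"
  shows "\<exists>N. (\<forall>n. vabs (N n) \<le> (1 / q_radius) ^ n) \<and> N 0 = 1 \<and>
    (\<forall>s\<in>power_disc p. (\<lambda>n. N n * s ^ n) sums padic_power a s)"
  unfolding padic_power_def by (rule newton_series_analytic[OF vabs_close_power[OF a]]) auto

lemma inv_q_power_le_1: "(1 / q_radius) ^ n \<le> 1"
  using q_radius_gt_1 by (intro power_le_one) auto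

text \<open>The identity theorem, applied to the difference of the two power series.\<close>

lemma analytic_eqI:
  assumes f: "\<And>n. vabs (A n :: 'k) \<le> 1" "\<And>s. s \<in> power_disc p \<Longrightarrow> (\<lambda>n. A n * s ^ n) sums f s"
    and g: "\<And>n. vabs (B n) \<le> 1" "\<And>s. s \<in> power_disc p \<Longrightarrow> (\<lambda>n. B n * s ^ n) sums g s"
    and eq: "\<And>k. f (of_nat k) = g (of_nat k)" and s: "s \<in> power_disc p"
  shows "f s = g s"
proof -
  define d where "d n = A n - B n" for n
  have "vabs (d n) \<le> 1" for n unfolding d_def by (intro vabs_diff_le f g)
  moreover have "(\<lambda>n. d n * of_nat k ^ n) sums 0" for k
    using sums_minus[OF f(2)[OF power_disc_of_nat[of k]] g(2)[OF power_disc_of_nat[of k]]]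
    by (simp add: d_def left_diff_distrib eq)
  ultimately have "d n = 0" for n by (rule power_series_identity)
  then have "A = B" by (auto simp: d_def)
  then show ?thesis using f(2)[OF s] g(2)[OF s] sums_unique2 by simp
qed

text \<open>
  Both sides are analytic in \<open>s\<close>, the right-hand side as a product of power series, and they agree
  at the natural numbers.
\<close>

lemma padic_power_mult:
  assumes a: "vabs (a - 1 :: 'k) \<le> 1 / real p" and b: "vabs (b - 1) \<le> 1 / real p" and s: "s \<in> power_disc p"
  shows "padic_power (a * b) s = padic_power a s * padic_power b s"
proof -
  obtain A where A: "\<And>n. vabs (A n) \<le> (1 / q_radius) ^ n" "A 0 = 1" "\<And>s. s \<in> power_disc p \<Longrightarrow> (\<lambda>n. A n * s ^ n) sums padic_power a s"
    using padic_power_analytic[OF a] by blast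
  obtain B where B: "\<And>n. vabs (B n) \<le> (1 / q_radius) ^ n" "B 0 = 1" "\<And>s. s \<in> power_disc p \<Longrightarrow> (\<lambda>n. B n * s ^ n) sums padic_power b s"
    using padic_power_analytic[OF b] by blast
  obtain N where N: "\<And>n. vabs (N n) \<le> (1 / q_radius) ^ n" "N 0 = 1" "\<And>s. s \<in> power_disc p \<Longrightarrow> (\<lambda>n. N n * s ^ n) sums padic_power (a * b) s"
    using padic_power_analytic[OF vabs_close_mult[OF a b]] by blast
  have prod: "(\<lambda>n. (\<Sum>i\<le>n. A i * B (n - i)) * s ^ n) sums (padic_power a s * padic_power b s)"
    if s: "s \<in> power_disc p" for s
    by (rule power_series_mult[where C = 1 and D = 1 and R = "1 / q_radius"])
       (use A B s q_radius_gt_1 in \<open>auto simp: power_disc_iff\<close>)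
  have coeff: "vabs (F n) \<le> 1" if "\<And>n. vabs (F n :: 'k) \<le> (1 / q_radius) ^ n" for F n
    using order_trans[OF that inv_q_power_le_1] .
  show ?thesis
  proof (rule analytic_eqI[OF coeff[OF N(1)] N(3) _ prod _ s])
    show "vabs (\<Sum>i\<le>n. A i * B (n - i)) \<le> 1" for n
      by (intro vabs_sum_le) (auto simp: vabs_mult intro!: mult_le_one coeff[OF A(1)] coeff[OF B(1)])
    show "padic_power (a * b) (of_nat k) = padic_power a (of_nat k) * padic_power b (of_nat k)" for k
      by (simp add: padic_power_of_nat power_mult_distrib)
  qed
qed

section \<open>Branches of pseudomeasures\<close>

definition character :: "int \<Rightarrow> 'k \<Rightarrow> 'k \<Rightarrow> 'k" where
  "character j s x = teichmueller p x powi j * padic_power (angle p x) s"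

lemma mellin_eq: "mellin p \<rho> j s = \<rho> (character j s)"
  by (simp add: mellin_def character_def[abs_def])

lemma character_mult:
  assumes "s \<in> power_disc p" "x \<in> Zp_units" "y \<in> Zp_units"
  shows "character j s (x * y) = character j s x * character j s y"
  using assms angle_close_1
  by (simp add: character_def teichmueller_mult angle_mult padic_power_mult power_int_mult_distrib)

lemma character_one: "character j s 1 = 1"
proof -
  have "teichmueller p (1 :: 'k) = 1" using p_pos by (intro teichmueller_eqI one_in_Zp_units) auto
  then show ?thesis by (simp add: character_def angle_def padic_power_one)
qed

text \<open>
  By multiplicativity, \<open>|a\<^sup>s - b\<^sup>s| = |(a/b)\<^sup>s - 1| = |s| |a - b|\<close>.
\<close>

lemma continuous_on_padic_power_angle:
  assumes s: "s \<in> power_disc p"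
  shows "continuous_on (Zp_units :: 'k set) (\<lambda>x. padic_power (angle p x) s)"
proof -
  have "dist (padic_power (angle p x) s) (padic_power (angle p y) s) = vabs s * dist (angle p x) (angle p y)"
    if x: "x \<in> Zp_units" and y: "y \<in> (Zp_units :: 'k set)" for x y
  proof -
    define a b where "a = angle p x" and "b = angle p y"
    have a: "vabs (a - 1) \<le> 1 / real p" and b: "vabs (b - 1) \<le> 1 / real p"
      using angle_close_1 x y by (auto simp: a_def b_def)
    have b1: "vabs b = 1" using b inv_p_less_1 by (intro vabs_eq_1_if_close_1) simp
    have diff: "vabs (a / b - 1) = vabs (a - b)" by (rule vabs_divide_close_iff[OF b1])
    also have "\<dots> \<le> 1 / real p"
      by (rule vabs_trans_le[OF a]) (use b in \<open>simp only: vabs_diff_commute[of 1]\<close>)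
    finally have ab: "vabs (a / b - 1) \<le> 1 / real p" .
    have "a = b * (a / b)" using b1 by auto
    then have "padic_power a s = padic_power b s * padic_power (a / b) s"
      using padic_power_mult[OF b ab s] by simp
    then have "padic_power a s - padic_power b s = padic_power b s * (padic_power (a / b) s - 1)"
      by (simp add: algebra_simps)
    moreover have "vabs (padic_power b s) = 1" by (rule vabs_eq_1_if_close_1[OF padic_power_close_1[OF s b]])
    ultimately show ?thesis
      unfolding dist_vabs a_def[symmetric] b_def[symmetric]
      by (simp add: vabs_mult vabs_padic_power_minus_1[OF s ab] diff)
  qed
  note isometry = this
  show ?thesis
    unfolding continuous_on_def
  proof
    fix y :: 'k assume y: "y \<in> Zp_units"
    have "(angle p \<longlongrightarrow> angle p y) (at y within Zp_units)"
      using continuous_on_angle y by (simp add: continuous_on_def)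
    then have "((\<lambda>x. dist (angle p x) (angle p y)) \<longlongrightarrow> 0) (at y within Zp_units)"
      by (rule iffD1[OF tendsto_dist_iff])
    from tendsto_mult_right_zero[OF this, of "vabs s"]
    have "((\<lambda>x. dist (padic_power (angle p x) s) (padic_power (angle p y) s)) \<longlongrightarrow> 0) (at y within Zp_units)"
      by (rule Lim_transform_eventually) (simp add: eventually_at_filter isometry[OF _ y])
    then show "((\<lambda>x. padic_power (angle p x) s) \<longlongrightarrow> padic_power (angle p y) s) (at y within Zp_units)"
      by (rule iffD2[OF tendsto_dist_iff])
  qed
qed

lemma continuous_on_character:
  assumes "s \<in> power_disc p"
  shows "continuous_on Zp_units (character j s)"
  unfolding character_def[abs_def]
  by (intro continuous_on_mult' continuous_on_teichmueller_powi continuous_on_padic_power_angle assms)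

lemma character_of_nat:
  assumes "[int n = j] (mod (int p - 1))" "x \<in> (Zp_units :: 'k set)"
  shows "character j (of_nat n) x = x ^ n"
proof -
  have "teichmueller p x powi j = teichmueller p x ^ n"
    using teichmueller_powi_mod[OF assms(2,1)] by simp
  then have "character j (of_nat n) x = (teichmueller p x * angle p x) ^ n"
    by (simp add: character_def padic_power_of_nat power_mult_distrib)
  then show ?thesis by (simp add: teichmueller_times_angle assms)
qed

lemma mellin_convolution:
  assumes "\<mu> \<in> carrier \<Lambda>" "\<nu> \<in> carrier \<Lambda>" "s \<in> power_disc p"
  shows "mellin p (\<mu> \<otimes>\<^bsub>\<Lambda>\<^esub> \<nu>) j s = mellin p \<mu> j s * mellin p \<nu> j s"
  using assms unfolding mellin_eq Iwasawa_simps
  by (intro convolution_multiplicative continuous_on_character character_mult)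

lemma pfrac_eqI:
  assumes "a \<in> carrier \<Lambda>" "b \<in> carrier \<Lambda>" "s \<in> denominators p" "t \<in> denominators p"
    "a \<otimes>\<^bsub>\<Lambda>\<^esub> t = b \<otimes>\<^bsub>\<Lambda>\<^esub> s"
  shows "pfrac p a s = pfrac p b t"
proof (rule loc_frac_eqI[OF Iwasawa_comm_monoid denominators_subset denominators_mult denominators.one])
  show "\<one>\<^bsub>\<Lambda>\<^esub> \<otimes>\<^bsub>\<Lambda>\<^esub> (a \<otimes>\<^bsub>\<Lambda>\<^esub> t) = \<one>\<^bsub>\<Lambda>\<^esub> \<otimes>\<^bsub>\<Lambda>\<^esub> (b \<otimes>\<^bsub>\<Lambda>\<^esub> s)" using assms by simp
qed (use assms denominators.one in auto)

lemma pfrac_self: "a \<in> carrier \<Lambda> \<Longrightarrow> s \<in> denominators p \<Longrightarrow> (a, s) \<in> pfrac p a s"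
  by (rule loc_frac_self[OF Iwasawa_comm_monoid denominators_subset denominators_mult denominators.one])

lemma pfrac_mult:
  assumes "a \<in> carrier \<Lambda>" "b \<in> carrier \<Lambda>" "s \<in> denominators p" "t \<in> denominators p"
  shows "pfrac p a s \<otimes>\<^bsub>pseudomeasures p\<^esub> pfrac p b t = pfrac p (a \<otimes>\<^bsub>\<Lambda>\<^esub> b) (s \<otimes>\<^bsub>\<Lambda>\<^esub> t)"
  using assms denominators_mult
  by (intro loc_frac_mult[OF Iwasawa_comm_monoid denominators_subset _ denominators.one])

lemma pfrac_mem:
  assumes "(b, t) \<in> pfrac p a s"
  shows "a \<in> carrier \<Lambda>" "b \<in> carrier \<Lambda>" "s \<in> denominators p" "t \<in> denominators p"
    "a \<otimes>\<^bsub>\<Lambda>\<^esub> t = b \<otimes>\<^bsub>\<Lambda>\<^esub> s"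
proof -
  interpret comm_monoid \<Lambda> by (rule Iwasawa_comm_monoid)
  note mem = loc_frac_mem[OF Iwasawa_comm_monoid denominators_subset denominators_mult denominators.one assms]
  show *: "a \<in> carrier \<Lambda>" "b \<in> carrier \<Lambda>" "s \<in> denominators p" "t \<in> denominators p"
    using mem by auto
  show "a \<otimes>\<^bsub>\<Lambda>\<^esub> t = b \<otimes>\<^bsub>\<Lambda>\<^esub> s"
    using mem(3) * denominators_subset by (auto intro: denominators_cancel)
qed

text \<open>
  The denominators are non-zero-divisors, so two representatives satisfy \<open>A t = B r\<close> in the
  algebra itself, and the quotient of Mellin transforms depends on the pseudomeasure only.
\<close>

lemma branch_pfrac:
  assumes A: "A \<in> carrier \<Lambda>" and r: "r \<in> denominators p" and s: "s \<in> power_disc p"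
    and nz: "mellin p r j s \<noteq> 0"
  shows "branch p (pfrac p A r) j s = mellin p A j s / mellin p r j s"
  unfolding branch_def
proof (rule the_equality)
  have "(A, r) \<in> pfrac p A r" by (rule pfrac_self[OF A r])
  then show "\<exists>(B, t)\<in>pfrac p A r. mellin p t j s \<noteq> 0 \<and> mellin p A j s / mellin p r j s = mellin p B j s / mellin p t j s"
    using nz by blast
next
  fix v assume "\<exists>(B, t)\<in>pfrac p A r. mellin p t j s \<noteq> 0 \<and> v = mellin p B j s / mellin p t j s"
  then obtain B t where Bt: "(B, t) \<in> pfrac p A r" "mellin p t j s \<noteq> 0" "v = mellin p B j s / mellin p t j s" by blast
  note mem = pfrac_mem[OF Bt(1)]
  have car: "r \<in> carrier \<Lambda>" "t \<in> carrier \<Lambda>" using mem denominators_subset by auto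
  have "mellin p A j s * mellin p t j s = mellin p B j s * mellin p r j s"
    using mellin_convolution[OF mem(1) car(2) s, of j] mellin_convolution[OF mem(2) car(1) s, of j] mem(5) by simp
  then show "v = mellin p A j s / mellin p r j s" using Bt nz by (simp add: frac_eq_eq)
qed

lemma mellin_r_elt:
  assumes "s \<in> power_disc p"
  shows "mellin p (r_elt c) j s = 1 - of_nat c * character j s (of_nat c :: 'k)"
  unfolding mellin_eq by (simp add: r_elt_continuous continuous_on_character[OF assms] character_one)

text \<open>
  Absorbing the factor \<open>c = \<omega>(c) \<langle>c\<rangle>\<close> into the character shifts both exponents by one; this
  is where the pole at \<open>j = s = -1\<close> becomes visible.
\<close>

lemma mellin_r_elt':
  assumes s: "s \<in> power_disc p" and c: "coprime c p"
  shows "mellin p (r_elt c) j s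
    = 1 - teichmueller p (of_nat c :: 'k) powi (j + 1) * padic_power (angle p (of_nat c)) (s + 1)"
proof -
  have u: "(of_nat c :: 'k) \<in> Zp_units" by (rule of_nat_in_Zp_units[OF c])
  define w :: 'k where "w = teichmueller p (of_nat c)"
  define b :: 'k where "b = angle p (of_nat c)"
  have "w \<noteq> 0" "(of_nat c :: 'k) = w * b"
    using teichmueller_nonzero[OF u] teichmueller_times_angle[OF u] by (auto simp: w_def b_def)
  moreover have "padic_power b (s + 1) = b * padic_power b s"
    using padic_power_Suc[OF s angle_close_1[OF u]] by (simp add: b_def)
  ultimately show ?thesis
    unfolding mellin_r_elt[OF s] character_def w_def[symmetric] b_def[symmetric]
    by (simp add: power_int_add mult_ac)
qed

lemma angle_nat_neq_1:
  assumes c: "c > 1" "coprime c p"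
  shows "angle p (of_nat c :: 'k) \<noteq> 1"
proof
  assume "angle p (of_nat c :: 'k) = 1"
  then have "teichmueller p (of_nat c :: 'k) = of_nat c"
    using teichmueller_times_angle[OF of_nat_in_Zp_units[OF c(2)]] by simp
  then have "of_nat c ^ (p - 1) = (1 :: 'k)"
    using teichmueller_unfold(2)[OF of_nat_in_Zp_units[OF c(2)]] by simp
  moreover have "(1 - of_nat c ^ Suc (p - 2) :: 'k) \<noteq> 0" by (rule r_elt_moment_nonzero[OF c(1)])
  moreover have "Suc (p - 2) = p - 1" using p_ge_3 by simp
  ultimately show False by simp
qed

text \<open>
  On the branch \<open>j = -1\<close> every \<open>c\<close> works, as \<open>|\<langle>c\<rangle>\<^bsup>s+1\<^esup> - 1| = |s + 1| |\<langle>c\<rangle> - 1|\<close>; on another branch, a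
  primitive root \<open>c\<close> modulo \<open>p\<close> makes \<open>\<omega>(c)\<^bsup>j+1\<^esup>\<close> differ from \<open>1\<close> modulo \<open>p\<close>.
\<close>

lemma ex_mellin_r_elt_nonzero:
  assumes s: "s \<in> power_disc p" and not_pole: "\<not> ([j = - 1] (mod (int p - 1)) \<and> s = - 1)"
  shows "\<exists>c. odd c \<and> c > 1 \<and> coprime c p \<and> mellin p (r_elt c :: 'k functional) j s \<noteq> 0"
proof (cases "[j = - 1] (mod (int p - 1))")
  case True
  define c where "c = p + 2"
  have "coprime (2 + 1 * p) p \<longleftrightarrow> coprime 2 p" by (metis coprime_commute coprime_iff_gcd_eq_1 gcd_add_mult mult.commute add.commute)
  then have c: "odd c" "c > 1" "coprime c p" using odd_p by (auto simp: c_def add.commute)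
  have u: "(of_nat c :: 'k) \<in> Zp_units" by (rule of_nat_in_Zp_units[OF c(3)])
  have "[j + 1 = 0] (mod (int p - 1))" using cong_add[OF True cong_refl[of 1]] by simp
  then have "teichmueller p (of_nat c :: 'k) powi (j + 1) = 1"
    using teichmueller_powi_mod[OF u, of "j + 1" 0] by simp
  moreover have "vabs (padic_power (angle p (of_nat c :: 'k)) (s + 1) - 1)
      = vabs (s + 1) * vabs (angle p (of_nat c :: 'k) - 1)"
    using power_disc_add[OF s power_disc_of_nat[of 1]] angle_close_1[OF u]
    by (intro vabs_padic_power_minus_1) auto
  moreover have "s + 1 \<noteq> 0" using True not_pole by (metis add_eq_0_iff2)
  moreover have "angle p (of_nat c :: 'k) - 1 \<noteq> 0" using angle_nat_neq_1[OF c(2,3)] by simp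
  ultimately have "padic_power (angle p (of_nat c :: 'k)) (s + 1) - 1 \<noteq> 0"
    by (metis mult_eq_0_iff vabs_eq_0_iff)
  then show ?thesis
    using c \<open>teichmueller p (of_nat c :: 'k) powi (j + 1) = 1\<close> mellin_r_elt'[OF s c(3), of j]
    by (intro exI[of _ c]) auto
next
  case False
  obtain g where g: "residue_primroot p g" using prime_primitive_root_exists[OF _ prime_p] p_pos by auto
  \<comment> \<open>Adding a multiple of \<open>p\<close> makes the primitive root odd and greater than \<open>1\<close>.\<close>
  define c where "c = (if odd g then g + 2 * p else g + p)"
  have cg: "[c = g] (mod p)" by (auto simp: c_def cong_def)
  have c: "odd c" "c > 1" using odd_p p_ge_3 by (auto simp: c_def)
  have "residue_primroot p c" using g residue_primroot_cong[OF cg] by simp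
  then have cop: "coprime c p" and ord: "ord p c = p - 1"
    using prime_p by (auto simp: residue_primroot_def coprime_commute totient_prime)
  have u: "(of_nat c :: 'k) \<in> Zp_units" by (rule of_nat_in_Zp_units[OF cop])
  define e where "e = nat ((j + 1) mod (int p - 1))"
  have pm1: "int p - 1 > 0" using p_ge_3 by simp
  have e: "int e = (j + 1) mod (int p - 1)" using pm1 by (simp add: e_def)
  have elt: "e < p - 1" using pos_mod_bound[OF pm1, of "j + 1"] unfolding e[symmetric] by linarith
  have "e \<noteq> 0"
  proof
    assume "e = 0"
    then have "[j + 1 = 0] (mod (int p - 1))" using e by (simp add: cong_def)
    from cong_diff[OF this cong_refl[of 1]] show False using False by simp
  qed
  have "\<not> [c ^ e = 1] (mod p)"
    using ord_divides[of c e p] ord elt \<open>e \<noteq> 0\<close> by (auto dest: dvd_imp_le)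
  then have "\<not> int p dvd int (c ^ e) - 1" by (metis cong_iff_dvd_diff cong_int_iff of_nat_1)
  then have "vabs (of_int (int (c ^ e) - 1) :: 'k) = 1" by (rule vabs_of_int_unit)
  then have far: "vabs (of_nat c ^ e - 1 :: 'k) = 1" by simp
  define w :: 'k where "w = teichmueller p (of_nat c)"
  define P where "P = padic_power (angle p (of_nat c :: 'k)) (s + 1)"
  have w: "vabs w = 1" "vabs (of_nat c - w) \<le> 1 / real p"
    using teichmueller_unfold[OF u] by (auto simp: w_def Zp_units_iff)
  have "[j + 1 = int e] (mod (int p - 1))" unfolding e by (simp add: cong_def)
  then have wj: "w powi (j + 1) = w ^ e" using teichmueller_powi_mod[OF u] by (simp add: w_def)
  have close: "vabs (of_nat c ^ e - w ^ e) \<le> 1 / real p"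
    using order_trans[OF vabs_power_diff_le w(2)] w(1) by (simp add: vabs_of_nat_le)
  have P: "vabs (P - 1) < 1"
    unfolding P_def using power_disc_add[OF s power_disc_of_nat[of 1]] angle_close_1[OF u]
    by (intro padic_power_close_1) auto
  have "w ^ e * P \<noteq> 1"
  proof
    assume 1: "w ^ e * P = 1"
    have "vabs (w ^ e - 1) = vabs (w ^ e - w ^ e * P)" by (simp only: 1)
    also have "\<dots> = vabs (w ^ e * (1 - P))" by (simp only: right_diff_distrib mult_1_right)
    also have "\<dots> = vabs (P - 1)" by (simp only: vabs_mult vabs_power w(1) power_one mult_1_left vabs_diff_commute[of 1])
    finally have 2: "vabs (w ^ e - 1) \<le> max (1 / real p) (vabs (P - 1))" by simp
    have "vabs (of_nat c ^ e - w ^ e) \<le> max (1 / real p) (vabs (P - 1))" using close by simp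
    from vabs_trans_le[OF this 2] have "1 \<le> max (1 / real p) (vabs (P - 1))" unfolding far .
    then show False using P inv_p_less_1 by linarith
  qed
  then show ?thesis
    using c cop mellin_r_elt'[OF s cop, of j] wj by (intro exI[of _ c]) (auto simp: w_def P_def)
qed

section \<open>Bernoulli numbers with index \<open>(p - 1) p\<^sup>k\<close>\<close>

lemma vabs_of_nat_ge: "n > 0 \<Longrightarrow> 1 / real n \<le> vabs (of_nat n :: 'k)"
proof (induction n rule: less_induct)
  case (less n)
  show ?case
  proof (cases "p dvd n")
    case True
    then obtain m where m: "n = p * m" by auto
    then have "m > 0" "m < n" using less.prems p_ge_3 by auto
    then have "1 / real m \<le> vabs (of_nat m :: 'k)" by (intro less.IH)
    then have "1 / real p * (1 / real m) \<le> 1 / real p * vabs (of_nat m :: 'k)" by (intro mult_left_mono) auto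
    then show ?thesis by (simp add: m vabs_mult vabs_p)
  next
    case False
    then show ?thesis using vabs_of_nat_unit[of n] less.prems by simp
  qed
qed

lemma Suc_le_p_power: "real (Suc i) \<le> real p ^ i"
proof -
  have "Suc i \<le> 2 ^ i" by (rule Suc_leI[OF less_exp])
  also have "\<dots> \<le> p ^ i" using p_ge_3 by (intro power_mono) auto
  finally have "real (Suc i) \<le> real (p ^ i)" by (simp only: of_nat_le_iff)
  then show ?thesis by simp
qed

lemma vabs_p_power_quotient:
  assumes "x \<noteq> 0" "1 / real (Suc i) \<le> vabs (x :: 'k)"
  shows "vabs (of_nat p ^ i / x) \<le> 1"
proof -
  have "vabs (of_nat p ^ i / x) = (1 / real p) ^ i / vabs x" by (simp only: vabs_divide vabs_p_power)
  also have "\<dots> \<le> (1 / real p) ^ i / (1 / real (Suc i))"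
    using assms by (intro divide_left_mono mult_pos_pos) auto
  also have "\<dots> = real (Suc i) / real p ^ i" by (simp add: power_divide)
  also have "\<dots> \<le> 1" using Suc_le_p_power[of i] p_pos by (simp add: divide_le_eq_1 del: of_nat_Suc)
  finally show ?thesis .
qed

lemma p_bernoulli_eq:
  "of_nat p * bernpoly m (0 :: 'k) = (\<Sum>a<p. of_nat a ^ m)
     - (\<Sum>i=1..m. of_nat (m choose i) * (of_nat p * bernpoly (m - i) 0) * (of_nat p ^ i / of_nat (Suc i)))"
proof -
  have "(\<Sum>a<p. of_nat a ^ m :: 'k)
      = (\<Sum>i=0..m. of_nat (m choose i) * bernpoly (m - i) 0 * of_nat p ^ Suc i / of_nat (Suc i))"
    by (simp only: faulhaber atMost_atLeast0)
  also have "\<dots> = of_nat p * bernpoly m 0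
      + (\<Sum>i=1..m. of_nat (m choose i) * bernpoly (m - i) 0 * of_nat p ^ Suc i / of_nat (Suc i))"
    by (subst sum.atLeast_Suc_atMost) (simp_all add: mult.commute)
  also have "(\<Sum>i=1..m. of_nat (m choose i) * bernpoly (m - i) 0 * of_nat p ^ Suc i / of_nat (Suc i))
      = (\<Sum>i=1..m. of_nat (m choose i) * (of_nat p * bernpoly (m - i) 0) * (of_nat p ^ i / of_nat (Suc i) :: 'k))"
    by (intro sum.cong refl) (simp add: mult_ac)
  finally show ?thesis by (simp add: algebra_simps)
qed

text \<open>
  Faulhaber's formula is a recursion for \<open>p B\<^sub>m\<close> with integral coefficients \<open>p\<^sup>i / (i + 1)\<close>. The
  result is a weak form of the von Staudt theorem.
\<close>

lemma p_bernoulli_integral: "vabs (of_nat p * bernpoly m (0 :: 'k)) \<le> 1"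
proof (induction m rule: less_induct)
  case (less m)
  show ?case
    unfolding p_bernoulli_eq[of m]
  proof (intro vabs_diff_le vabs_sum_le)
    fix a show "vabs (of_nat a ^ m :: 'k) \<le> 1" by (simp add: vabs_power power_le_one vabs_of_nat_le)
  next
    fix i assume i: "i \<in> {1..m}"
    have "vabs (of_nat p ^ i / of_nat (Suc i) :: 'k) \<le> 1"
      using vabs_of_nat_ge[of "Suc i"] by (intro vabs_p_power_quotient) (simp_all del: of_nat_Suc)
    moreover have "vabs (of_nat p * bernpoly (m - i) (0 :: 'k)) \<le> 1" using i by (intro less) auto
    ultimately show "vabs (of_nat (m choose i) * (of_nat p * bernpoly (m - i) 0) * (of_nat p ^ i / of_nat (Suc i) :: 'k)) \<le> 1"
      unfolding vabs_mult[of "_ * _" "_ / _"] vabs_mult[of "of_nat (m choose i)"]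
      by (intro mult_le_one mult_nonneg_nonneg vabs_of_nat_le) auto
  qed auto
qed

text \<open>
  In the correction terms \<open>m choose i = (m / i) ((m-1) choose (i-1))\<close> contributes the factor
  \<open>m\<close>, and \<open>p\<^sup>i / (i (i+1))\<close> is integral because \<open>p\<close> divides only one of \<open>i\<close> and \<open>i + 1\<close>.
\<close>

lemma p_bernoulli_close_power_sum:
  assumes m: "m > 0"
  shows "vabs (of_nat p * bernpoly m (0 :: 'k) - (\<Sum>a<p. of_nat a ^ m)) \<le> vabs (of_nat m :: 'k)"
proof -
  have "vabs (\<Sum>i=1..m. of_nat (m choose i) * (of_nat p * bernpoly (m - i) 0) * (of_nat p ^ i / of_nat (Suc i) :: 'k))
      \<le> vabs (of_nat m :: 'k)"
  proof (rule vabs_sum_le)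
    fix i assume i: "i \<in> {1..m}"
    then have i0: "i > 0" by auto
    have "i * (m choose i) = m * (m - 1 choose (i - 1))" using times_binomial_minus1_eq[OF i0] .
    then have "(of_nat i * of_nat (m choose i) :: 'k) = of_nat m * of_nat (m - 1 choose (i - 1))"
      by (simp only: of_nat_mult[symmetric])
    then have binom: "(of_nat (m choose i) :: 'k) = of_nat m * of_nat (m - 1 choose (i - 1)) / of_nat i"
      using i0 by (simp add: field_simps)
    have rearrange: "x * y / u * z * (w / v) = x * (y * z * (w / (u * v)))" for x y z u v w :: 'k
      by simp
    have "1 / real (Suc i) \<le> vabs (of_nat i * of_nat (Suc i) :: 'k)"
    proof (cases "p dvd i")
      case True
      then have "\<not> p dvd Suc i" using prime_p by (metis dvd_add_right_iff Suc_eq_plus1 nat_dvd_1_iff_1 not_prime_1)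
      then have "vabs (of_nat (Suc i) :: 'k) = 1" by (rule vabs_of_nat_unit)
      moreover have "1 / real (Suc i) \<le> 1 / real i" using i0 by (intro divide_left_mono) auto
      ultimately show ?thesis using vabs_of_nat_ge[OF i0] by (simp only: vabs_mult)
    next
      case False
      then have "vabs (of_nat i :: 'k) = 1" by (rule vabs_of_nat_unit)
      then show ?thesis using vabs_of_nat_ge[OF zero_less_Suc, of i] by (simp only: vabs_mult mult_1)
    qed
    then have "vabs (of_nat p ^ i / (of_nat i * of_nat (Suc i)) :: 'k) \<le> 1"
      using i0 by (intro vabs_p_power_quotient) (simp_all del: of_nat_Suc)
    then have "vabs (of_nat (m - 1 choose (i - 1)) * (of_nat p * bernpoly (m - i) 0)
        * (of_nat p ^ i / (of_nat i * of_nat (Suc i))) :: 'k) \<le> 1"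
      unfolding vabs_mult[of "_ * _" "_ / _"] vabs_mult[of "of_nat (m - 1 choose (i - 1))"]
      by (intro mult_le_one mult_nonneg_nonneg vabs_of_nat_le p_bernoulli_integral) auto
    then show "vabs (of_nat (m choose i) * (of_nat p * bernpoly (m - i) 0) * (of_nat p ^ i / of_nat (Suc i) :: 'k))
        \<le> vabs (of_nat m :: 'k)"
      unfolding binom rearrange vabs_mult[of "of_nat m"] by (intro mult_left_le) auto
  qed simp
  then show ?thesis by (subst p_bernoulli_eq) (simp add: vabs_minus)
qed

text \<open>
  Euler's totient of \<open>p\<^bsup>k+1\<^esup>\<close>. These exponents are divisible by \<open>p - 1\<close> and tend to \<open>0\<close> in \<open>Zp\<close>,
  so that raising a unit to them tends to \<open>1\<close>.
\<close>

definition phi :: "nat \<Rightarrow> nat" where "phi k = (p - 1) * p ^ k"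

lemma phi_ge: "Suc k \<le> phi k"
  unfolding phi_def by (rule exponent_ge)

lemma vabs_phi: "vabs (of_nat (phi k) :: 'k) \<le> (1 / real p) ^ k"
  by (rule vabs_of_nat_dvd) (simp add: phi_def)

lemma unit_power_phi_tendsto:
  assumes "x \<in> (Zp_units :: 'k set)"
  shows "(\<lambda>k. x ^ phi k) \<longlonglongrightarrow> 1"
  unfolding phi_def using unit_power_close_1[OF assms] LIMSEQ_Suc[OF inv_p_power_tendsto_0]
  by (rule tendsto_if_vabs_le)

lemma p_power_phi_tendsto: "(\<lambda>k. of_nat p ^ phi k :: 'k) \<longlonglongrightarrow> 0"
proof (rule tendsto_0_vabs_le[OF _ inv_p_power_tendsto_0])
  fix k show "vabs (of_nat p ^ phi k :: 'k) \<le> (1 / real p) ^ k"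
    unfolding vabs_p_power using phi_ge[of k] by (intro inv_p_power_le) auto
qed

text \<open>
  Modulo a quantity that tends to \<open>0\<close>, \<open>p B\<^sub>m\<close> is the power sum \<open>\<Sum>a<p. a\<^sup>m\<close>, in which each of
  the \<open>p - 1\<close> terms with \<open>a > 0\<close> tends to \<open>1\<close> along \<open>m = \<phi>(p\<^bsup>k+1\<^esup>)\<close>.
\<close>

lemma bernoulli_phi_tendsto: "(\<lambda>k. bernpoly (phi k) (0 :: 'k)) \<longlonglongrightarrow> 1 - inverse (of_nat p)"
proof -
  have S: "vabs ((\<Sum>a<p. of_nat a ^ phi k) - of_nat (p - 1) :: 'k) \<le> (1 / real p) ^ k" for k
  proof -
    have "(\<Sum>a<p. of_nat a ^ phi k :: 'k) = (\<Sum>a=0..<p. of_nat a ^ phi k)" by (simp only: atLeast0LessThan)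
    also have "\<dots> = (\<Sum>a=1..<p. of_nat a ^ phi k)"
      using p_pos phi_ge[of k] by (subst sum.atLeast_Suc_lessThan) auto
    finally have "(\<Sum>a<p. of_nat a ^ phi k) - of_nat (p - 1) = (\<Sum>a=1..<p. of_nat a ^ phi k - 1 :: 'k)"
      by (simp add: sum_subtractf)
    moreover have "vabs (of_nat a ^ phi k - 1 :: 'k) \<le> (1 / real p) ^ k" if "a \<in> {1..<p}" for a
    proof -
      have "\<not> p dvd a" using that by (auto dest: dvd_imp_le)
      then have "coprime a p" using prime_p by (metis coprime_commute prime_imp_coprime)
      then have "(of_nat a :: 'k) \<in> Zp_units" by (rule of_nat_in_Zp_units)
      from unit_power_close_1[OF this, of k] show ?thesis
        unfolding phi_def using inv_p_power_le[of k "Suc k"] by linarith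
    qed
    ultimately show ?thesis by (simp only:) (intro vabs_sum_le, auto)
  qed
  have "vabs (of_nat p * bernpoly (phi k) (0 :: 'k) - of_nat (p - 1)) \<le> (1 / real p) ^ k" for k
  proof (rule vabs_trans_le[OF _ S])
    show "vabs (of_nat p * bernpoly (phi k) (0 :: 'k) - (\<Sum>a<p. of_nat a ^ phi k)) \<le> (1 / real p) ^ k"
      using p_bernoulli_close_power_sum[of "phi k"] vabs_phi[of k] phi_ge[of k] by linarith
  qed
  then have "(\<lambda>k. of_nat p * bernpoly (phi k) (0 :: 'k)) \<longlonglongrightarrow> of_nat (p - 1)"
    using inv_p_power_tendsto_0 by (rule tendsto_if_vabs_le)
  then have "(\<lambda>k. inverse (of_nat p) * (of_nat p * bernpoly (phi k) (0 :: 'k))) \<longlonglongrightarrow> inverse (of_nat p) * of_nat (p - 1)"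
    by (intro tendsto_mult tendsto_const)
  moreover have "inverse (of_nat p) * (of_nat p * x) = x" for x :: 'k using p_pos by simp
  moreover have "inverse (of_nat p) * of_nat (p - 1) = 1 - inverse (of_nat p :: 'k)"
    using p_pos by (simp add: of_nat_diff field_simps)
  ultimately show ?thesis by simp
qed

section \<open>Comparison of the two zeta measures\<close>

lemma continuous_on_extend_by_0:
  fixes f :: "'k \<Rightarrow> 'k"
  assumes f: "continuous_on Zp_units f"
  shows "continuous_on Zp (\<lambda>x. if x \<in> Zp_units then f x else 0)"
  unfolding continuous_on_iff
proof (intro ballI allI impI)
  fix x :: 'k and e :: real assume x: "x \<in> Zp" and e: "e > 0"
  have close: "y \<in> Zp_units \<longleftrightarrow> x \<in> Zp_units" if "y \<in> Zp" "dist y x < 1" for y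
    using that x vabs_eq_if_close[of x y] vabs_eq_if_close[of y x]
    by (auto simp: Zp_units_iff dist_vabs vabs_diff_commute[of y x])
  show "\<exists>d>0. \<forall>y\<in>Zp. dist y x < d
      \<longrightarrow> dist (if y \<in> Zp_units then f y else 0) (if x \<in> Zp_units then f x else 0) < e"
  proof (cases "x \<in> Zp_units")
    case True
    then obtain d where d: "d > 0" "\<And>y. y \<in> Zp_units \<Longrightarrow> dist y x < d \<Longrightarrow> dist (f y) (f x) < e"
      using f e unfolding continuous_on_iff by blast
    have "dist (if y \<in> Zp_units then f y else 0) (if x \<in> Zp_units then f x else 0) < e"
      if "y \<in> Zp" "dist y x < min d 1" for y
      using that close[of y] d(2)[of y] True by simp
    moreover have "min d 1 > 0" using d by simp
    ultimately show ?thesis by blast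
  next
    case False
    then show ?thesis using close e by (intro exI[of _ 1]) auto
  qed
qed

lemma restrict_measure_bounded:
  assumes \<mu>: "\<mu> \<in> bounded_measures (Zp :: 'k set)"
  shows "restrict_measure Zp_units \<mu> \<in> bounded_measures Zp_units"
proof -
  obtain C where "norm_bound Zp \<mu> C" using measure_bound[OF \<mu>] by blast
  note C = norm_boundD[OF this]
  let ?e = "\<lambda>f x. if x \<in> Zp_units then f x else (0 :: 'k)"
  show ?thesis
  proof (rule bounded_measuresI[where C = C])
    fix f g :: "'k \<Rightarrow> 'k" assume f: "continuous_on Zp_units f" and g: "continuous_on Zp_units g"
    have "?e (\<lambda>x. f x + g x) = (\<lambda>x. ?e f x + ?e g x)" by auto
    then have "\<mu> (?e (\<lambda>x. f x + g x)) = \<mu> (?e f) + \<mu> (?e g)"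
      using measure_add[OF \<mu> continuous_on_extend_by_0[OF f] continuous_on_extend_by_0[OF g]] by simp
    then show "restrict_measure Zp_units \<mu> (\<lambda>x. f x + g x) = restrict_measure Zp_units \<mu> f + restrict_measure Zp_units \<mu> g"
      using f g by (simp add: restrict_measure_def continuous_intros)
  next
    fix a and f :: "'k \<Rightarrow> 'k" assume f: "continuous_on Zp_units f"
    have "?e (\<lambda>x. a * f x) = (\<lambda>x. a * ?e f x)" by auto
    then have "\<mu> (?e (\<lambda>x. a * f x)) = a * \<mu> (?e f)"
      using measure_cmult[OF \<mu> continuous_on_extend_by_0[OF f]] by simp
    then show "restrict_measure Zp_units \<mu> (\<lambda>x. a * f x) = a * restrict_measure Zp_units \<mu> f"
      using f by (simp add: restrict_measure_def continuous_intros)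
  next
    fix f :: "'k \<Rightarrow> 'k" and b assume f: "continuous_on Zp_units f" "\<And>x. x \<in> Zp_units \<Longrightarrow> vabs (f x) \<le> b"
    have b: "b \<ge> 0" using f(2)[OF one_in_Zp_units] order_trans vabs_nonneg by blast
    then have "vabs (\<mu> (?e f)) \<le> C * b" using f by (intro C continuous_on_extend_by_0) auto
    then show "vabs (restrict_measure Zp_units \<mu> f) \<le> C * b" using f by (simp add: restrict_measure_def)
  qed (simp add: restrict_measure_def)
qed

text \<open>
  \<open>x\<^bsup>\<phi>(p^(k+1))\<^esup>\<close> tends uniformly on \<open>Zp\<close> to the indicator function of the units.
\<close>

lemma restrict_measure_moment_limit:
  assumes \<mu>: "\<mu> \<in> bounded_measures (Zp :: 'k set)"
  shows "(\<lambda>k. \<mu> (\<lambda>x. x ^ (n + phi k))) \<longlonglongrightarrow> restrict_measure Zp_units \<mu> (\<lambda>x. x ^ n)"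
proof -
  let ?g = "\<lambda>x. if x \<in> Zp_units then x ^ n else (0 :: 'k)"
  have "(\<lambda>k. \<mu> (\<lambda>x. x ^ (n + phi k))) \<longlonglongrightarrow> \<mu> ?g"
  proof (rule measure_uniform_limit[OF \<mu> _ _ LIMSEQ_Suc[OF inv_p_power_tendsto_0]])
    fix k and x :: 'k assume x: "x \<in> Zp"
    have "vabs x ^ n \<le> 1" using x by (intro power_le_one) (auto simp: Zp_def)
    moreover have "x ^ (n + phi k) - ?g x = x ^ n * (x ^ phi k - (if x \<in> Zp_units then 1 else 0))"
      by (simp add: power_add algebra_simps)
    moreover have "vabs (x ^ phi k - (if x \<in> Zp_units then 1 else 0)) \<le> (1 / real p) ^ Suc k"
      unfolding phi_def using unit_power_close_1[of x k] nonunit_power_close_0[OF x, of k] by simp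
    ultimately show "vabs (x ^ (n + phi k) - ?g x) \<le> (1 / real p) ^ Suc k"
      using mult_mono[of "vabs x ^ n" 1 "vabs (x ^ phi k - (if x \<in> Zp_units then 1 else 0))" "(1 / real p) ^ Suc k"]
      by (simp only: vabs_mult vabs_power) simp
  qed (auto intro!: continuous_intros continuous_on_extend_by_0)
  then show ?thesis by (simp add: restrict_measure_def continuous_intros)
qed

lemma moment_limit:
  assumes \<mu>: "\<mu> \<in> bounded_measures (Zp_units :: 'k set)"
  shows "(\<lambda>k. \<mu> (\<lambda>x. x ^ (n + phi k))) \<longlonglongrightarrow> \<mu> (\<lambda>x. x ^ n)"
proof (rule measure_uniform_limit[OF \<mu> _ _ LIMSEQ_Suc[OF inv_p_power_tendsto_0]])
  fix k and x :: 'k assume x: "x \<in> Zp_units"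
  have "x ^ (n + phi k) - x ^ n = x ^ n * (x ^ phi k - 1)" by (simp add: power_add algebra_simps)
  then show "vabs (x ^ (n + phi k) - x ^ n) \<le> (1 / real p) ^ Suc k"
    using unit_power_close_1[OF x, of k] x by (simp add: vabs_mult vabs_power Zp_units_iff phi_def)
qed (auto intro!: continuous_intros)

lemma half_in_Zp_units: "(inverse 2 :: 'k) \<in> Zp_units" "(2 :: 'k) \<in> Zp_units"
proof -
  have "coprime 2 p" using odd_p by simp
  then show "(2 :: 'k) \<in> Zp_units" using of_nat_in_Zp_units[of 2] by simp
  then show "(inverse 2 :: 'k) \<in> Zp_units" by (rule Zp_units_inverse)
qed

text \<open>
  The moments that characterize \<open>r\<^sub>c \<star> Z\<close> for the classical zeta pseudomeasure \<open>Z\<close>.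
\<close>

definition zeta_moment :: "nat \<Rightarrow> nat \<Rightarrow> 'k" where
  "zeta_moment c n = - ((1 - of_nat c ^ (n + 1)) * (1 - of_nat p ^ n) * (bernpoly (n + 1) 0 / of_nat (n + 1)))"

text \<open>
  The moments of the half-shift measure \<open>\<mu>\<close> on \<open>Zp\<close> and of \<open>\<rho>\<close> on the units are related by
  \<open>(1 - p\<^sup>n) \<integral> x\<^sup>n d\<mu> = (1 - 2\<^bsup>-n\<^esup>) \<integral> x\<^sup>n d\<rho>\<close>. Replacing \<open>n\<close> by \<open>n + (p - 1) p\<^sup>k\<close> and letting
  \<open>k\<close> tend to infinity restricts \<open>\<mu>\<close> to the units and removes the Euler factor.
\<close>

lemma half_shift_restricted_moment:
  assumes \<mu>: "is_half_shift_measure c \<mu>" and c: "c > 0"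
    and \<rho>: "\<rho> \<in> bounded_measures (Zp_units :: 'k set)" "\<And>n. \<rho> (\<lambda>x. x ^ n) = zeta_moment c n"
  shows "restrict_measure Zp_units \<mu> (\<lambda>x. x ^ n) = (1 - inverse 2 ^ n) * \<rho> (\<lambda>x. x ^ n)"
proof (rule LIMSEQ_unique)
  have bm: "\<mu> \<in> bounded_measures Zp" using \<mu> by (simp add: is_half_shift_measure_def)
  have rearrange: "(1 - u) * ((h - 1) * b / d) * (1 - e) = (1 - h) * - ((1 - u) * (1 - e) * (b / d))"
    for u h b d e :: 'k by (simp add: divide_inverse algebra_simps)
  have rel: "\<mu> (\<lambda>x. x ^ m) * (1 - of_nat p ^ m) = (1 - inverse 2 ^ m) * \<rho> (\<lambda>x. x ^ m)" for m
    unfolding half_shift_moment[OF \<mu> c] \<rho>(2) zeta_moment_def Suc_eq_plus1[symmetric] bernpoly_half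
    by (simp only: rearrange)
  have pm: "(\<lambda>k. of_nat p ^ (n + phi k) :: 'k) \<longlonglongrightarrow> 0"
    using tendsto_mult[OF tendsto_const p_power_phi_tendsto, of "of_nat p ^ n"] by (simp add: power_add)
  have half: "(\<lambda>k. inverse 2 ^ (n + phi k) :: 'k) \<longlonglongrightarrow> inverse 2 ^ n"
    using tendsto_mult[OF tendsto_const unit_power_phi_tendsto[OF half_in_Zp_units(1)], of "inverse 2 ^ n"]
    by (simp add: power_add)
  have "(\<lambda>k. \<mu> (\<lambda>x. x ^ (n + phi k)) * (1 - of_nat p ^ (n + phi k)))
      \<longlonglongrightarrow> restrict_measure Zp_units \<mu> (\<lambda>x. x ^ n) * (1 - 0)"
    by (intro tendsto_mult tendsto_diff restrict_measure_moment_limit bm tendsto_const pm)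
  then show "(\<lambda>k. \<mu> (\<lambda>x. x ^ (n + phi k)) * (1 - of_nat p ^ (n + phi k)))
      \<longlonglongrightarrow> restrict_measure Zp_units \<mu> (\<lambda>x. x ^ n)" by simp
  show "(\<lambda>k. \<mu> (\<lambda>x. x ^ (n + phi k)) * (1 - of_nat p ^ (n + phi k)))
      \<longlonglongrightarrow> (1 - inverse 2 ^ n) * \<rho> (\<lambda>x. x ^ n)"
    unfolding rel by (intro tendsto_mult tendsto_diff moment_limit \<rho>(1) tendsto_const half)
qed

definition half_shift_factor :: "'k functional" where
  "half_shift_factor = (\<lambda>f. dirac Zp_units 1 f - dirac Zp_units (inverse 2) f)"

lemma half_shift_factor_bounded: "half_shift_factor \<in> bounded_measures Zp_units"
  unfolding half_shift_factor_def
  using measure_linear_combination[OF dirac_bounded[OF one_in_Zp_units] dirac_bounded[OF half_in_Zp_units(1)], of 1]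
    one_in_Zp_units by auto

lemma half_shift_eq_convolution:
  assumes \<mu>: "is_half_shift_measure c \<mu>" and c: "c > 0"
    and \<rho>: "\<rho> \<in> bounded_measures (Zp_units :: 'k set)" "\<And>n. \<rho> (\<lambda>x. x ^ n) = zeta_moment c n"
  shows "restrict_measure Zp_units \<mu> = half_shift_factor \<otimes>\<^bsub>\<Lambda>\<^esub> \<rho>"
proof (rule measure_eq_if_moments_eq)
  show "restrict_measure Zp_units \<mu> \<in> bounded_measures Zp_units"
    using \<mu> by (intro restrict_measure_bounded) (simp add: is_half_shift_measure_def)
  show "half_shift_factor \<otimes>\<^bsub>\<Lambda>\<^esub> \<rho> \<in> bounded_measures Zp_units"
    unfolding Iwasawa_simps by (intro convolution_bounded half_shift_factor_bounded \<rho>)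
  fix n
  have "half_shift_factor (\<lambda>x. x ^ n) = 1 - inverse 2 ^ n"
    by (simp only: half_shift_factor_def one_moment power_one)
  then show "restrict_measure Zp_units \<mu> (\<lambda>x. x ^ n) = (half_shift_factor \<otimes>\<^bsub>\<Lambda>\<^esub> \<rho>) (\<lambda>x. x ^ n)"
    unfolding Iwasawa_simps convolution_moment[OF half_shift_factor_bounded \<rho>(1)]
      half_shift_restricted_moment[OF assms] by simp
qed

text \<open>
  For each \<open>c\<close> the classical zeta pseudomeasure is the fraction \<open>\<rho> / r\<^sub>c\<close>. The freedom in \<open>c\<close> is used to
  find, at each point, a denominator whose Mellin transform does not vanish.
\<close>

lemma classical_zeta_pfrac:
  assumes Z: "is_classical_zeta p (Z :: 'k pseudomeasure)" and c: "odd c" "c > 1" "coprime c p"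
  obtains \<rho> where "\<rho> \<in> bounded_measures Zp_units" "\<And>n. \<rho> (\<lambda>x. x ^ n) = zeta_moment c n" "Z = pfrac p \<rho> (r_elt c)"
proof -
  interpret comm_monoid \<Lambda> by (rule Iwasawa_comm_monoid)
  have Zcar: "Z \<in> carrier (pseudomeasures p)" using Z by (simp add: is_classical_zeta_def)
  from Z c obtain \<rho> where \<rho>: "\<rho> \<in> integral_measures Zp_units"
      "of_measure p (r_elt c) \<otimes>\<^bsub>pseudomeasures p\<^esub> Z = of_measure p \<rho>"
      "\<And>n. \<rho> (\<lambda>x. x ^ n) = zeta_moment c n"
    unfolding is_classical_zeta_def zeta_moment_def by blast
  have \<rho>b: "\<rho> \<in> bounded_measures Zp_units" using \<rho>(1) by (simp add: integral_measures_def)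
  obtain A t where At: "A \<in> carrier \<Lambda>" "t \<in> denominators p" "Z = pfrac p A t"
    by (rule localization_elem[OF Iwasawa_comm_monoid denominators_subset _ denominators.one Zcar])
       (use denominators_mult in auto)
  have r: "(r_elt c :: 'k functional) \<in> denominators p" "r_elt c \<in> carrier \<Lambda>" "t \<in> carrier \<Lambda>"
    using r_elt_in_denominators[OF c] At(2) denominators_subset by auto
  have \<rho>c: "\<rho> \<in> carrier \<Lambda>" using \<rho>b by (simp add: Iwasawa_simps)
  have "of_measure p (r_elt c) \<otimes>\<^bsub>pseudomeasures p\<^esub> Z = pfrac p (r_elt c \<otimes>\<^bsub>\<Lambda>\<^esub> A) (\<one>\<^bsub>\<Lambda>\<^esub> \<otimes>\<^bsub>\<Lambda>\<^esub> t)"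
    unfolding At(3) by (rule pfrac_mult[OF r(2) At(1) denominators.one At(2)])
  also have "\<dots> = pfrac p (r_elt c \<otimes>\<^bsub>\<Lambda>\<^esub> A) t" using r by simp
  finally have eq: "pfrac p (r_elt c \<otimes>\<^bsub>\<Lambda>\<^esub> A) t = pfrac p \<rho> \<one>\<^bsub>\<Lambda>\<^esub>" using \<rho>(2) by simp
  have "(\<rho>, \<one>\<^bsub>\<Lambda>\<^esub>) \<in> pfrac p \<rho> \<one>\<^bsub>\<Lambda>\<^esub>"
    by (rule pfrac_self[OF \<rho>c denominators.one])
  then have "(r_elt c \<otimes>\<^bsub>\<Lambda>\<^esub> A) \<otimes>\<^bsub>\<Lambda>\<^esub> \<one>\<^bsub>\<Lambda>\<^esub> = \<rho> \<otimes>\<^bsub>\<Lambda>\<^esub> t" unfolding eq[symmetric] by (rule pfrac_mem(5))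
  then have "A \<otimes>\<^bsub>\<Lambda>\<^esub> r_elt c = \<rho> \<otimes>\<^bsub>\<Lambda>\<^esub> t" using r At by (simp add: m_comm)
  then have "Z = pfrac p \<rho> (r_elt c)" unfolding At(3) by (rule pfrac_eqI[OF At(1) \<rho>c At(2) r(1)])
  then show ?thesis using that \<rho>b \<rho>(3) by blast
qed

lemma half_shift_factor_times_pfrac:
  assumes \<rho>: "\<rho> \<in> bounded_measures (Zp_units :: 'k set)" and r: "r \<in> denominators p"
  shows "of_measure p half_shift_factor \<otimes>\<^bsub>pseudomeasures p\<^esub> pfrac p \<rho> r = pfrac p (half_shift_factor \<otimes>\<^bsub>\<Lambda>\<^esub> \<rho>) r"
proof -
  interpret comm_monoid \<Lambda> by (rule Iwasawa_comm_monoid)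
  have car: "half_shift_factor \<in> carrier \<Lambda>" "\<rho> \<in> carrier \<Lambda>" "r \<in> carrier \<Lambda>"
    using half_shift_factor_bounded \<rho> r denominators_subset by (auto simp: Iwasawa_simps(1))
  have "of_measure p half_shift_factor \<otimes>\<^bsub>pseudomeasures p\<^esub> pfrac p \<rho> r
      = pfrac p (half_shift_factor \<otimes>\<^bsub>\<Lambda>\<^esub> \<rho>) (\<one>\<^bsub>\<Lambda>\<^esub> \<otimes>\<^bsub>\<Lambda>\<^esub> r)"
    by (rule pfrac_mult[OF car(1,2) denominators.one r])
  then show ?thesis using car by simp
qed

lemma padic_power_minus_of_nat:
  assumes a: "vabs (a - 1 :: 'k) \<le> 1 / real p"
  shows "padic_power a (- of_nat n) = inverse a ^ n"
proof (induction n)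
  case 0
  then show ?case using padic_power_of_nat[of a 0] by simp
next
  case (Suc n)
  have "vabs a = 1" using a inv_p_less_1 by (intro vabs_eq_1_if_close_1) simp
  then have "a \<noteq> 0" by auto
  have "padic_power a (- of_nat n) = a * padic_power a (- of_nat (Suc n))"
    using padic_power_Suc[OF power_disc_minus[OF power_disc_of_nat[of "Suc n"]] a] by simp
  then show ?case using Suc \<open>a \<noteq> 0\<close> by (simp add: field_simps)
qed

text \<open>Again both sides are analytic in \<open>s\<close> and agree at the natural numbers.\<close>

lemma padic_power_inverse:
  assumes a: "vabs (a - 1 :: 'k) \<le> 1 / real p" and s: "s \<in> power_disc p"
  shows "padic_power (inverse a) s = padic_power a (- s)"
proof -
  have a1: "vabs a = 1" using a inv_p_less_1 by (intro vabs_eq_1_if_close_1) simp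
  then have "a \<noteq> 0" by auto
  then have "inverse a - 1 = - ((a - 1) / a)" by (simp add: field_simps)
  then have ia: "vabs (inverse a - 1) \<le> 1 / real p" using a a1 by (simp only: vabs_minus) (simp add: vabs_divide)
  obtain A where A: "\<And>n. vabs (A n) \<le> (1 / q_radius) ^ n" "A 0 = 1" "\<And>s. s \<in> power_disc p \<Longrightarrow> (\<lambda>n. A n * s ^ n) sums padic_power a s"
    using padic_power_analytic[OF a] by blast
  obtain B where B: "\<And>n. vabs (B n) \<le> (1 / q_radius) ^ n" "B 0 = 1" "\<And>s. s \<in> power_disc p \<Longrightarrow> (\<lambda>n. B n * s ^ n) sums padic_power (inverse a) s"
    using padic_power_analytic[OF ia] by blast
  have A': "(\<lambda>n. ((- 1) ^ n * A n) * s ^ n) sums padic_power a (- s)" if "s \<in> power_disc p" for s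
    using A(3)[OF power_disc_minus[OF that]] by (simp add: power_minus[of s] mult_ac)
  show ?thesis
  proof (rule analytic_eqI[OF _ B(3) _ A' _ s])
    show "vabs (B n) \<le> 1" "vabs ((- 1) ^ n * A n) \<le> 1" for n
      using order_trans[OF B(1) inv_q_power_le_1] order_trans[OF A(1) inv_q_power_le_1]
      by (simp_all only: vabs_mult vabs_power vabs_minus vabs_one power_one mult_1)
    show "padic_power (inverse a) (of_nat k) = padic_power a (- of_nat k)" for k
      by (simp add: padic_power_of_nat padic_power_minus_of_nat[OF a])
  qed
qed

lemma mellin_half_shift_factor:
  assumes s: "s \<in> power_disc p"
  shows "mellin p half_shift_factor j s = 1 - teichmueller p 2 powi (- j) * padic_power (angle p 2) (- s)"
proof -
  have "mellin p half_shift_factor j s = 1 - character j s (inverse 2)"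
    unfolding mellin_eq half_shift_factor_def
    by (simp add: dirac_def continuous_on_character[OF s] character_one)
  moreover have "character j s (inverse 2) = teichmueller p 2 powi (- j) * padic_power (angle p 2) (- s)"
  proof -
    have "angle p (inverse 2) = inverse (angle p 2 :: 'k)"
      by (simp only: angle_def teichmueller_inverse[OF half_in_Zp_units(2)] inverse_divide divide_inverse inverse_mult_distrib inverse_inverse_eq)
    then show ?thesis
      unfolding character_def teichmueller_inverse[OF half_in_Zp_units(2)]
      by (simp add: padic_power_inverse[OF angle_close_1[OF half_in_Zp_units(2)] s] power_int_minus power_int_inverse)
  qed
  ultimately show ?thesis by simp
qed

lemma branch_half_shift_times:
  assumes Z: "is_classical_zeta p (Z :: 'k pseudomeasure)" and s: "s \<in> power_disc p"
    and not_pole: "\<not> ([j = - 1] (mod (int p - 1)) \<and> s = - 1)"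
  shows "branch p (of_measure p half_shift_factor \<otimes>\<^bsub>pseudomeasures p\<^esub> Z) j s
    = mellin p half_shift_factor j s * branch p Z j s"
proof -
  obtain c where c: "odd c" "c > 1" "coprime c p" "mellin p (r_elt c :: 'k functional) j s \<noteq> 0"
    using ex_mellin_r_elt_nonzero[OF s not_pole] by blast
  obtain \<rho> where \<rho>: "\<rho> \<in> bounded_measures Zp_units" "Z = pfrac p \<rho> (r_elt c)"
    by (rule classical_zeta_pfrac[OF Z c(1-3)])
  have r: "(r_elt c :: 'k functional) \<in> denominators p" by (rule r_elt_in_denominators[OF c(1-3)])
  have car: "half_shift_factor \<in> carrier \<Lambda>" "\<rho> \<in> carrier \<Lambda>"
    using half_shift_factor_bounded \<rho> by (auto simp: Iwasawa_simps(1))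
  interpret comm_monoid \<Lambda> by (rule Iwasawa_comm_monoid)
  show ?thesis
    unfolding \<rho>(2) half_shift_factor_times_pfrac[OF \<rho>(1) r]
      branch_pfrac[OF m_closed[OF car] r s c(4)] branch_pfrac[OF car(2) r s c(4)] mellin_convolution[OF car s]
    by simp
qed

section \<open>The residue at the pole\<close>

lemma continuous_on_inverse_Zp_units: "continuous_on (Zp_units :: 'k set) inverse"
  unfolding continuous_on_iff
proof (intro ballI allI impI)
  fix x :: 'k and e :: real assume x: "x \<in> Zp_units" and e: "e > 0"
  have "dist (inverse y) (inverse x) = dist y x" if y: "y \<in> Zp_units" for y
  proof -
    have "inverse y - inverse x = - ((y - x) / (y * x))"
      using Zp_units_nonzero[OF x] Zp_units_nonzero[OF y] by (simp add: field_simps)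
    then have "vabs (inverse y - inverse x) = vabs ((y - x) / (y * x))" by (simp only: vabs_minus)
    then show ?thesis using x y by (simp add: dist_vabs vabs_divide vabs_mult Zp_units_iff)
  qed
  then show "\<exists>d>0. \<forall>y\<in>Zp_units. dist y x < d \<longrightarrow> dist (inverse y) (inverse x) < e" using e by auto
qed

lemma character_minus_1:
  assumes x: "x \<in> (Zp_units :: 'k set)" and s: "s \<in> power_disc p"
  shows "character (- 1) s x = inverse x * padic_power (angle p x) (s + 1)"
proof -
  have "padic_power (angle p x) (s + 1) = angle p x * padic_power (angle p x) s"
    by (rule padic_power_Suc[OF s angle_close_1[OF x]])
  moreover have "inverse x * angle p x = inverse (teichmueller p x)"
    using Zp_units_nonzero[OF x] by (simp add: angle_def field_simps)
  ultimately show ?thesis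
    by (simp add: character_def power_int_minus flip: mult.assoc)
qed

text \<open>Integrating the binomial series termwise expands the Mellin transform around \<open>s = -1\<close>.\<close>

lemma mellin_newton_series:
  assumes \<sigma>: "\<sigma> \<in> bounded_measures (Zp_units :: 'k set)" and s: "s \<in> power_disc p"
  shows "(\<lambda>k. (s + 1 gchoose k) * \<sigma> (\<lambda>x. inverse x * (angle p x - 1) ^ k)) sums mellin p \<sigma> (- 1) s"
proof -
  define h where "h = s + 1"
  have h: "h \<in> power_disc p" using power_disc_add[OF s power_disc_of_nat[of 1]] by (simp add: h_def)
  let ?t = "\<lambda>k x :: 'k. inverse x * (angle p x - 1) ^ k"
  let ?f = "\<lambda>n x. \<Sum>k<Suc n. (h gchoose k) * ?t k x"
  have t: "continuous_on Zp_units (?t k)" for k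
    by (intro continuous_intros continuous_on_angle continuous_on_inverse_Zp_units)
  have "(\<lambda>n. \<sigma> (?f n)) \<longlonglongrightarrow> \<sigma> (character (- 1) s)"
  proof (rule measure_uniform_limit[OF \<sigma>])
    show "continuous_on Zp_units (?f n)" for n
      by (intro continuous_on_sum continuous_on_mult' continuous_on_const t)
    show "continuous_on Zp_units (character (- 1) s)" by (rule continuous_on_character[OF s])
    show "(\<lambda>n. vabs h * 1 * ratio h ^ n) \<longlonglongrightarrow> 0"
      using ratio_bounds[OF h] by (intro tendsto_mult_right_zero LIMSEQ_power_zero) auto
    fix n and x :: 'k assume x: "x \<in> Zp_units"
    let ?u = "\<lambda>k. (h gchoose k) * (angle p x - 1) ^ k"
    have tail: "(\<lambda>k. ?u (k + Suc n)) sums (padic_power (angle p x) h - (\<Sum>k<Suc n. ?u k))"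
      by (rule sums_shift[OF padic_power_sums[OF h angle_close_1[OF x]]])
    have "vabs (padic_power (angle p x) h - (\<Sum>k<Suc n. ?u k)) \<le> vabs h * 1 * ratio h ^ n"
    proof (rule vabs_sums_le[OF tail])
      fix k
      have "vabs (angle p x - 1) ^ (k + Suc n) \<le> (1 / real p) ^ (k + Suc n)"
        using angle_close_1[OF x] by (intro power_mono) auto
      also have "\<dots> \<le> (1 / real p) ^ (k + n)" by (rule inv_p_power_le) simp
      finally have "vabs ((angle p x - 1) ^ Suc (k + n)) \<le> 1 * (1 / real p) ^ (k + n)"
        by (simp only: vabs_power add_Suc_right mult_1)
      then have "vabs ((h gchoose Suc (k + n)) * (angle p x - 1) ^ Suc (k + n)) \<le> vabs h * 1 * ratio h ^ (k + n)"
        by (rule vabs_gbinomial_term_le) simp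
      also have "\<dots> \<le> vabs h * 1 * ratio h ^ n"
        using ratio_bounds[OF h] by (intro mult_left_mono power_decreasing) auto
      finally show "vabs (?u (k + Suc n)) \<le> vabs h * 1 * ratio h ^ n" by (simp only: add_Suc_right)
    qed
    moreover have "?f n x - character (- 1) s x
        = - (inverse x * (padic_power (angle p x) h - (\<Sum>k<Suc n. ?u k)))"
    proof -
      have "?f n x = inverse x * (\<Sum>k<Suc n. ?u k)"
        unfolding sum_distrib_left by (intro sum.cong refl) (simp only: mult_ac)
      then show ?thesis unfolding character_minus_1[OF x s] h_def[symmetric]
        by (simp only: right_diff_distrib minus_diff_eq)
    qed
    moreover have "vabs (inverse x) = 1" using x by (simp add: vabs_inverse Zp_units_iff)
    ultimately show "vabs (?f n x - character (- 1) s x) \<le> vabs h * 1 * ratio h ^ n"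
      by (simp only: vabs_minus vabs_mult mult_1)
  qed
  moreover have "\<sigma> (?f n) = (\<Sum>k<Suc n. (h gchoose k) * \<sigma> (?t k))" for n
  proof -
    have "\<sigma> (?f n) = (\<Sum>k<Suc n. \<sigma> (\<lambda>x. (h gchoose k) * ?t k x))"
      by (intro measure_sum[OF \<sigma>] continuous_on_mult' continuous_on_const t)
    then show ?thesis by (simp only: measure_cmult[OF \<sigma> t])
  qed
  ultimately have "(\<lambda>n. \<Sum>k<Suc n. (h gchoose k) * \<sigma> (?t k)) \<longlonglongrightarrow> mellin p \<sigma> (- 1) s"
    by (simp only: mellin_eq)
  then show ?thesis unfolding sums_def h_def[symmetric] by (rule LIMSEQ_imp_Suc)
qed

lemma mellin_analytic:
  assumes \<sigma>: "\<sigma> \<in> bounded_measures (Zp_units :: 'k set)"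
  obtains N C where "\<And>n. vabs (N n) \<le> C" "N 0 = \<sigma> inverse"
    "\<And>s. s \<in> power_disc p \<Longrightarrow> (\<lambda>n. N n * (s + 1) ^ n) sums mellin p \<sigma> (- 1) s"
proof -
  obtain C where "norm_bound Zp_units \<sigma> C" using measure_bound[OF \<sigma>] by blast
  note C = norm_boundD[OF this]
  let ?m = "\<lambda>k. \<sigma> (\<lambda>x. inverse x * (angle p x - 1) ^ k)"
  have m: "vabs (?m k) \<le> C * (1 / real p) ^ k" for k
  proof (rule C(2))
    show "continuous_on Zp_units (\<lambda>x :: 'k. inverse x * (angle p x - 1) ^ k)"
      by (intro continuous_intros continuous_on_angle continuous_on_inverse_Zp_units)
    fix x :: 'k assume x: "x \<in> Zp_units"
    then show "vabs (inverse x * (angle p x - 1) ^ k) \<le> (1 / real p) ^ k"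
      using angle_close_1[OF x] by (simp only: vabs_mult vabs_power vabs_inverse Zp_units_iff) (simp add: power_mono)
  qed (use p_pos in simp)
  obtain N where N: "\<And>n. vabs (N n) \<le> C * (1 / q_radius) ^ n" "N 0 = ?m 0"
    "\<And>s. s \<in> power_disc p \<Longrightarrow> (\<lambda>n. N n * s ^ n) sums (\<Sum>k. (s gchoose k) * ?m k)"
    by (rule newton_series_analytic[OF m]) blast
  have "(\<lambda>n. N n * (s + 1) ^ n) sums mellin p \<sigma> (- 1) s" if s: "s \<in> power_disc p" for s
  proof -
    have "s + 1 \<in> power_disc p" using power_disc_add[OF s power_disc_of_nat[of 1]] by simp
    from N(3)[OF this] show ?thesis using mellin_newton_series[OF \<sigma> s] by (simp add: sums_iff)
  qed
  moreover have "N 0 = \<sigma> inverse" using N(2) by simp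
  moreover have "vabs (N n) \<le> C" for n
    using order_trans[OF N(1) mult_left_mono[OF inv_q_power_le_1 C(1)]] by simp
  ultimately show ?thesis using that by blast
qed

text \<open>The constant term \<open>E\<^sub>0\<close> of \<open>(a\<^sup>h - 1) / h\<close> is the p-adic logarithm of \<open>a\<close>.\<close>

lemma padic_log_series:
  assumes a: "vabs (a - 1 :: 'k) \<le> 1 / real p" and a1: "a \<noteq> 1"
  obtains E where "\<And>n. vabs (E n) \<le> 1" "E 0 \<noteq> 0"
    "\<And>h. h \<in> power_disc p \<Longrightarrow> h \<noteq> 0 \<Longrightarrow> (\<lambda>n. E n * h ^ n) sums ((padic_power a h - 1) / h)"
    "(\<lambda>k. (a ^ phi k - 1) / of_nat (phi k)) \<longlonglongrightarrow> E 0"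
proof -
  obtain A where A: "\<And>n. vabs (A n) \<le> (1 / q_radius) ^ n" "A 0 = 1" "\<And>s. s \<in> power_disc p \<Longrightarrow> (\<lambda>n. A n * s ^ n) sums padic_power a s"
    using padic_power_analytic[OF a] by blast
  define E where "E n = A (Suc n)" for n
  have E: "vabs (E n) \<le> 1" for n
  proof -
    have "(1 / q_radius) ^ Suc n \<le> 1" using q_radius_gt_1 by (intro power_le_one) auto
    then show ?thesis unfolding E_def using A(1)[of "Suc n"] by linarith
  qed
  have sums: "(\<lambda>n. E n * h ^ n) sums ((padic_power a h - 1) / h)" if h: "h \<in> power_disc p" "h \<noteq> 0" for h
  proof -
    have "(\<lambda>n. A (n + 1) * h ^ (n + 1)) sums (padic_power a h - (\<Sum>k<1. A k * h ^ k))"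
      by (rule sums_shift[OF A(3)[OF h(1)]])
    from sums_cmult[OF this, of "inverse h"]
    have "(\<lambda>n. inverse h * (A (n + 1) * h ^ (n + 1))) sums (inverse h * (padic_power a h - 1))"
      by (simp add: A(2))
    moreover have "inverse h * (A (n + 1) * h ^ (n + 1)) = E n * h ^ n" for n
      using h(2) by (simp add: E_def)
    ultimately show ?thesis by (simp only: divide_inverse mult.commute)
  qed
  have close: "vabs ((padic_power a h - 1) / h - E 0) \<le> vabs h" if h: "h \<noteq> 0" "vabs h \<le> 1" for h
  proof -
    have "h \<in> power_disc p" using h q_radius_gt_1 by (simp add: power_disc_iff)
    from sums_shift[OF sums[OF this h(1)], of 1]
    have "(\<lambda>n. E (n + 1) * h ^ (n + 1)) sums ((padic_power a h - 1) / h - E 0)" by simp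
    then show ?thesis
    proof (rule vabs_sums_le)
      fix n
      have "vabs h ^ (n + 1) \<le> vabs h ^ 1" using h by (intro power_decreasing) auto
      then have "vabs (E (n + 1)) * vabs h ^ (n + 1) \<le> 1 * vabs h" using E by (intro mult_mono) auto
      then show "vabs (E (n + 1) * h ^ (n + 1)) \<le> vabs h" by (simp only: vabs_mult vabs_power mult_1)
    qed
  qed
  have phi0: "(of_nat (phi k) :: 'k) \<noteq> 0" for k
  proof -
    have "phi k \<noteq> 0" using phi_ge[of k] by linarith
    then show ?thesis by simp
  qed
  have lim: "(\<lambda>k. (a ^ phi k - 1) / of_nat (phi k)) \<longlonglongrightarrow> E 0"
  proof (rule tendsto_if_vabs_le[OF _ inv_p_power_tendsto_0])
    fix k
    have "vabs ((padic_power a (of_nat (phi k)) - 1) / of_nat (phi k) - E 0) \<le> vabs (of_nat (phi k) :: 'k)"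
      by (rule close[OF phi0 vabs_of_nat_le])
    then show "vabs ((a ^ phi k - 1) / of_nat (phi k) - E 0) \<le> (1 / real p) ^ k"
      using vabs_phi[of k] unfolding padic_power_of_nat by linarith
  qed
  have "vabs ((a ^ phi k - 1) / of_nat (phi k)) = vabs (a - 1)" for k
    using vabs_padic_power_minus_1[OF power_disc_of_nat[of "phi k"] a] phi0[of k]
    by (simp add: padic_power_of_nat vabs_divide)
  then have "vabs (E 0) = vabs (a - 1)"
    using tendsto_vabs[OF lim] LIMSEQ_unique tendsto_const by (simp only:) blast
  then have "E 0 \<noteq> 0" using a1 by auto
  then show ?thesis using that E sums lim by blast
qed

text \<open>
  On the units \<open>x\<^bsup>m-1\<^esup>\<close> tends to \<open>x\<^bsup>-1\<^esup>\<close> along \<open>m = \<phi>(p\<^bsup>k+1\<^esup>)\<close>. In the moment of index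
  \<open>m - 1\<close>, the factor \<open>1 - 2\<^bsup>1-m\<^esup>\<close> tends to \<open>-1\<close>, the Euler factor to \<open>1\<close>, and
  \<open>- (1 - c\<^sup>m) B\<^sub>m / m\<close> to \<open>E\<^sub>0 (1 - 1/p)\<close>, where \<open>E\<^sub>0\<close> is the logarithm of \<open>\<langle>c\<rangle>\<close>.
\<close>

lemma half_shift_inverse_moment:
  assumes \<sigma>: "\<sigma> \<in> bounded_measures (Zp_units :: 'k set)"
    and moments: "\<And>n. \<sigma> (\<lambda>x. x ^ n) = (1 - inverse 2 ^ n) * zeta_moment c n"
    and c: "coprime c p" and E: "(\<lambda>k. (angle p (of_nat c) ^ phi k - 1) / of_nat (phi k)) \<longlonglongrightarrow> (E0 :: 'k)"
  shows "\<sigma> inverse = - E0 * (1 - inverse (of_nat p))"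
proof (rule LIMSEQ_unique)
  have u: "(of_nat c :: 'k) \<in> Zp_units" by (rule of_nat_in_Zp_units[OF c])
  have Suc_phi: "Suc (phi k - 1) = phi k" for k using phi_ge[of k] by linarith
  show "(\<lambda>k. \<sigma> (\<lambda>x. x ^ (phi k - 1))) \<longlonglongrightarrow> \<sigma> inverse"
  proof (rule measure_uniform_limit[OF \<sigma> _ continuous_on_inverse_Zp_units LIMSEQ_Suc[OF inv_p_power_tendsto_0]])
    fix k and x :: 'k assume x: "x \<in> Zp_units"
    have "x ^ phi k = x * x ^ (phi k - 1)" by (simp only: power_Suc[symmetric] Suc_phi)
    then have "x ^ (phi k - 1) - inverse x = inverse x * (x ^ phi k - 1)"
      using Zp_units_nonzero[OF x] by (simp add: field_simps)
    then show "vabs (x ^ (phi k - 1) - inverse x) \<le> (1 / real p) ^ Suc k"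
      using unit_power_close_1[OF x, of k] x by (simp only: vabs_mult vabs_inverse Zp_units_iff phi_def) simp
  qed (intro continuous_intros)
  have c_phi: "(of_nat c :: 'k) ^ phi k = angle p (of_nat c) ^ phi k" for k
  proof -
    have "(of_nat c :: 'k) ^ phi k = (teichmueller p (of_nat c) * angle p (of_nat c)) ^ phi k"
      by (simp only: teichmueller_times_angle[OF u])
    also have "\<dots> = (teichmueller p (of_nat c) ^ (p - 1)) ^ p ^ k * angle p (of_nat c) ^ phi k"
      by (simp only: power_mult_distrib phi_def power_mult)
    finally show ?thesis by (simp only: teichmueller_unfold(2)[OF u] power_one mult_1)
  qed
  have eq: "\<sigma> (\<lambda>x. x ^ (phi k - 1)) = (1 - inverse 2 ^ phi k * 2)
      * (((angle p (of_nat c) ^ phi k - 1) / of_nat (phi k)) * (1 - of_nat p ^ phi k / of_nat p) * bernpoly (phi k) 0)" for k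
  proof -
    have shift: "y ^ (phi k - 1) = y ^ phi k / y" if "y \<noteq> 0" for y :: 'k
      using that power_Suc[of y "phi k - 1"] unfolding Suc_phi by simp
    have neg: "- ((1 - u) * v * (w / d)) = (u - 1) / d * v * w" for u v w d :: 'k
      by (simp add: divide_inverse algebra_simps)
    have "(of_nat p :: 'k) \<noteq> 0" using p_pos by simp
    then show ?thesis
      unfolding moments zeta_moment_def Suc_eq_plus1[symmetric] Suc_phi c_phi neg
      using shift[of "inverse 2"] shift[of "of_nat p"] by simp
  qed
  have "(\<lambda>k. \<sigma> (\<lambda>x. x ^ (phi k - 1))) \<longlonglongrightarrow>
      (1 - 1 * 2) * (E0 * (1 - 0 / of_nat p) * (1 - inverse (of_nat p)))"
    unfolding eq divide_inverse[of "_ ^ _" "of_nat p"] divide_inverse[of 0]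
    by (intro tendsto_mult tendsto_diff tendsto_const bernoulli_phi_tendsto p_power_phi_tendsto E
        unit_power_phi_tendsto half_in_Zp_units)
  then show "(\<lambda>k. \<sigma> (\<lambda>x. x ^ (phi k - 1))) \<longlonglongrightarrow> - E0 * (1 - inverse (of_nat p))" by simp
qed

text \<open>
  Near \<open>s = -1\<close> the branch is \<open>N(h) / (1 - \<langle>c\<rangle>\<^sup>h)\<close> with \<open>h = s + 1\<close>, where \<open>N\<close> is the Mellin
  transform of the half-shift measure and \<open>1 - \<langle>c\<rangle>\<^sup>h = - h E(h)\<close>. So the residue is
  \<open>- N(0) / E(0)\<close>.
\<close>

lemma half_shift_residue:
  assumes \<sigma>: "\<sigma> \<in> bounded_measures (Zp_units :: 'k set)"
    and moments: "\<And>n. \<sigma> (\<lambda>x. x ^ n) = (1 - inverse 2 ^ n) * zeta_moment c n"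
    and c: "odd c" "c > 1" "coprime c p"
  shows "has_residue (branch p (pfrac p \<sigma> (r_elt c)) (- 1)) (- 1) (1 - inverse (of_nat p :: 'k))"
proof -
  define a :: 'k where "a = angle p (of_nat c)"
  have u: "(of_nat c :: 'k) \<in> Zp_units" by (rule of_nat_in_Zp_units[OF c(3)])
  have a: "vabs (a - 1) \<le> 1 / real p" unfolding a_def by (rule angle_close_1[OF u])
  have a1: "a \<noteq> 1" unfolding a_def by (rule angle_nat_neq_1[OF c(2,3)])
  obtain E where E: "\<And>n. vabs (E n) \<le> 1" "E 0 \<noteq> 0"
    "\<And>h. h \<in> power_disc p \<Longrightarrow> h \<noteq> 0 \<Longrightarrow> (\<lambda>n. E n * h ^ n) sums ((padic_power a h - 1) / h)"
    "(\<lambda>k. (a ^ phi k - 1) / of_nat (phi k)) \<longlonglongrightarrow> E 0"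
    by (rule padic_log_series[OF a a1]) blast
  obtain N C where N: "\<And>n. vabs (N n) \<le> C" "N 0 = \<sigma> inverse"
    "\<And>s. s \<in> power_disc p \<Longrightarrow> (\<lambda>n. N n * (s + 1) ^ n) sums mellin p \<sigma> (- 1) s"
    by (rule mellin_analytic[OF \<sigma>]) blast
  have N0: "N 0 = - E 0 * (1 - inverse (of_nat p))"
    unfolding N(2) by (rule half_shift_inverse_moment[OF \<sigma> moments c(3) E(4)[unfolded a_def]])
  have pinv: "1 - inverse (of_nat p) \<noteq> (0 :: 'k)"
  proof -
    have "(of_nat p :: 'k) \<noteq> of_nat 1" using p_pos unfolding of_nat_eq_iff by simp
    then show ?thesis by auto
  qed
  have E0: "0 < vabs (E 0)" "vabs (E 0) \<le> 1" using E(1,2) by auto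
  obtain Q where Q: "Q 0 = N 0 / E 0"
    "\<And>h d v. vabs h < vabs (E 0) \<Longrightarrow> (\<lambda>n. E n * h ^ n) sums d \<Longrightarrow> (\<lambda>n. N n * h ^ n) sums v
      \<Longrightarrow> d \<noteq> 0 \<and> (\<lambda>n. Q n * h ^ n) sums (v / d)"
    by (rule quotient_power_series[of E N C, OF E(1,2) N(1)]) (rule that)
  have Q0: "Q 0 = - (1 - inverse (of_nat p))" unfolding Q(1) N0 using E(2) by simp
  \<comment> \<open>The Laurent series is \<open>- Q(h) / h\<close>.\<close>
  define F where "F = fls_shift 1 (fps_to_fls (- Abs_fps Q))"
  have Fnth: "fls_nth F k = (if k + 1 < 0 then 0 else - Q (nat (k + 1)))" for k
    by (simp add: F_def)
  have sub: "fls_subdegree F = - 1"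
    by (rule fls_subdegree_eqI) (use Q0 pinv in \<open>auto simp: Fnth\<close>)
  have val: "(\<lambda>n. fls_nth F (- 1 + int n) * h powi (- 1 + int n)) sums branch p (pfrac p \<sigma> (r_elt c)) (- 1) s"
    if h: "h \<noteq> 0" "vabs h < vabs (E 0)" "s + 1 = h" for h s
  proof -
    have hd: "h \<in> power_disc p" using h E0 q_radius_gt_1 by (simp add: power_disc_iff)
    have "s = h + - of_nat 1" using h(3) by (simp add: algebra_simps)
    then have sd: "s \<in> power_disc p"
      using power_disc_add[OF hd power_disc_minus[OF power_disc_of_nat[of 1]]] by simp
    define D where "D = (padic_power a h - 1) / h"
    have "D \<noteq> 0" and "(\<lambda>n. Q n * h ^ n) sums (mellin p \<sigma> (- 1) s / D)"
      using Q(2)[OF h(2) E(3)[OF hd h(1)], of "mellin p \<sigma> (- 1) s"] N(3)[OF sd] unfolding h(3) D_def by auto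
    from sums_cmult[OF this(2), of "- inverse h"]
    have sums: "(\<lambda>n. - inverse h * (Q n * h ^ n)) sums (- inverse h * (mellin p \<sigma> (- 1) s / D))" .
    have "h powi (- 1 + int n) = inverse h * h ^ n" for n
      using h(1) power_int_add[of h "- 1" "int n"] by (simp add: power_int_minus)
    then have terms: "fls_nth F (- 1 + int n) * h powi (- 1 + int n) = - inverse h * (Q n * h ^ n)" for n
      by (simp add: Fnth mult_ac)
    have mr: "mellin p (r_elt c) (- 1) s = - (h * D)"
      using mellin_r_elt'[OF sd c(3), of "- 1"] h by (simp add: D_def a_def)
    have "mellin p (r_elt c) (- 1) s \<noteq> 0" unfolding mr using h(1) \<open>D \<noteq> 0\<close> by simp
    then have "branch p (pfrac p \<sigma> (r_elt c)) (- 1) s = mellin p \<sigma> (- 1) s / - (h * D)"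
      using branch_pfrac[OF _ r_elt_in_denominators[OF c] sd, of \<sigma> "- 1"] \<sigma> mr by (simp add: Iwasawa_simps)
    also have "\<dots> = - inverse h * (mellin p \<sigma> (- 1) s / D)"
      by (simp add: divide_inverse mult_ac)
    finally show ?thesis using sums unfolding terms by simp
  qed
  show ?thesis
    unfolding has_residue_def
  proof (intro exI[of _ F] exI[of _ "vabs (E 0)"] conjI allI impI)
    show "vabs (E 0) > 0" by (rule E0(1))
    show "1 - inverse (of_nat p) = fls_residue F" using Q0 by (simp add: Fnth)
    fix s :: 'k assume s: "0 < vabs (s - - 1) \<and> vabs (s - - 1) < vabs (E 0)"
    show "(\<lambda>n. fls_nth F (fls_subdegree F + int n) * (s - - 1) powi (fls_subdegree F + int n))
        sums branch p (pfrac p \<sigma> (r_elt c)) (- 1) s"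
      unfolding sub using s by (intro val) auto
  qed
qed

end

section \<open>The half-shift zeta pseudomeasure and its branches\<close>

theorem theorem4p15:
  fixes p :: nat
    and Z_half Z_cl :: "'k::complete_ultrametric_field pseudomeasure"
  assumes "prime p" and "odd p"
    and "finite_extension_of_Qp p TYPE('k)"
    and "is_half_shift_zeta p Z_half"
    and "is_classical_zeta p Z_cl"
  shows "Z_half =
           of_measure p (\<lambda>f. dirac Zp_units 1 f - dirac Zp_units (inverse 2) f)
             \<otimes>\<^bsub>pseudomeasures p\<^esub> Z_cl
    \<and> (\<forall>j. \<forall>s \<in> power_disc p. \<not> ([j = - 1] (mod (int p - 1)) \<and> s = - 1) \<longrightarrow>
         branch p Z_half j s =
           (1 - teichmueller p 2 powi (- j) * padic_power (angle p 2) (- s))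
             * zeta_branch p Z_cl j (- s))
    \<and> (\<forall>j. \<forall>n::nat. [int n = j] (mod (int p - 1)) \<longrightarrow>
         branch p Z_half j (of_nat n) =
           (1 - of_nat p ^ n) * (bernpoly (n + 1) (1 / 2) / of_nat (n + 1)))
    \<and> has_residue (branch p Z_half (- 1)) (- 1) (1 - inverse (of_nat p))"
proof -
  interpret padic_field p "TYPE('k)"
    using assms(1-3) by unfold_locales (auto simp: finite_extension_of_Qp_def)
  obtain c \<mu> where c: "odd c" "c > 1" "coprime c p" and \<mu>: "is_half_shift_measure c \<mu>"
    and Zh: "Z_half = pfrac p (restrict_measure Zp_units \<mu>) (r_elt c)"
    using assms(4) unfolding is_half_shift_zeta_def by blast
  obtain \<rho> where \<rho>: "\<rho> \<in> bounded_measures Zp_units" "\<And>n. \<rho> (\<lambda>x. x ^ n) = zeta_moment c n"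
    "Z_cl = pfrac p \<rho> (r_elt c)"
    by (rule classical_zeta_pfrac[OF assms(5) c]) blast
  define \<sigma> where "\<sigma> = restrict_measure Zp_units \<mu>"
  have r: "(r_elt c :: 'k functional) \<in> denominators p" by (rule r_elt_in_denominators[OF c])
  have c0: "c > 0" using c(2) by simp
  have \<sigma>: "\<sigma> \<in> bounded_measures Zp_units"
    unfolding \<sigma>_def using \<mu> by (intro restrict_measure_bounded) (simp add: is_half_shift_measure_def)
  have moments: "\<sigma> (\<lambda>x. x ^ n) = (1 - inverse 2 ^ n) * zeta_moment c n" for n
    unfolding \<sigma>_def half_shift_restricted_moment[OF \<mu> c0 \<rho>(1,2)] \<rho>(2) ..
  have Zh': "Z_half = pfrac p \<sigma> (r_elt c)" unfolding Zh \<sigma>_def ..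
  have identity: "Z_half = of_measure p half_shift_factor \<otimes>\<^bsub>pseudomeasures p\<^esub> Z_cl"
    unfolding Zh \<rho>(3) half_shift_factor_times_pfrac[OF \<rho>(1) r] half_shift_eq_convolution[OF \<mu> c0 \<rho>(1,2)] ..
  show ?thesis
  proof (intro conjI allI ballI impI)
    show "Z_half = of_measure p (\<lambda>f. dirac Zp_units 1 f - dirac Zp_units (inverse 2) f)
        \<otimes>\<^bsub>pseudomeasures p\<^esub> Z_cl"
      using identity unfolding half_shift_factor_def .
  next
    fix j and s :: 'k assume s: "s \<in> power_disc p" "\<not> ([j = - 1] (mod (int p - 1)) \<and> s = - 1)"
    show "branch p Z_half j s = (1 - teichmueller p 2 powi (- j) * padic_power (angle p 2) (- s))
        * zeta_branch p Z_cl j (- s)"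
      unfolding identity branch_half_shift_times[OF assms(5) s] mellin_half_shift_factor[OF s(1)]
        zeta_branch_def minus_minus ..
  next
    fix j and n :: nat assume j: "[int n = j] (mod (int p - 1))"
    have "mellin p \<tau> j (of_nat n) = \<tau> (\<lambda>x. x ^ n)" if "\<tau> \<in> bounded_measures Zp_units" for \<tau> :: "'k functional"
      unfolding mellin_eq using character_of_nat[OF j] by (rule measure_cong[OF that])
    then have mellin: "mellin p \<sigma> j (of_nat n) = \<sigma> (\<lambda>x. x ^ n)"
      "mellin p (r_elt c) j (of_nat n) = (1 - of_nat c ^ Suc n :: 'k)"
      using \<sigma> r_elt_bounded[OF c(3)] by (auto simp: r_elt_moment)
    have nz: "(1 - of_nat c ^ Suc n :: 'k) \<noteq> 0" by (rule r_elt_moment_nonzero[OF c(2)])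
    have "branch p Z_half j (of_nat n) = \<sigma> (\<lambda>x. x ^ n) / (1 - of_nat c ^ Suc n)"
      unfolding Zh' mellin[symmetric]
      by (rule branch_pfrac[OF _ r power_disc_of_nat]) (use \<sigma> nz mellin in \<open>auto simp: Iwasawa_simps\<close>)
    moreover have "(1 - h) * - (u * v * (b / d)) / u = v * ((h - 1) * b / d)" if "u \<noteq> 0" for h u v b d :: 'k
    proof -
      have eq: "(1 - h) * - (u * v * (b / d)) = u * (v * ((h - 1) * b / d))"
        by (simp add: divide_inverse algebra_simps)
      show ?thesis unfolding eq using that by simp
    qed
    ultimately show "branch p Z_half j (of_nat n)
        = (1 - of_nat p ^ n) * (bernpoly (n + 1) (1 / 2) / of_nat (n + 1))"
      using nz by (simp only: moments zeta_moment_def Suc_eq_plus1[symmetric] bernpoly_half)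
  next
    show "has_residue (branch p Z_half (- 1)) (- 1) (1 - inverse (of_nat p))"
      unfolding Zh' by (rule half_shift_residue[OF \<sigma> moments c])
  qed
qed

end
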